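(* Let $R$ be the map associated with a nonnegative tensor $t$ of order $m\ge2$, a vector $\boldsymbol{\nu}=(\nu_1,\ldots,\nu_d)$ and exponents $p_1,\ldots,p_d\in(1,\infty)$ as defined in the context, and assume that $R(\mathbf{1})>0$ (all entries positive). Let $A\in\mathbb{R}^{d\times d}_+$, $A_{i,k}=(p_i'-1)(\nu_k-\delta_{ik})$ (with $\delta_{ik}$ the Kronecker delta), be the homogeneity matrix of $R$. Let $\mathbf{x}^0\in\mathcal{S}^R_{++}$ and define $(\mathbf{x}^k)_{k=0}^\infty\subset\mathcal{S}^R_{++}$ by $$\mathbf{x}^k=\Big(\frac{R_1(\mathbf{x}^{k-1})}{\|R_1(\mathbf{x}^{k-1})\|_{p_1}},\ldots,\frac{R_d(\mathbf{x}^{k-1})}{\|R_d(\mathbf{x}^{k-1})\|_{p_d}}\Big)\qquad\forall k\in\mathbb{N}.$$ Then there exists a unique $\mathbf{b}\in\mathbb{R}^d_{++}$ such that $A^T\mathbf{b}=\rho(A)\mathbf{b}$ and $\sum_{i=1}^db_i=1$. Set $\gamma=\big(\sum_{i=1}^db_ip_i'-1\big)^{-1}\sum_{i=1}^db_ip_i'$; then $\gamma>1$. Furthermore: (1) (Contractive case) If $\rho(A)<1$, then there exist unique $\mathbf{u}\in\mathcal{S}^R_{++}$ and $\lambda>0$ such that $(\lambda,\mathbf{u})$ is an eigenpair of $R$. Moreover, $\lambda=r(R)$, $\lim_{k\to\infty}\mathbf{x}^k=\mathbf{u}$ and $$\mu_{\mathbf{b}}(\mathbf{x}^k,\mathbf{u})\le\Big(\frac{\mu_{\mathbf{b}}(\mathbf{x}^1,\mathbf{x}^0)}{1-\rho(A)}\Big)\rho(A)^k\qquad\forall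 k\in\mathbb{N}.$$ (2) (Non-expansive case) If $\rho(A)=1$, there exists $\mathbf{u}\in\mathcal{S}^R_+$ such that $(r(R),\mathbf{u})$ is an eigenpair of $R$, and for every $\mathbf{y}\in\mathcal{S}^R_{++}$, $$r(R)=\lim_{k\to\infty}\Big(\prod_{i=1}^d\|R^k_i(\mathbf{y})\|_{p_i}^{b_i}\Big)^{\frac{\gamma-1}{k}}=\sup_{\mathbf{x}\in\mathcal{K}^R_{+,0}}\limsup_{k\to\infty}\Big(\prod_{i=1}^d\|R^k_i(\mathbf{x})\|_{p_i}^{b_i}\Big)^{\frac{\gamma-1}{k}}=\lim_{k\to\infty}\Big(\sup_{\mathbf{x}\in\mathcal{S}^R_+}\prod_{i=1}^d\|R^k_i(\mathbf{x})\|_{p_i}^{b_i}\Big)^{\frac{\gamma-1}{k}}.$$ Moreover, if $DR(\mathbf{1})$ is irreducible, then $\mathbf{u}\in\mathcal{S}^R_{++}$ and it is the unique positive eigenvector of $R$ (in $\mathcal{S}^R_{++}$). If additionally $DR(\mathbf{1})$ is primitive, then $\lim_{k\to\infty}\mathbf{x}^k=\mathbf{u}$. (3) (Collatz–Wielandt principle) If $\rho(A)\le1$, then $$\inf_{\mathbf{x}\in\mathcal{S}^R_{++}}\check{\mathrm{cw}}(\mathbf{x})=r(R)=\max_{\mathbf{y}\in\mathcal{S}^R_+}\widehat{\mathrm{cw}}(\mathbf{y}),$$ where $$\check{\mathrm{cw}}(\mathbf{x})=\prod_{i=1}^d\Big(\max_{j_i\in[n_i]}\frac{R_{i,j_i}(\mathbf{x})}{x_{i,j_i}}\Big)^{(\gamma-1)b_i}\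 \ (\mathbf{x}\in\mathcal{S}^R_{++}),\qquad\widehat{\mathrm{cw}}(\mathbf{y})=\prod_{i=1}^d\Big(\min_{j_i\in[n_i],\,y_{i,j_i}>0}\frac{R_{i,j_i}(\mathbf{y})}{y_{i,j_i}}\Big)^{(\gamma-1)b_i}\ \ (\mathbf{y}\in\mathcal{S}^R_+).$$ Moreover, for every $k\in\mathbb{N}$, $$\widehat{\mathrm{cw}}(\mathbf{x}^k)\le\widehat{\mathrm{cw}}(\mathbf{x}^{k+1})\le r(R)\le\check{\mathrm{cw}}(\mathbf{x}^{k+1})\le\check{\mathrm{cw}}(\mathbf{x}^k),$$ and for every $\epsilon>0$ and $k\in\mathbb{N}$, if $\check{\mathrm{cw}}(\mathbf{x}^k)-\widehat{\mathrm{cw}}(\mathbf{x}^k)<\epsilon$, then $$\Big|\frac{\check{\mathrm{cw}}(\mathbf{x}^k)+\widehat{\mathrm{cw}}(\mathbf{x}^k)}{2}-r(R)\Big|\le\frac{\epsilon}{2}.$$ Also, if $\lim_{k\to\infty}\mathbf{x}^k=\mathbf{u}$ for a positive eigenvector $\mathbf{u}\in\mathcal{S}^R_{++}$ of $R$, then $\lim_{k\to\infty}\check{\mathrm{cw}}(\mathbf{x}^k)=\lim_{k\to\infty}\widehat{\mathrm{cw}}(\mathbf{x}^k)=r(R)$. Finally, if $DR(\mathbf{1})$ is irreducible, then for every eigenpair $(\theta,\mathbf{w})\in\mathbb{R}_+\times\mathcal{S}^R_+$ of $R$ such that $\mathbf{w}\notin\mathcal{S}^R_{++}$, it holds $\theta<r(R)$.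 (4) (Irreducible tensors) Define $\bar R(\mathbf{x})=\mathbf{x}+R(\mathbf{x})$ for every $\mathbf{x}\in\mathcal{K}^R_{+,0}$, with iterates $\bar R^{k+1}(\mathbf{y})=\bar R(\bar R^k(\mathbf{y}))$. If for every $\mathbf{y}\in\mathcal{S}^R_+$ there exists $\kappa\in\mathbb{N}$ such that $\bar R^\kappa(\mathbf{y})>0$, then every nonnegative eigenvector of $R$ is positive. In particular, if $\mathbf{u}\in\mathcal{S}^R_{++}$ is the unique positive eigenvector of $R$, then it is the unique eigenvector of $R$ in $\mathcal{S}^R_+$.
   Context: $\mathbb{N}=\{1,2,\ldots\}$, $[n]=\{1,\ldots,n\}$, $\rho$ is the spectral radius, $\mathbf{1}$ is the vector of all ones. For $p\in(1,\infty)$, $p'=p/(p-1)$ and $\psi_p(\mathbf{z})=(|z_1|^{p-1}\mathrm{sign}(z_1),\ldots,|z_n|^{p-1}\mathrm{sign}(z_n))$ for $\mathbf{z}\in\mathbb{R}^n$. Let $d\ge1$, $\boldsymbol{\nu}=(\nu_1,\ldots,\nu_d)\in\mathbb{N}^d$ with $\sum_{i=1}^d\nu_i=m$, $m\ge2$; $s_1=1$, $s_{k+1}=s_k+\nu_k$. Let $n_1,\ldots,n_d\in\mathbb{N}$ and let $t$ be a real tensor of order $m$ with nonnegative entries $t_{j_1,\ldots,j_m}$, in which the index in position $q$ ranges over $[n_i]$ whenever $s_i\le q<s_i+\nu_i$. Let $\tau(\mathbf{z}_1,\ldots,\mathbf{z}_m)=\sum_{j_1,\ldots,j_m}t_{j_1,\ldots,j_m}z_{1,j_1}\cdots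 z_{m,j_m}$ be the associated multilinear form and let $T_q=\nabla_{\mathbf{z}_q}\tau$ be its gradient with respect to the $q$-th argument, i.e. $T_{q,j}(\mathbf{z}_1,\ldots,\mathbf{z}_m)$ is the sum over all indices other than $j_q$, with $j_q=j$ fixed, of $t_{j_1,\ldots,j_m}\prod_{r\ne q}z_{r,j_r}$. Let $V=\mathbb{R}^{n_1}\times\cdots\times\mathbb{R}^{n_d}$, and define $R=(R_1,\ldots,R_d)\colon V\to V$ by $$R_i(\mathbf{x}_1,\ldots,\mathbf{x}_d)=\psi_{p_i'}\big(T_{s_i}(\underbrace{\mathbf{x}_1,\ldots,\mathbf{x}_1}_{\nu_1},\ldots,\underbrace{\mathbf{x}_d,\ldots,\mathbf{x}_d}_{\nu_d})\big),\qquad i\in[d],$$ with components $R_{i,j_i}$; $R^k=(R^k_1,\ldots,R^k_d)$ denotes the $k$-th iterate and $DR(\mathbf{1})$ the Jacobian matrix at $\mathbf{1}$. $\mathcal{S}^R=\{\mathbf{v}\in V:\|\mathbf{v}_i\|_{p_i}=1\ \forall i\in[d]\}$ ($\|\cdot\|_p$ the usual $p$-norm); $\mathcal{S}^R_+$ and $\mathcal{S}^R_{++}$ are the subsets of vectors of $\mathcal{S}^R$ with all entries nonnegative, respectively positive; $\mathcal{K}^R_{+,0}=(\mathbb{R}^{n_1}_+\setminus\{0\})\times\cdots\times(\mathbb{R}^{n_d}_+\setminus\{0\})$. For $\lambda\in\mathbb{R}$ and $\mathbf{x}\in\mathcal{S}^R$, $(\lambda,\mathbf{x})$ is an eigenpair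 of $R$ (and $\mathbf{x}$ an eigenvector) if $R_i(\mathbf{x})=\mathrm{sign}(\lambda)|\lambda|^{p_i'-1}\mathbf{x}_i$ for all $i\in[d]$. The spectral radius of $R$ is $r(R)=\sup\{|\lambda|:\exists\,\mathbf{x}\in\mathcal{S}^R\text{ such that }(\lambda,\mathbf{x})\text{ is an eigenpair of }R\}$. For vectors $\mathbf{x},\mathbf{y}\in V$ with positive entries, $$\mu_{\mathbf{b}}(\mathbf{x},\mathbf{y})=\sum_{i=1}^db_i\ln\Big[\Big(\max_{j_i\in[n_i]}\frac{x_{i,j_i}}{y_{i,j_i}}\Big)\Big(\max_{l_i\in[n_i]}\frac{y_{i,l_i}}{x_{i,l_i}}\Big)\Big].$$ A nonnegative matrix $M\in\mathbb{R}^{n\times n}$ is irreducible if $(I+M)^{n-1}$ has positive entries, and primitive if some power $M^\nu$, $\nu\in\mathbb{N}$, has positive entries. *)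

theory Defs
  imports "HOL-Analysis.Analysis" "Jordan_Normal_Form.Spectral_Radius"
begin

unbundle no vec_syntax

text \<open>
  All indices start at 0: block \<open>i < d\<close> stands for \<open>i + 1 \<in> [d]\<close>, and so on. A vector
  \<open>x = (x_1, \<dots>, x_d)\<close> of \<open>V = \<real>^(n_1) \<times> \<dots> \<times> \<real>^(n_d)\<close> is the function \<open>x :: nat \<Rightarrow> nat \<Rightarrow> real\<close>
  whose entry \<open>j < n i\<close> of block \<open>i < d\<close> is \<open>x i j\<close> and which is \<open>0\<close> at all other index pairs,
  so that equality of functions is equality in \<open>V\<close>, and the product topology on
  \<open>nat \<Rightarrow> nat \<Rightarrow> real\<close> induces the usual topology of \<open>V\<close>.
\<close>

type_synonym blockvec = "nat \<Rightarrow> nat \<Rightarrow> real"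

definition block_space :: "nat \<Rightarrow> (nat \<Rightarrow> nat) \<Rightarrow> blockvec set" where
  "block_space d n = {x. \<forall>i j. \<not> (i < d \<and> j < n i) \<longrightarrow> x i j = 0}"

definition ones :: "nat \<Rightarrow> (nat \<Rightarrow> nat) \<Rightarrow> blockvec" where
  "ones d n = (\<lambda>i j. if i < d \<and> j < n i then 1 else 0)"

definition nonneg_entries :: "nat \<Rightarrow> (nat \<Rightarrow> nat) \<Rightarrow> blockvec \<Rightarrow> bool" where
  "nonneg_entries d n x \<longleftrightarrow> (\<forall>i<d. \<forall>j<n i. 0 \<le> x i j)"

definition pos_entries :: "nat \<Rightarrow> (nat \<Rightarrow> nat) \<Rightarrow> blockvec \<Rightarrow> bool" where
  "pos_entries d n x \<longleftrightarrow> (\<forall>i<d. \<forall>j<n i. 0 < x i j)"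

definition pnorm :: "nat \<Rightarrow> real \<Rightarrow> (nat \<Rightarrow> real) \<Rightarrow> real" where
  "pnorm N q z = (\<Sum>j<N. \<bar>z j\<bar> powr q) powr (1 / q)"

definition conj_exp :: "real \<Rightarrow> real" where
  "conj_exp q = q / (q - 1)"

definition psi :: "real \<Rightarrow> real \<Rightarrow> real" where
  "psi q z = \<bar>z\<bar> powr (q - 1) * sgn z"

subsection \<open>The multilinear form of a tensor and the associated map\<close>

text \<open>\<open>offset \<nu> i\<close> is \<open>s_(i+1) - 1\<close>; the order of the tensor is \<open>m = offset \<nu> d\<close>.\<close>

definition offset :: "(nat \<Rightarrow> nat) \<Rightarrow> nat \<Rightarrow> nat" where
  "offset \<nu> i = (\<Sum>k<i. \<nu> k)"

definition block_of :: "(nat \<Rightarrow> nat) \<Rightarrow> nat \<Rightarrow> nat" where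
  "block_of \<nu> q = (THE i. offset \<nu> i \<le> q \<and> q < offset \<nu> i + \<nu> i)"

text \<open>A multi-index \<open>(j_1, \<dots>, j_m)\<close> is an extensional function on the positions \<open>{..<m}\<close>.\<close>

definition multi_indices :: "nat \<Rightarrow> (nat \<Rightarrow> nat) \<Rightarrow> (nat \<Rightarrow> nat) \<Rightarrow> (nat \<Rightarrow> nat) set" where
  "multi_indices d \<nu> n = (\<Pi>\<^sub>E q\<in>{..<offset \<nu> d}. {..<n (block_of \<nu> q)})"

definition multilinear_form ::
    "nat \<Rightarrow> (nat \<Rightarrow> nat) \<Rightarrow> (nat \<Rightarrow> nat) \<Rightarrow> ((nat \<Rightarrow> nat) \<Rightarrow> real) \<Rightarrow> (nat \<Rightarrow> nat \<Rightarrow> real) \<Rightarrow> real" where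
  "multilinear_form d \<nu> n t z = (\<Sum>j\<in>multi_indices d \<nu> n. t j * (\<Prod>r<offset \<nu> d. z r (j r)))"

text \<open>Component \<open>l\<close> of the gradient with respect to argument \<open>q\<close>:\<close>

definition form_gradient ::
    "nat \<Rightarrow> (nat \<Rightarrow> nat) \<Rightarrow> (nat \<Rightarrow> nat) \<Rightarrow> ((nat \<Rightarrow> nat) \<Rightarrow> real) \<Rightarrow> nat \<Rightarrow> nat
      \<Rightarrow> (nat \<Rightarrow> nat \<Rightarrow> real) \<Rightarrow> real" where
  "form_gradient d \<nu> n t q l z =
     (\<Sum>j\<in>{j \<in> multi_indices d \<nu> n. j q = l}. t j * (\<Prod>r\<in>{..<offset \<nu> d} - {q}. z r (j r)))"

lemma finite_multi_indices: "finite (multi_indices d \<nu> n)"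
  unfolding multi_indices_def by (rule finite_PiE) auto

lemma has_field_derivative_multilinear_form:
  assumes "q < offset \<nu> d"
  shows "((\<lambda>h. multilinear_form d \<nu> n t (z(q := (z q)(l := h))))
           has_field_derivative form_gradient d \<nu> n t q l z) (at h)"
proof -
  let ?P = "\<lambda>j. \<Prod>r\<in>{..<offset \<nu> d} - {q}. z r (j r)"
  have split: "(\<Prod>r<offset \<nu> d. (z(q := (z q)(l := y))) r (j r))
                 = (if j q = l then y else z q (j q)) * ?P j" for j y
    using assms by (subst prod.remove[of _ q]) auto
  have "((\<lambda>y. \<Sum>j\<in>multi_indices d \<nu> n. t j * ((if j q = l then y else z q (j q)) * ?P j))
          has_field_derivative
          (\<Sum>j\<in>multi_indices d \<nu> n. if j q = l then t j * ?P j else 0)) (at h)"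
    by (rule DERIV_sum) (auto intro!: derivative_eq_intros)
  then show ?thesis
    unfolding multilinear_form_def form_gradient_def split
    by (simp add: sum.inter_filter finite_multi_indices)
qed

definition tensor_map ::
    "nat \<Rightarrow> (nat \<Rightarrow> nat) \<Rightarrow> (nat \<Rightarrow> nat) \<Rightarrow> (nat \<Rightarrow> real) \<Rightarrow> ((nat \<Rightarrow> nat) \<Rightarrow> real)
      \<Rightarrow> blockvec \<Rightarrow> blockvec" where
  "tensor_map d \<nu> n p t x = (\<lambda>i l.
     if i < d \<and> l < n i
     then psi (conj_exp (p i)) (form_gradient d \<nu> n t (offset \<nu> i) l (\<lambda>q. x (block_of \<nu> q)))
     else 0)"

definition homogeneity_matrix :: "nat \<Rightarrow> (nat \<Rightarrow> nat) \<Rightarrow> (nat \<Rightarrow> real) \<Rightarrow> real mat" where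
  "homogeneity_matrix d \<nu> p =
     mat d d (\<lambda>(i, k). (conj_exp (p i) - 1) * (real (\<nu> k) - (if i = k then 1 else 0)))"

subsection \<open>Spheres, eigenpairs and the spectral radius of a map\<close>

definition sphere_set :: "nat \<Rightarrow> (nat \<Rightarrow> nat) \<Rightarrow> (nat \<Rightarrow> real) \<Rightarrow> blockvec set" where
  "sphere_set d n p = {x \<in> block_space d n. \<forall>i<d. pnorm (n i) (p i) (x i) = 1}"

definition sphere_nonneg :: "nat \<Rightarrow> (nat \<Rightarrow> nat) \<Rightarrow> (nat \<Rightarrow> real) \<Rightarrow> blockvec set" where
  "sphere_nonneg d n p = {x \<in> sphere_set d n p. nonneg_entries d n x}"

definition sphere_pos :: "nat \<Rightarrow> (nat \<Rightarrow> nat) \<Rightarrow> (nat \<Rightarrow> real) \<Rightarrow> blockvec set" where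
  "sphere_pos d n p = {x \<in> sphere_set d n p. pos_entries d n x}"

definition cone_nonzero :: "nat \<Rightarrow> (nat \<Rightarrow> nat) \<Rightarrow> blockvec set" where
  "cone_nonzero d n =
     {x \<in> block_space d n. nonneg_entries d n x \<and> (\<forall>i<d. \<exists>j<n i. x i j \<noteq> 0)}"

definition normalize_blocks :: "nat \<Rightarrow> (nat \<Rightarrow> nat) \<Rightarrow> (nat \<Rightarrow> real) \<Rightarrow> blockvec \<Rightarrow> blockvec" where
  "normalize_blocks d n p x =
     (\<lambda>i j. if i < d \<and> j < n i then x i j / pnorm (n i) (p i) (x i) else 0)"

definition eigenpair ::
    "nat \<Rightarrow> (nat \<Rightarrow> nat) \<Rightarrow> (nat \<Rightarrow> real) \<Rightarrow> (blockvec \<Rightarrow> blockvec) \<Rightarrow> real \<Rightarrow> blockvec \<Rightarrow> bool" where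
  "eigenpair d n p F \<theta> x \<longleftrightarrow> x \<in> sphere_set d n p \<and>
     (\<forall>i<d. \<forall>j<n i. F x i j = sgn \<theta> * \<bar>\<theta>\<bar> powr (conj_exp (p i) - 1) * x i j)"

definition map_eigenvector ::
    "nat \<Rightarrow> (nat \<Rightarrow> nat) \<Rightarrow> (nat \<Rightarrow> real) \<Rightarrow> (blockvec \<Rightarrow> blockvec) \<Rightarrow> blockvec \<Rightarrow> bool" where
  "map_eigenvector d n p F x \<longleftrightarrow> (\<exists>\<theta>. eigenpair d n p F \<theta> x)"

text \<open>The set is bounded for \<open>F = tensor_map d \<nu> n p t\<close>, since \<open>sphere_set d n p\<close> is compact.\<close>

definition map_spectral_radius ::
    "nat \<Rightarrow> (nat \<Rightarrow> nat) \<Rightarrow> (nat \<Rightarrow> real) \<Rightarrow> (blockvec \<Rightarrow> blockvec) \<Rightarrow> real" where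
  "map_spectral_radius d n p F = Sup {\<bar>\<theta>\<bar> |\<theta>. \<exists>x. eigenpair d n p F \<theta> x}"

definition weight_vector :: "nat \<Rightarrow> real mat \<Rightarrow> real \<Rightarrow> real Matrix.vec \<Rightarrow> bool" where
  "weight_vector d A \<rho> b \<longleftrightarrow> b \<in> carrier_vec d \<and> (\<forall>i<d. 0 < b $ i) \<and>
     transpose_mat A *\<^sub>v b = \<rho> \<cdot>\<^sub>v b \<and> (\<Sum>i<d. b $ i) = 1"

definition mu :: "nat \<Rightarrow> (nat \<Rightarrow> nat) \<Rightarrow> real Matrix.vec \<Rightarrow> blockvec \<Rightarrow> blockvec \<Rightarrow> real" where
  "mu d n b x y = (\<Sum>i<d. b $ i * ln (Max ((\<lambda>j. x i j / y i j) ` {..<n i})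
                                        * Max ((\<lambda>l. y i l / x i l) ` {..<n i})))"

definition norm_product ::
    "nat \<Rightarrow> (nat \<Rightarrow> nat) \<Rightarrow> (nat \<Rightarrow> real) \<Rightarrow> real Matrix.vec \<Rightarrow> blockvec \<Rightarrow> real" where
  "norm_product d n p b x = (\<Prod>i<d. pnorm (n i) (p i) (x i) powr (b $ i))"

text \<open>\<open>cw_upper\<close> and \<open>cw_lower\<close> are the functions written cw with a check and with a hat.\<close>

definition cw_upper ::
    "nat \<Rightarrow> (nat \<Rightarrow> nat) \<Rightarrow> (blockvec \<Rightarrow> blockvec) \<Rightarrow> real \<Rightarrow> real Matrix.vec \<Rightarrow> blockvec \<Rightarrow> real" where
  "cw_upper d n F \<gamma> b x =
     (\<Prod>i<d. Max ((\<lambda>j. F x i j / x i j) ` {..<n i}) powr ((\<gamma> - 1) * b $ i))"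

definition cw_lower ::
    "nat \<Rightarrow> (nat \<Rightarrow> nat) \<Rightarrow> (blockvec \<Rightarrow> blockvec) \<Rightarrow> real \<Rightarrow> real Matrix.vec \<Rightarrow> blockvec \<Rightarrow> real" where
  "cw_lower d n F \<gamma> b y =
     (\<Prod>i<d. Min ((\<lambda>j. F y i j / y i j) ` {j. j < n i \<and> 0 < y i j}) powr ((\<gamma> - 1) * b $ i))"

subsection \<open>Jacobian matrix, irreducible and primitive matrices\<close>

text \<open>Rows and columns of the Jacobian are indexed by the coordinates of \<open>V\<close> in
  lexicographic order.\<close>

definition coords :: "nat \<Rightarrow> (nat \<Rightarrow> nat) \<Rightarrow> (nat \<times> nat) list" where
  "coords d n = [(i, j). i \<leftarrow> [0..<d], j \<leftarrow> [0..<n i]]"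

definition partial_deriv ::
    "(blockvec \<Rightarrow> blockvec) \<Rightarrow> nat \<times> nat \<Rightarrow> nat \<times> nat \<Rightarrow> blockvec \<Rightarrow> real" where
  "partial_deriv F = (\<lambda>(i, j) (k, l) x. deriv (\<lambda>h. F (x(k := (x k)(l := h))) i j) (x k l))"

definition jacobian_matrix ::
    "nat \<Rightarrow> (nat \<Rightarrow> nat) \<Rightarrow> (blockvec \<Rightarrow> blockvec) \<Rightarrow> blockvec \<Rightarrow> real mat" where
  "jacobian_matrix d n F x = mat (length (coords d n)) (length (coords d n))
     (\<lambda>(a, c). partial_deriv F (coords d n ! a) (coords d n ! c) x)"

definition pos_mat :: "real mat \<Rightarrow> bool" where
  "pos_mat M \<longleftrightarrow> (\<forall>i<dim_row M. \<forall>j<dim_col M. 0 < M $$ (i, j))"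

text \<open>For nonnegative square matrices:\<close>

definition irreducible_matrix :: "real mat \<Rightarrow> bool" where
  "irreducible_matrix M \<longleftrightarrow> pos_mat ((1\<^sub>m (dim_row M) + M) ^\<^sub>m (dim_row M - 1))"

definition primitive_matrix :: "real mat \<Rightarrow> bool" where
  "primitive_matrix M \<longleftrightarrow> (\<exists>k\<ge>1. pos_mat (M ^\<^sub>m k))"

end

theory Submission
  imports Defs
begin

text \<open>
  The whole theorem rests on two properties of \<open>R\<close> on nonnegative block vectors: it preserves the
  entrywise order, and scaling block \<open>k\<close> by \<open>c k > 0\<close> multiplies block \<open>i\<close> of the value by
  \<open>\<Prod>k. c k powr A_ik\<close>. If \<open>A\<^sup>T b = \<rho> b\<close> with \<open>b > 0\<close>, then the weighted geometric mean
  \<open>\<Prod>i. (c i) powr (b i)\<close> of these factors is the \<open>\<rho>\<close>-th power of the weighted mean of the scalings.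
  So \<open>x \<le> c y\<close> gives \<open>R x \<le> c' R y\<close> where the mean of \<open>c'\<close> is the \<open>\<rho>\<close>-th power of the mean of \<open>c\<close>.
  The analysis below is carried out for arbitrary maps with these properties, in the locales
  \<open>multihom_map\<close> and \<open>multihom_graph\<close>; the tensor supplies an instance.

  Weights. \<open>A = D (1 \<nu>\<^sup>T - I)\<close> with \<open>D = diag (p_i' - 1)\<close>, so the eigenvector equations can be solved by
  hand: \<open>\<rho>\<close> is the root of \<open>\<Sum>k. \<nu>_k D_k / (\<rho> + D_k) = 1\<close>, and \<open>b_k\<close> is proportional to
  \<open>\<nu>_k / (\<rho> + D_k)\<close>. The positive left eigenvector bounds the modulus of every eigenvalue,
  so this root is the spectral radius (\<open>spectral_radius_weight_vector\<close>).

  Contraction. For \<open>\<rho> < 1\<close> the normalised map contracts the Hilbert metric \<open>mu\<close> by the factor \<open>\<rho>\<close>; its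
  iterates stay at a bounded distance from the starting point, hence in a compact part of the positive
  sphere, and converge to a fixed point (\<open>contraction_fixed_point\<close>).

  Comparison. If \<open>m x \<le> R x\<close> and \<open>R y \<le> M y\<close> with \<open>x \<ge> 0\<close> and \<open>y > 0\<close> on the spheres, then evaluating both inequalities where
  \<open>x / y\<close> is maximal shows that the mean of \<open>m\<close> is at most that of \<open>M\<close>, provided \<open>\<rho> \<le> 1\<close>
  (\<open>collatz_wielandt_compare\<close>). Applied to \<open>\<bar>x\<bar>\<close> this bounds all real eigenvalues.

  Existence for \<open>\<rho> \<le> 1\<close>. The entrywise powers \<open>R(x) powr e\<close> with \<open>e < 1\<close> have homogeneity matrix \<open>e A\<close> and the
  same \<open>b\<close>, so they are contractive. Their positive fixed points \<open>u_e\<close> have a limit point \<open>u\<close> as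
  \<open>e\<close> tends to \<open>1\<close>; it is an eigenvector of \<open>R\<close>, and since the entries of \<open>u_e\<close> are at most \<open>1\<close> the quotients
  \<open>R(u_e) / u_e\<close> are almost bounded by the
  block eigenvalues of \<open>u\<close>. This gives the eigenvector and both
  Collatz-Wielandt formulas at once (\<open>collatz_wielandt_eigenvector\<close>). On the sphere the block
  eigenvalues all come from one number because \<open>\<langle>T_i(u), u_i\<rangle>\<close> is the value of the
  multilinear form for every \<open>i\<close> (\<open>block_eigenvalues_from_one\<close>).

  Irreducible and primitive Jacobians. A nonzero entry of \<open>DR(1)\<close> comes from a positive tensor entry
  and thus from an edge of a dependency graph on the coordinates. If \<open>w \<le> v\<close>, \<open>v > 0\<close> and \<open>R w\<close>, \<open>R v\<close>
  agree in a coordinate, then \<open>w\<close>, \<open>v\<close> agree at all its successors; this yields uniqueness when the graph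
  is strongly connected, and strict decrease of \<open>mu\<close> after \<open>K\<close> steps, hence convergence, when all pairs of
  coordinates are joined by paths of length \<open>K\<close>. Positivity of \<open>u\<close> comes from the growth of \<open>R\<close> along edges,
  which bounds the ratios inside the blocks of \<open>u_e\<close> uniformly in \<open>e\<close>.
\<close>

section \<open>Pointwise convergence of block vectors\<close>

lemma tendsto_fun_iff:
  fixes f :: "'a \<Rightarrow> 'b \<Rightarrow> 'c::topological_space"
  shows "(f \<longlongrightarrow> l) F \<longleftrightarrow> (\<forall>i. ((\<lambda>x. f x i) \<longlongrightarrow> l i) F)"
proof -
  have "(f \<longlongrightarrow> l) F \<longleftrightarrow> limitin (product_topology (\<lambda>i. euclidean) UNIV) f l F"
    by (simp add: euclidean_product_topology)
  also have "\<dots> \<longleftrightarrow> (\<forall>i. ((\<lambda>x. f x i) \<longlongrightarrow> l i) F)"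
    by (subst limitin_componentwise) auto
  finally show ?thesis .
qed

lemma blockvec_tendsto_iff:
  fixes f :: "'a \<Rightarrow> blockvec"
  shows "(f \<longlongrightarrow> l) F \<longleftrightarrow> (\<forall>i j. ((\<lambda>x. f x i j) \<longlongrightarrow> l i j) F)"
  by (simp add: tendsto_fun_iff)

text \<open>
  Bolzano-Weierstrass for finitely many coordinates, by passing to a further subsequence for each new
  coordinate.
\<close>

lemma bounded_pointwise_convergent_subsequence:
  fixes f :: "nat \<Rightarrow> 'a \<Rightarrow> real"
  assumes "finite S" and "\<And>s. s \<in> S \<Longrightarrow> \<exists>B. \<forall>k. \<bar>f k s\<bar> \<le> B"
  shows "\<exists>\<phi>. strict_mono \<phi> \<and> (\<forall>s\<in>S. convergent (\<lambda>k. f (\<phi> k) s))"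
  using assms
proof (induction S rule: finite_induct)
  case empty
  then show ?case using strict_mono_id by auto
next
  case (insert a S)
  then obtain \<phi> where \<phi>: "strict_mono \<phi>" "\<forall>s\<in>S. convergent (\<lambda>k. f (\<phi> k) s)" by auto
  obtain B where B: "\<forall>k. \<bar>f k a\<bar> \<le> B" using insert.prems by blast
  have "bounded (range (\<lambda>k. f (\<phi> k) a))"
    unfolding bounded_iff using B by (auto intro!: exI[of _ B])
  then obtain l r where r: "strict_mono r" "((\<lambda>k. f (\<phi> k) a) \<circ> r) \<longlonglongrightarrow> l"
    using bounded_imp_convergent_subsequence by blast
  have "convergent (\<lambda>k. f ((\<phi> \<circ> r) k) s)" if s: "s \<in> insert a S" for s
  proof (cases "s = a")
    case True
    then show ?thesis using r(2) by (auto simp: convergent_def o_def)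
  next
    case False
    then have "convergent (\<lambda>k. f (\<phi> k) s)" using s \<phi>(2) by auto
    then show ?thesis
      using r(1) convergent_subseq_convergent[of "\<lambda>k. f (\<phi> k) s" r] by (simp add: o_def)
  qed
  then show ?case using strict_mono_o[OF \<phi>(1) r(1)] by blast
qed

lemma blockvec_convergent_subsequence:
  assumes "\<And>k. f k \<in> block_space d n"
    and "\<And>k i j. i < d \<Longrightarrow> j < n i \<Longrightarrow> \<bar>f k i j\<bar> \<le> B"
  shows "\<exists>\<phi> l. strict_mono (\<phi> :: nat \<Rightarrow> nat) \<and> (\<lambda>k. f (\<phi> k)) \<longlonglongrightarrow> l \<and> l \<in> block_space d n"
proof -
  define S where "S = (SIGMA i:{..<d}. {..<n i})"
  have "finite S" unfolding S_def by auto
  moreover have "\<exists>B. \<forall>k. \<bar>f k (fst s) (snd s)\<bar> \<le> B" if "s \<in> S" for s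
    using that assms(2) unfolding S_def by (intro exI[of _ B]) auto
  ultimately obtain \<phi> where \<phi>: "strict_mono \<phi>"
    "\<forall>s\<in>S. convergent (\<lambda>k. f (\<phi> k) (fst s) (snd s))"
    using bounded_pointwise_convergent_subsequence[of S "\<lambda>k s. f k (fst s) (snd s)"] by blast
  define l where "l = (\<lambda>i j. if i < d \<and> j < n i then lim (\<lambda>k. f (\<phi> k) i j) else 0)"
  have "(\<lambda>k. f (\<phi> k) i j) \<longlonglongrightarrow> l i j" for i j
  proof (cases "i < d \<and> j < n i")
    case True
    then have "(i, j) \<in> S" unfolding S_def by auto
    then show ?thesis using \<phi>(2) True unfolding l_def
      by (auto simp: convergent_LIMSEQ_iff)
  next
    case False
    then have "f (\<phi> k) i j = 0" for k using assms(1) unfolding block_space_def by auto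
    then show ?thesis using False unfolding l_def by simp
  qed
  then have "(\<lambda>k. f (\<phi> k)) \<longlonglongrightarrow> l" by (simp add: blockvec_tendsto_iff)
  moreover have "l \<in> block_space d n" unfolding l_def block_space_def by auto
  ultimately show ?thesis using \<phi>(1) by blast
qed

section \<open>Weighted geometric means\<close>

definition weighted_gm :: "nat \<Rightarrow> real Matrix.vec \<Rightarrow> (nat \<Rightarrow> real) \<Rightarrow> real" where
  "weighted_gm d b c = (\<Prod>i<d. c i powr (b $ i))"

lemma weighted_gm_cong: "(\<And>i. i < d \<Longrightarrow> c i = e i) \<Longrightarrow> weighted_gm d b c = weighted_gm d b e"
  unfolding weighted_gm_def by (intro prod.cong) auto

lemma weighted_gm_mult: "weighted_gm d b (\<lambda>i. c i * e i) = weighted_gm d b c * weighted_gm d b e"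
  unfolding weighted_gm_def by (simp add: powr_mult prod.distrib)

lemma weighted_gm_divide: "weighted_gm d b (\<lambda>i. c i / e i) = weighted_gm d b c / weighted_gm d b e"
  unfolding weighted_gm_def by (simp add: powr_divide prod_dividef)

lemma weighted_gm_powr: "weighted_gm d b (\<lambda>i. c i powr s) = weighted_gm d b c powr s"
  unfolding weighted_gm_def by (simp add: prod_powr_distrib powr_powr mult.commute)

lemma weighted_gm_nonneg [simp]: "0 \<le> weighted_gm d b c"
  unfolding weighted_gm_def by (intro prod_nonneg) auto

lemma weighted_gm_pos: "(\<And>i. i < d \<Longrightarrow> 0 < c i) \<Longrightarrow> 0 < weighted_gm d b c"
  unfolding weighted_gm_def by (intro prod_pos) force

lemma weighted_gm_one [simp]: "weighted_gm d b (\<lambda>i. 1) = 1"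
  unfolding weighted_gm_def by simp

lemma weighted_gm_mono:
  assumes "\<And>i. i < d \<Longrightarrow> 0 < b $ i" and "\<And>i. i < d \<Longrightarrow> 0 \<le> c i" and "\<And>i. i < d \<Longrightarrow> c i \<le> e i"
  shows "weighted_gm d b c \<le> weighted_gm d b e"
  unfolding weighted_gm_def using assms
  by (intro prod_mono) (auto intro!: powr_mono2 simp: less_imp_le)

lemma weighted_gm_strict_mono:
  assumes "\<And>i. i < d \<Longrightarrow> 0 < b $ i" and "\<And>i. i < d \<Longrightarrow> 0 < c i" and "\<And>i. i < d \<Longrightarrow> c i \<le> e i"
    and "i < d" and "c i < e i"
  shows "weighted_gm d b c < weighted_gm d b e"
  unfolding weighted_gm_def
proof (rule prod_mono_strict[of i])
  show "c i powr b $ i < e i powr b $ i"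
    using assms(1,2,5) \<open>i < d\<close> by (intro powr_less_mono2) (auto simp: less_imp_le)
  show "0 \<le> c k powr b $ k \<and> c k powr b $ k \<le> e k powr b $ k" if "k \<in> {..<d}" for k
    using assms(1,2,3)[of k] that by (auto intro!: powr_mono2 simp: less_imp_le)
  show "0 < e k powr b $ k" if "k \<in> {..<d}" for k
    using assms(2,3)[of k] that by auto
qed (use assms in auto)

lemma tendsto_weighted_gm:
  assumes "\<And>i. i < d \<Longrightarrow> 0 < b $ i"
    and "\<And>i. i < d \<Longrightarrow> ((\<lambda>s. c s i) \<longlongrightarrow> e i) F"
    and "\<And>i s. i < d \<Longrightarrow> 0 \<le> c s i"
  shows "((\<lambda>s. weighted_gm d b (c s)) \<longlongrightarrow> weighted_gm d b e) F"
  unfolding weighted_gm_def using assms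
  by (intro tendsto_prod tendsto_powr') auto

text \<open>
  The factor gained by block \<open>i\<close> of the value of a map with homogeneity matrix \<open>a\<close> when the blocks of the
  argument are scaled by \<open>c\<close>.
\<close>

definition hom_factor :: "nat \<Rightarrow> (nat \<Rightarrow> nat \<Rightarrow> real) \<Rightarrow> (nat \<Rightarrow> real) \<Rightarrow> nat \<Rightarrow> real" where
  "hom_factor d a c i = (\<Prod>k<d. c k powr a i k)"

lemma hom_factor_pos: "(\<And>k. k < d \<Longrightarrow> 0 < c k) \<Longrightarrow> 0 < hom_factor d a c i"
  unfolding hom_factor_def by (intro prod_pos) force

text \<open>
  Exchanging the two products turns the left eigenvector equation for the exponents into a power.
\<close>

lemma weighted_gm_hom_factor:
  assumes "\<And>k. k < d \<Longrightarrow> 0 < c k"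
    and "\<And>k. k < d \<Longrightarrow> (\<Sum>i<d. b $ i * a i k) = \<kappa> * b $ k"
  shows "weighted_gm d b (hom_factor d a c) = weighted_gm d b c powr \<kappa>"
proof -
  have "weighted_gm d b (hom_factor d a c) = (\<Prod>i<d. \<Prod>k<d. c k powr (b $ i * a i k))"
    unfolding weighted_gm_def hom_factor_def by (simp add: prod_powr_distrib powr_powr mult.commute)
  also have "\<dots> = (\<Prod>k<d. \<Prod>i<d. c k powr (b $ i * a i k))" by (rule prod.swap)
  also have "\<dots> = (\<Prod>k<d. c k powr (\<kappa> * b $ k))"
  proof (intro prod.cong refl)
    fix k assume k: "k \<in> {..<d}"
    then have "c k \<noteq> 0" using assms(1)[of k] by auto
    then have "(\<Prod>i<d. c k powr (b $ i * a i k)) = c k powr (\<Sum>i<d. b $ i * a i k)"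
      by (simp add: powr_sum)
    then show "(\<Prod>i<d. c k powr (b $ i * a i k)) = c k powr (\<kappa> * b $ k)"
      using assms(2)[of k] k by simp
  qed
  also have "\<dots> = weighted_gm d b c powr \<kappa>"
    unfolding weighted_gm_def by (simp add: prod_powr_distrib powr_powr mult.commute)
  finally show ?thesis .
qed

section \<open>Block norms\<close>

lemma pnorm_nonneg [simp]: "0 \<le> pnorm N q z"
  unfolding pnorm_def by simp

lemma pnorm_abs [simp]: "pnorm N q (\<lambda>j. \<bar>z j\<bar>) = pnorm N q z"
  unfolding pnorm_def by simp

lemma pnorm_cong: "(\<And>j. j < N \<Longrightarrow> z j = w j) \<Longrightarrow> pnorm N q z = pnorm N q w"
  unfolding pnorm_def by (metis (no_types, lifting) lessThan_iff sum.cong)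

lemma pnorm_powr: "0 < q \<Longrightarrow> pnorm N q z powr q = (\<Sum>j<N. \<bar>z j\<bar> powr q)"
  unfolding pnorm_def by (simp add: powr_powr sum_nonneg)

lemma pnorm_mono:
  assumes "0 < q" and "\<And>j. j < N \<Longrightarrow> \<bar>z j\<bar> \<le> \<bar>w j\<bar>"
  shows "pnorm N q z \<le> pnorm N q w"
  unfolding pnorm_def using assms
  by (intro powr_mono2 sum_mono sum_nonneg) auto

lemma pnorm_scale: "0 < q \<Longrightarrow> pnorm N q (\<lambda>j. c * z j) = \<bar>c\<bar> * pnorm N q z"
  unfolding pnorm_def
  by (simp add: abs_mult powr_mult sum_distrib_left[symmetric] powr_powr)

lemma abs_le_pnorm:
  assumes "0 < q" and "j < N"
  shows "\<bar>z j\<bar> \<le> pnorm N q z"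
proof -
  have "\<bar>z j\<bar> powr q \<le> (\<Sum>j<N. \<bar>z j\<bar> powr q)"
    using assms by (intro member_le_sum) auto
  then have "(\<bar>z j\<bar> powr q) powr (1 / q) \<le> pnorm N q z"
    unfolding pnorm_def using assms by (intro powr_mono2) auto
  then show ?thesis using assms by (simp add: powr_powr)
qed

lemma pnorm_pos: "0 < q \<Longrightarrow> j < N \<Longrightarrow> z j \<noteq> 0 \<Longrightarrow> 0 < pnorm N q z"
  using abs_le_pnorm[of q j N z] by linarith

lemma pnorm_nonzero_entry: "pnorm N q z \<noteq> 0 \<Longrightarrow> \<exists>j<N. z j \<noteq> 0"
  unfolding pnorm_def by (rule ccontr) auto

lemma tendsto_pnorm:
  assumes "0 < q" and "\<And>j. j < N \<Longrightarrow> ((\<lambda>s. z s j) \<longlongrightarrow> w j) F"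
  shows "((\<lambda>s. pnorm N q (z s)) \<longlongrightarrow> pnorm N q w) F"
  unfolding pnorm_def using assms
  by (intro tendsto_powr' tendsto_sum tendsto_rabs tendsto_const) (auto intro!: always_eventually sum_nonneg)

section \<open>Blockwise maximal ratios\<close>

definition top_ratio :: "(nat \<Rightarrow> nat) \<Rightarrow> blockvec \<Rightarrow> blockvec \<Rightarrow> nat \<Rightarrow> real" where
  "top_ratio n x y i = Max ((\<lambda>j. x i j / y i j) ` {..<n i})"

lemma top_ratio_ge: "j < n i \<Longrightarrow> x i j / y i j \<le> top_ratio n x y i"
  unfolding top_ratio_def by (intro Max_ge) auto

lemma top_ratio_bound: "j < n i \<Longrightarrow> 0 < y i j \<Longrightarrow> x i j \<le> top_ratio n x y i * y i j"
  using top_ratio_ge[of j n i x y] by (simp add: divide_le_eq)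

lemma top_ratio_le_iff: "0 < n i \<Longrightarrow> top_ratio n x y i \<le> C \<longleftrightarrow> (\<forall>j<n i. x i j / y i j \<le> C)"
  unfolding top_ratio_def by (subst Max_le_iff) auto

lemma top_ratio_attained:
  assumes "0 < n i" shows "\<exists>j<n i. top_ratio n x y i = x i j / y i j"
proof -
  have "top_ratio n x y i \<in> (\<lambda>j. x i j / y i j) ` {..<n i}"
    unfolding top_ratio_def using assms by (intro Max_in) auto
  then show ?thesis by auto
qed

lemma tendsto_Max_image:
  fixes f :: "'a \<Rightarrow> 'b \<Rightarrow> real"
  assumes "finite S" "S \<noteq> {}" and "\<And>s. s \<in> S \<Longrightarrow> ((\<lambda>x. f x s) \<longlongrightarrow> l s) F"
  shows "((\<lambda>x. Max (f x ` S)) \<longlongrightarrow> Max (l ` S)) F"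
  using assms
proof (induction S rule: finite_ne_induct)
  case (insert a S)
  then show ?case by (auto intro!: tendsto_max)
qed auto

lemma tendsto_Min_image:
  fixes f :: "'a \<Rightarrow> 'b \<Rightarrow> real"
  assumes "finite S" "S \<noteq> {}" and "\<And>s. s \<in> S \<Longrightarrow> ((\<lambda>x. f x s) \<longlongrightarrow> l s) F"
  shows "((\<lambda>x. Min (f x ` S)) \<longlongrightarrow> Min (l ` S)) F"
  using assms
proof (induction S rule: finite_ne_induct)
  case (insert a S)
  then show ?case by (auto intro!: tendsto_min)
qed auto

section \<open>The weighted Hilbert metric\<close>

lemma nonneg_entriesD: "nonneg_entries d n x \<Longrightarrow> i < d \<Longrightarrow> j < n i \<Longrightarrow> 0 \<le> x i j"
  unfolding nonneg_entries_def by auto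

lemma pos_entriesD: "pos_entries d n x \<Longrightarrow> i < d \<Longrightarrow> j < n i \<Longrightarrow> 0 < x i j"
  unfolding pos_entries_def by auto

lemma pos_imp_nonneg_entries: "pos_entries d n x \<Longrightarrow> nonneg_entries d n x"
  unfolding pos_entries_def nonneg_entries_def by (auto simp: less_imp_le)

lemma sphere_pos_subset_nonneg: "x \<in> sphere_pos d n p \<Longrightarrow> x \<in> sphere_nonneg d n p"
  unfolding sphere_pos_def sphere_nonneg_def by (auto intro: pos_imp_nonneg_entries)

lemma block_space_eqI:
  assumes "x \<in> block_space d n" "y \<in> block_space d n"
    and "\<And>i j. i < d \<Longrightarrow> j < n i \<Longrightarrow> x i j = y i j"
  shows "x = y"
proof (intro ext)
  fix i j
  show "x i j = y i j"
  proof (cases "i < d \<and> j < n i")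
    case True then show ?thesis using assms(3) by blast
  next
    case False then show ?thesis using assms(1,2) unfolding block_space_def by simp
  qed
qed

text \<open>
  Block dimensions, norm exponents and positive weights, without any map.
\<close>

locale weighted_blocks =
  fixes d :: nat and n :: "nat \<Rightarrow> nat" and p :: "nat \<Rightarrow> real" and b :: "real Matrix.vec"
  assumes d_pos: "0 < d" and n_pos: "i < d \<Longrightarrow> 0 < n i" and p_gt_1: "i < d \<Longrightarrow> 1 < p i"
    and b_pos: "i < d \<Longrightarrow> 0 < b $ i"
begin

abbreviation "gm \<equiv> weighted_gm d b"
abbreviation "tr \<equiv> top_ratio n"
abbreviation "nrm \<equiv> normalize_blocks d n p"

lemma sphere_posD:
  assumes "x \<in> sphere_pos d n p"
  shows "x \<in> block_space d n" "pos_entries d n x" "i < d \<Longrightarrow> pnorm (n i) (p i) (x i) = 1"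
  using assms unfolding sphere_pos_def sphere_set_def by auto

lemma sphere_nonnegD:
  assumes "x \<in> sphere_nonneg d n p"
  shows "x \<in> block_space d n" "nonneg_entries d n x" "i < d \<Longrightarrow> pnorm (n i) (p i) (x i) = 1"
  using assms unfolding sphere_nonneg_def sphere_set_def by auto

lemma sphere_entry_le_1:
  assumes "x \<in> sphere_nonneg d n p" "i < d" "j < n i" shows "x i j \<le> 1"
  using abs_le_pnorm[of "p i" j "n i" "x i"] sphere_nonnegD(3)[OF assms(1,2)] p_gt_1[OF assms(2)] assms(3)
  by auto

lemma sphere_nonzero_entry:
  assumes "x \<in> sphere_nonneg d n p" "i < d" shows "\<exists>j<n i. 0 < x i j"
proof -
  obtain j where j: "j < n i" "x i j \<noteq> 0"
    using pnorm_nonzero_entry[of "n i" "p i" "x i"] sphere_nonnegD(3)[OF assms] by auto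
  then show ?thesis using nonneg_entriesD[OF sphere_nonnegD(2)[OF assms(1)] assms(2) j(1)]
    by (auto simp: order_less_le)
qed

lemma sphere_nonneg_in_cone: "x \<in> sphere_nonneg d n p \<Longrightarrow> x \<in> cone_nonzero d n"
  unfolding cone_nonzero_def using sphere_nonnegD(1,2)[of x] sphere_nonzero_entry[of x] by (auto simp: order_less_le)

lemma top_ratio_pos:
  assumes "pos_entries d n y" "i < d" "j < n i" "0 < x i j" shows "0 < tr x y i"
proof -
  have "0 < x i j / y i j" using assms pos_entriesD[OF assms(1-3)] by simp
  then show ?thesis using top_ratio_ge[of j n i x y] assms(3) by linarith
qed

lemma top_ratio_pos':
  assumes "pos_entries d n x" "pos_entries d n y" "i < d" shows "0 < tr x y i"
  using top_ratio_pos[OF assms(2,3), of 0 x] pos_entriesD[OF assms(1,3), of 0] n_pos[OF assms(3)] by auto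

lemma top_ratio_sphere_pos:
  assumes "x \<in> sphere_nonneg d n p" "pos_entries d n y" "i < d" shows "0 < tr x y i"
  using sphere_nonzero_entry[OF assms(1,3)] top_ratio_pos[OF assms(2,3)] by auto

text \<open>
  Two vectors of equal norm: \<open>x \<le> c y\<close> in block \<open>i\<close> forces \<open>c \<ge> 1\<close>.
\<close>

lemma top_ratio_sphere_ge_1:
  assumes "x \<in> sphere_nonneg d n p" "y \<in> sphere_pos d n p" "i < d"
  shows "1 \<le> tr x y i"
proof -
  let ?c = "tr x y i"
  have c: "0 < ?c" using top_ratio_sphere_pos assms sphere_posD(2) by blast
  have p: "0 < p i" using p_gt_1[OF assms(3)] by simp
  have "1 = pnorm (n i) (p i) (x i)" using sphere_nonnegD(3)[OF assms(1,3)] by simp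
  also have "\<dots> \<le> pnorm (n i) (p i) (\<lambda>j. ?c * y i j)"
  proof (rule pnorm_mono[OF p])
    fix j assume j: "j < n i"
    have "0 \<le> x i j" using nonneg_entriesD[OF sphere_nonnegD(2)[OF assms(1)] assms(3) j] .
    moreover have "0 < y i j" using pos_entriesD[OF sphere_posD(2)[OF assms(2)] assms(3) j] .
    ultimately show "\<bar>x i j\<bar> \<le> \<bar>?c * y i j\<bar>"
      using top_ratio_bound[of j n i y x] j c by auto
  qed
  also have "\<dots> = ?c" using pnorm_scale[OF p] c sphere_posD(3)[OF assms(2,3)] by simp
  finally show ?thesis .
qed

lemma top_ratio_le_prod:
  assumes "pos_entries d n x" "pos_entries d n y" "pos_entries d n z" "i < d"
  shows "tr x z i \<le> tr x y i * tr y z i"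
proof -
  have "x i j / z i j \<le> tr x y i * tr y z i" if j: "j < n i" for j
  proof -
    have pos: "0 < x i j" "0 < y i j" "0 < z i j" using assms j pos_entriesD by auto
    have "x i j / z i j = (x i j / y i j) * (y i j / z i j)" using pos by simp
    also have "\<dots> \<le> tr x y i * tr y z i"
      using pos top_ratio_ge[of j n i x y, OF j] top_ratio_ge[of j n i y z, OF j] top_ratio_pos'[OF assms(1,2,4)]
      by (intro mult_mono) auto
    finally show ?thesis .
  qed
  then show ?thesis using top_ratio_le_iff n_pos assms(4) by auto
qed

lemma mu_eq_ln_gm:
  assumes "pos_entries d n x" "pos_entries d n y"
  shows "mu d n b x y = ln (gm (tr x y)) + ln (gm (tr y x))"
proof -
  have *: "ln (gm (tr x y)) = (\<Sum>i<d. b $ i * ln (tr x y i))" 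
    if "pos_entries d n x" "pos_entries d n y" for x y
  proof -
    have "tr x y i \<noteq> 0" if "i < d" for i using top_ratio_pos'[OF \<open>pos_entries d n x\<close> \<open>pos_entries d n y\<close> that] by simp
    then show ?thesis unfolding weighted_gm_def by (subst ln_prod) auto
  qed
  show ?thesis
    unfolding mu_def *[OF assms] *[OF assms(2,1)] sum.distrib[symmetric]
  proof (intro sum.cong refl)
    fix i assume "i \<in> {..<d}"
    then have "0 < tr x y i" "0 < tr y x i" using top_ratio_pos' assms by auto
    then have "ln (tr x y i * tr y x i) = ln (tr x y i) + ln (tr y x i)" by (rule ln_mult_pos)
    then show "b $ i * ln (Max ((\<lambda>j. x i j / y i j) ` {..<n i}) * Max ((\<lambda>l. y i l / x i l) ` {..<n i}))
      = b $ i * ln (tr x y i) + b $ i * ln (tr y x i)"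
      unfolding top_ratio_def by (simp add: distrib_left)
  qed
qed

lemma gm_top_pos: "pos_entries d n x \<Longrightarrow> pos_entries d n y \<Longrightarrow> 0 < gm (tr x y)"
  using top_ratio_pos' by (intro weighted_gm_pos) auto

lemma mu_commute: "mu d n b x y = mu d n b y x"
  unfolding mu_def by (simp add: mult.commute)

lemma mu_triangle:
  assumes "pos_entries d n x" "pos_entries d n y" "pos_entries d n z"
  shows "mu d n b x z \<le> mu d n b x y + mu d n b y z"
proof -
  have *: "ln (gm (tr x z)) \<le> ln (gm (tr x y)) + ln (gm (tr y z))"
    if "pos_entries d n x" "pos_entries d n y" "pos_entries d n z" for x y z
  proof -
    have "gm (tr x z) \<le> gm (\<lambda>i. tr x y i * tr y z i)"
      using that top_ratio_pos' top_ratio_le_prod b_pos by (intro weighted_gm_mono) (auto simp: less_imp_le)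
    then have "gm (tr x z) \<le> gm (tr x y) * gm (tr y z)" by (simp add: weighted_gm_mult)
    then show ?thesis
      using gm_top_pos that by (subst ln_mult_pos[symmetric]) (auto simp: )
  qed
  show ?thesis using *[OF assms] *[OF assms(3,2,1)] mu_eq_ln_gm assms by auto
qed

lemma top_ratio_scale_left:
  assumes "i < d" "0 < c" "\<And>j. j < n i \<Longrightarrow> x' i j = c * x i j"
  shows "tr x' y i = c * tr x y i"
proof (rule antisym)
  have "x' i j / y i j \<le> c * tr x y i" if j: "j < n i" for j
    using mult_left_mono[OF top_ratio_ge[of j n i x y, OF j], of c] assms(2,3) j by simp
  then show "tr x' y i \<le> c * tr x y i"
    using top_ratio_le_iff n_pos[OF assms(1)] by blast
  obtain j where j: "j < n i" "tr x y i = x i j / y i j" using top_ratio_attained n_pos[OF assms(1)] by blast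
  then show "c * tr x y i \<le> tr x' y i" using top_ratio_ge[of j n i x' y] assms by auto
qed

lemma top_ratio_scale_right:
  assumes "i < d" "0 < c" "\<And>j. j < n i \<Longrightarrow> y' i j = c * y i j"
  shows "tr x y' i = tr x y i / c"
proof -
  have "x i j / y' i j = inverse c * x i j / y i j" if "j < n i" for j using assms that by (simp add: field_simps)
  then have "tr x y' i = tr (\<lambda>i j. inverse c * x i j) y i"
    unfolding top_ratio_def by (intro arg_cong[where f = Max] image_cong) auto
  also have "\<dots> = inverse c * tr x y i" using assms by (intro top_ratio_scale_left) auto
  finally show ?thesis by (simp add: field_simps)
qed

lemma mu_scale_left:
  assumes "\<And>i. i < d \<Longrightarrow> 0 < c i" "\<And>i j. i < d \<Longrightarrow> j < n i \<Longrightarrow> x' i j = c i * x i j"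
  shows "mu d n b x' y = mu d n b x y"
proof -
  have "tr x' y i * tr y x' i = tr x y i * tr y x i" if "i < d" for i
  proof -
    have "tr x' y i = c i * tr x y i" "tr y x' i = tr y x i / c i"
      using assms that by (auto intro!: top_ratio_scale_left top_ratio_scale_right)
    then show ?thesis using assms(1)[OF that] by simp
  qed
  then show ?thesis unfolding mu_def top_ratio_def by (intro sum.cong) auto
qed

text \<open>
  On the sphere every summand of \<open>mu\<close> is nonnegative, so \<open>mu\<close> controls each single ratio of entries. This makes
  bounded subsets for \<open>mu\<close> stay away from the boundary of the cone.
\<close>

lemma entry_le_exp_mu:
  assumes "x \<in> sphere_pos d n p" "y \<in> sphere_pos d n p" "i < d" "j < n i"
  shows "x i j \<le> exp (mu d n b x y / b $ i) * y i j"
proof -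
  note pos = sphere_posD(2)[OF assms(1)] sphere_posD(2)[OF assms(2)]
  have ge: "1 \<le> tr x y k" "1 \<le> tr y x k" if "k < d" for k
    using top_ratio_sphere_ge_1 assms that sphere_pos_subset_nonneg by blast+
  have ge': "1 \<le> tr x y k * tr y x k" if "k < d" for k
    using mult_mono[OF ge[OF that]] ge[OF that] by simp
  have "b $ i * ln (tr x y i * tr y x i) \<le> mu d n b x y"
    unfolding mu_def top_ratio_def[symmetric]
  proof (rule member_le_sum[of i])
    show "0 \<le> b $ k * ln (tr x y k * tr y x k)" if "k \<in> {..<d} - {i}" for k
      using ge'[of k] b_pos[of k] that by auto
  qed (use assms in auto)
  moreover have "ln (tr x y i) \<le> ln (tr x y i * tr y x i)"
    using ge[OF assms(3)] by (subst ln_le_cancel_iff) (auto simp: mult_le_cancel_left1)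
  then have "b $ i * ln (tr x y i) \<le> b $ i * ln (tr x y i * tr y x i)"
    using b_pos[OF assms(3)] by (intro mult_left_mono) auto
  ultimately have "b $ i * ln (tr x y i) \<le> mu d n b x y" by linarith
  then have "ln (tr x y i) \<le> mu d n b x y / b $ i" using b_pos[OF assms(3)] by (simp add: field_simps)
  then have "exp (ln (tr x y i)) \<le> exp (mu d n b x y / b $ i)" by simp
  then have "tr x y i \<le> exp (mu d n b x y / b $ i)"
    using ge(1)[OF assms(3)] by simp
  moreover have y: "0 < y i j" using pos_entriesD[OF pos(2) assms(3,4)] .
  ultimately have "tr x y i * y i j \<le> exp (mu d n b x y / b $ i) * y i j"
    by (intro mult_right_mono) auto
  then show ?thesis using top_ratio_bound[of j n i y x, OF assms(4) y] by linarith
qed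

lemma mu_nonneg:
  assumes "x \<in> sphere_pos d n p" "y \<in> sphere_pos d n p" shows "0 \<le> mu d n b x y"
  unfolding mu_def top_ratio_def[symmetric]
proof (rule sum_nonneg)
  fix k assume k: "k \<in> {..<d}"
  have "1 \<le> tr x y k" "1 \<le> tr y x k"
    using top_ratio_sphere_ge_1 assms k sphere_pos_subset_nonneg by auto
  then have "1 \<le> tr x y k * tr y x k" using mult_mono[of 1 "tr x y k" 1 "tr y x k"] by simp
  then show "0 \<le> b $ k * ln (tr x y k * tr y x k)" using b_pos[of k] k by auto
qed

lemma mu_self:
  assumes "pos_entries d n x" shows "mu d n b x x = 0"
proof -
  have "tr x x i = 1" if "i < d" for i
    using top_ratio_attained[of n i x x] n_pos[OF that] pos_entriesD[OF assms that] by force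
  then show ?thesis unfolding mu_def top_ratio_def[symmetric] by simp
qed

lemma mu_zero_imp_eq:
  assumes "x \<in> sphere_pos d n p" "y \<in> sphere_pos d n p" "mu d n b x y = 0"
  shows "x = y"
proof (rule block_space_eqI)
  show "x i j = y i j" if "i < d" "j < n i" for i j
    using entry_le_exp_mu[OF assms(1,2) that] entry_le_exp_mu[OF assms(2,1) that] assms(3)
    by (simp add: mu_commute[of y x])
qed (use assms sphere_posD in auto)

lemma tendsto_if_mu_tendsto_0:
  assumes x: "\<And>k. x k \<in> sphere_pos d n p" and u: "u \<in> sphere_pos d n p"
    and mu: "(\<lambda>k. mu d n b (x k) u) \<longlonglongrightarrow> 0"
  shows "x \<longlonglongrightarrow> u"
proof -
  have "(\<lambda>k. x k i j) \<longlonglongrightarrow> u i j" for i j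
  proof (cases "i < d \<and> j < n i")
    case True
    let ?e = "\<lambda>k. mu d n b (x k) u / b $ i"
    have e: "?e \<longlonglongrightarrow> 0" using tendsto_divide[OF mu tendsto_const, of "b $ i"] b_pos True by fastforce
    have up: "x k i j \<le> exp (?e k) * u i j" for k using entry_le_exp_mu[OF x u] True by auto
    have lo: "exp (- ?e k) * u i j \<le> x k i j" for k
      using entry_le_exp_mu[OF u x, of i j k] True by (simp add: mu_commute[of u] exp_minus field_simps)
    have 1: "(\<lambda>k. exp (?e k) * u i j) \<longlonglongrightarrow> u i j" using tendsto_mult[OF tendsto_exp[OF e] tendsto_const, of "u i j"] by simp
    have 2: "(\<lambda>k. exp (- ?e k) * u i j) \<longlonglongrightarrow> u i j"
      using tendsto_mult[OF tendsto_exp[OF tendsto_minus[OF e]] tendsto_const, of "u i j"] by simp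
    show ?thesis by (rule tendsto_sandwich[OF _ _ 2 1]) (use up lo in auto)
  next
    case False
    have "x k i j = 0" "u i j = 0" for k
      using sphere_posD(1)[OF x[of k]] sphere_posD(1)[OF u] False unfolding block_space_def by blast+
    then show ?thesis by simp
  qed
  then show ?thesis by (simp add: blockvec_tendsto_iff)
qed

lemma sphere_nonneg_limit:
  assumes x: "\<And>k. x k \<in> sphere_nonneg d n p" and lim: "x \<longlonglongrightarrow> z"
  shows "z \<in> sphere_nonneg d n p"
proof -
  have lim': "(\<lambda>k. x k i j) \<longlonglongrightarrow> z i j" for i j using lim by (simp add: blockvec_tendsto_iff)
  have "z i j = 0" if "\<not> (i < d \<and> j < n i)" for i j
  proof -
    have "x k i j = 0" for k using sphere_nonnegD(1)[OF x] that unfolding block_space_def by blast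
    then show ?thesis using lim'[of i j] by (simp add: LIMSEQ_const_iff)
  qed
  moreover have "0 \<le> z i j" if "i < d" "j < n i" for i j
    using nonneg_entriesD[OF sphere_nonnegD(2)[OF x] that] by (intro LIMSEQ_le_const[OF lim']) auto
  moreover have "pnorm (n i) (p i) (z i) = 1" if i: "i < d" for i
  proof -
    have "(\<lambda>k. pnorm (n i) (p i) (x k i)) \<longlonglongrightarrow> pnorm (n i) (p i) (z i)"
      using lim' p_gt_1[OF i] by (intro tendsto_pnorm) auto
    then show ?thesis using sphere_nonnegD(3)[OF x i] by (simp add: LIMSEQ_const_iff)
  qed
  ultimately show ?thesis
    unfolding sphere_nonneg_def sphere_set_def block_space_def nonneg_entries_def by auto
qed

lemma tendsto_top_ratio:
  assumes "(x \<longlongrightarrow> z) G" "(y \<longlongrightarrow> w) G" "pos_entries d n w" "i < d"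
  shows "((\<lambda>s. tr (x s) (y s) i) \<longlongrightarrow> tr z w i) G"
  unfolding top_ratio_def
proof (rule tendsto_Max_image)
  show "{..<n i} \<noteq> {}" using n_pos[OF assms(4)] by auto
  show "((\<lambda>s. x s i j / y s i j) \<longlongrightarrow> z i j / w i j) G" if "j \<in> {..<n i}" for j
    using assms(1,2) pos_entriesD[OF assms(3,4), of j] that unfolding blockvec_tendsto_iff
    by (intro tendsto_divide) force+
qed auto

lemma tendsto_mu:
  assumes "(x \<longlongrightarrow> z) G" "(y \<longlongrightarrow> w) G" "pos_entries d n z" "pos_entries d n w"
  shows "((\<lambda>s. mu d n b (x s) (y s)) \<longlongrightarrow> mu d n b z w) G"
  unfolding mu_def top_ratio_def[symmetric]
proof (intro tendsto_sum tendsto_mult tendsto_const tendsto_ln)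
  fix i assume i: "i \<in> {..<d}"
  show "((\<lambda>s. tr (x s) (y s) i) \<longlongrightarrow> tr z w i) G" "((\<lambda>s. tr (y s) (x s) i) \<longlongrightarrow> tr w z i) G"
    using tendsto_top_ratio assms i by auto
  show "tr z w i * tr w z i \<noteq> 0"
    using top_ratio_pos'[OF assms(3,4), of i] top_ratio_pos'[OF assms(4,3), of i] i by auto
qed

lemma normalize_in_sphere:
  assumes "\<And>i. i < d \<Longrightarrow> \<exists>j<n i. x i j \<noteq> 0"
  shows "nrm x \<in> sphere_set d n p"
proof -
  have "pnorm (n i) (p i) (nrm x i) = 1" if i: "i < d" for i
  proof -
    have p: "0 < p i" using p_gt_1[OF i] by simp
    have N: "0 < pnorm (n i) (p i) (x i)" using assms[OF i] pnorm_pos[OF p] by blast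
    have "pnorm (n i) (p i) (nrm x i)
        = pnorm (n i) (p i) (\<lambda>j. inverse (pnorm (n i) (p i) (x i)) * x i j)"
      unfolding normalize_blocks_def using i by (intro pnorm_cong) (simp add: field_simps)
    also have "\<dots> = 1" using pnorm_scale[OF p] N by simp
    finally show ?thesis .
  qed
  then show ?thesis unfolding sphere_set_def block_space_def by (auto simp: normalize_blocks_def)
qed

lemma pnorm_block_pos: "pos_entries d n x \<Longrightarrow> i < d \<Longrightarrow> 0 < pnorm (n i) (p i) (x i)"
  using pnorm_pos[of "p i" 0 "n i" "x i"] pos_entriesD[of d n x i 0] n_pos[of i] p_gt_1[of i] by simp

lemma normalize_in_sphere_pos:
  assumes "pos_entries d n x" shows "nrm x \<in> sphere_pos d n p"
proof -
  have "nrm x \<in> sphere_set d n p"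
  proof (rule normalize_in_sphere)
    show "\<exists>j<n i. x i j \<noteq> 0" if "i < d" for i
      using pos_entriesD[OF assms that n_pos[OF that]] n_pos[OF that] by (intro exI[of _ 0]) auto
  qed
  moreover have "pos_entries d n (nrm x)"
    unfolding pos_entries_def normalize_blocks_def using pos_entriesD[OF assms] pnorm_block_pos[OF assms] by auto
  ultimately show ?thesis unfolding sphere_pos_def by auto
qed

lemma normalize_scale:
  assumes "pos_entries d n x"
  shows "i < d \<Longrightarrow> j < n i \<Longrightarrow> nrm x i j = inverse (pnorm (n i) (p i) (x i)) * x i j"
  unfolding normalize_blocks_def by (simp add: field_simps)

lemma tendsto_normalize:
  assumes "(x \<longlongrightarrow> z) G" "\<And>i. i < d \<Longrightarrow> pnorm (n i) (p i) (z i) \<noteq> 0"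
  shows "((\<lambda>s. nrm (x s)) \<longlongrightarrow> nrm z) G"
  unfolding blockvec_tendsto_iff
proof (intro allI)
  fix i j
  show "((\<lambda>s. nrm (x s) i j) \<longlongrightarrow> nrm z i j) G"
  proof (cases "i < d \<and> j < n i")
    case True
    then have p: "0 < p i" using p_gt_1[of i] by simp
    have "((\<lambda>s. pnorm (n i) (p i) (x s i)) \<longlongrightarrow> pnorm (n i) (p i) (z i)) G"
      using assms(1) unfolding blockvec_tendsto_iff by (intro tendsto_pnorm p) auto
    then show ?thesis using True assms(2)[of i] assms(1) unfolding blockvec_tendsto_iff normalize_blocks_def
      by (auto intro!: tendsto_divide)
  next
    case False then show ?thesis by (auto simp: normalize_blocks_def)
  qed
qed

lemma mu_normalize:
  assumes "pos_entries d n x" shows "mu d n b (nrm x) y = mu d n b x y"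
  by (rule mu_scale_left[of "\<lambda>i. inverse (pnorm (n i) (p i) (x i))"])
     (use pnorm_block_pos[OF assms] normalize_scale[OF assms] in auto)

lemma mu_normalize_right:
  assumes "pos_entries d n y" shows "mu d n b x (nrm y) = mu d n b x y"
  using mu_normalize[OF assms] mu_commute by metis

lemma pos_entries_ones: "pos_entries d n (ones d n)"
  unfolding pos_entries_def ones_def by auto

lemma sphere_pos_nonempty: "nrm (ones d n) \<in> sphere_pos d n p"
  by (rule normalize_in_sphere_pos[OF pos_entries_ones])

end

section \<open>Order-preserving multihomogeneous maps\<close>

text \<open>
  \<open>a\<close> holds the homogeneity exponents, and \<open>\<kappa>\<close> is their eigenvalue for the left eigenvector \<open>b\<close>. The map is
  kept abstract because the existence proof also applies the theory to entrywise powers of \<open>R\<close>.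
  Continuity is required on the closed cone, since limits of positive vectors may have zero entries.
\<close>

locale multihom_map = weighted_blocks +
  fixes F :: "blockvec \<Rightarrow> blockvec" and a :: "nat \<Rightarrow> nat \<Rightarrow> real" and \<kappa> :: real
  assumes F_block: "F x \<in> block_space d n"
    and F_nonneg: "nonneg_entries d n x \<Longrightarrow> nonneg_entries d n (F x)"
    and F_mono: "\<lbrakk>nonneg_entries d n x; \<And>i j. i < d \<Longrightarrow> j < n i \<Longrightarrow> x i j \<le> y i j; i < d; j < n i\<rbrakk>
      \<Longrightarrow> F x i j \<le> F y i j"
    and F_hom: "\<lbrakk>\<And>k. k < d \<Longrightarrow> 0 < c k; nonneg_entries d n x; i < d; j < n i\<rbrakk>
      \<Longrightarrow> F (\<lambda>i j. c i * x i j) i j = hom_factor d a c i * F x i j"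
    and F_pos_ones: "pos_entries d n (F (ones d n))"
    and F_cont: "\<lbrakk>\<And>s. nonneg_entries d n (f s); f \<longlonglongrightarrow> x\<rbrakk> \<Longrightarrow> (\<lambda>s. F (f s)) \<longlonglongrightarrow> F x"
    and weights: "k < d \<Longrightarrow> (\<Sum>i<d. b $ i * a i k) = \<kappa> * b $ k"
    and \<kappa>_nonneg: "0 \<le> \<kappa>"
begin

abbreviation "hf \<equiv> hom_factor d a"

lemma gm_hf: "(\<And>k. k < d \<Longrightarrow> 0 < c k) \<Longrightarrow> gm (hf c) = gm c powr \<kappa>"
  using weighted_gm_hom_factor weights by blast

text \<open>
  Order preservation and homogeneity in one step; all estimates below apply the map through this lemma or its
  lower counterpart.
\<close>

lemma F_le_hf:
  assumes "nonneg_entries d n x" "nonneg_entries d n y" "\<And>k. k < d \<Longrightarrow> 0 < c k"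
    and "\<And>i j. i < d \<Longrightarrow> j < n i \<Longrightarrow> x i j \<le> c i * y i j" "i < d" "j < n i"
  shows "F x i j \<le> hf c i * F y i j"
proof -
  have "F x i j \<le> F (\<lambda>i j. c i * y i j) i j" using assms by (intro F_mono) auto
  then show ?thesis using F_hom[of c y i j] assms by simp
qed

lemma hf_le_F:
  assumes "nonneg_entries d n x" "nonneg_entries d n y" "\<And>k. k < d \<Longrightarrow> 0 < c k"
    and "\<And>i j. i < d \<Longrightarrow> j < n i \<Longrightarrow> c i * y i j \<le> x i j" "i < d" "j < n i"
  shows "hf c i * F y i j \<le> F x i j"
proof -
  have "nonneg_entries d n (\<lambda>i j. c i * y i j)"
    using assms(2,3) unfolding nonneg_entries_def by (simp add: less_imp_le)
  then have "F (\<lambda>i j. c i * y i j) i j \<le> F x i j" using assms by (intro F_mono) auto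
  then show ?thesis using F_hom[of c y i j] assms by simp
qed

text \<open>
  \<open>x > 0\<close> dominates a blockwise multiple of the all-ones vector, where the map is positive.
\<close>

lemma F_pos:
  assumes "pos_entries d n x" shows "pos_entries d n (F x)"
proof -
  let ?c = "tr (ones d n) x"
  have c: "0 < ?c k" if "k < d" for k using top_ratio_pos'[OF pos_entries_ones assms that] .
  have "F (ones d n) i j \<le> hf ?c i * F x i j" if "i < d" "j < n i" for i j
    using that top_ratio_bound[of _ n _ x] pos_entriesD[OF assms]
    by (intro F_le_hf pos_imp_nonneg_entries[OF assms] pos_imp_nonneg_entries[OF pos_entries_ones] c) auto
  moreover have "0 < hf ?c i" for i using hom_factor_pos c .
  moreover have "0 < F (ones d n) i j" if "i < d" "j < n i" for i j using pos_entriesD[OF F_pos_ones that] .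
  ultimately have "0 < F x i j" if "i < d" "j < n i" for i j
    using that less_le_trans zero_less_mult_pos by blast
  then show ?thesis unfolding pos_entries_def by blast
qed

lemma funpow_F_pos: "pos_entries d n x \<Longrightarrow> pos_entries d n ((F ^^ k) x)"
  by (induction k) (auto intro: F_pos)

lemma funpow_F_nonneg: "nonneg_entries d n x \<Longrightarrow> nonneg_entries d n ((F ^^ k) x)"
  by (induction k) (auto intro: F_nonneg)

lemma top_ratio_F_le:
  assumes "pos_entries d n x" "pos_entries d n y" "i < d"
  shows "tr (F x) (F y) i \<le> hf (tr x y) i"
proof -
  have "F x i j / F y i j \<le> hf (tr x y) i" if j: "j < n i" for j
  proof -
    have "F x i j \<le> hf (tr x y) i * F y i j"
      using assms j top_ratio_pos' top_ratio_bound pos_entriesD[OF assms(2)]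
      by (intro F_le_hf) (auto intro: pos_imp_nonneg_entries)
    then show ?thesis using pos_entriesD[OF F_pos[OF assms(2)] assms(3) j] by (simp add: divide_le_eq)
  qed
  then show ?thesis using top_ratio_le_iff n_pos assms(3) by blast
qed

lemma gm_top_ratio_F_le:
  assumes "pos_entries d n x" "pos_entries d n y"
  shows "gm (tr (F x) (F y)) \<le> gm (tr x y) powr \<kappa>"
proof -
  have "gm (tr (F x) (F y)) \<le> gm (hf (tr x y))"
    using top_ratio_F_le top_ratio_pos' F_pos assms b_pos
    by (intro weighted_gm_mono) (auto simp: less_imp_le)
  then show ?thesis using gm_hf top_ratio_pos' assms by auto
qed

lemma mu_F_le:
  assumes "pos_entries d n x" "pos_entries d n y"
  shows "mu d n b (F x) (F y) \<le> \<kappa> * mu d n b x y"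
proof -
  have *: "ln (gm (tr (F x) (F y))) \<le> \<kappa> * ln (gm (tr x y))"
    if "pos_entries d n x" "pos_entries d n y" for x y
  proof -
    have g: "0 < gm (tr x y)" "0 < gm (tr (F x) (F y))" using gm_top_pos F_pos that by auto
    then have "ln (gm (tr (F x) (F y))) \<le> ln (gm (tr x y) powr \<kappa>)"
      using gm_top_ratio_F_le[OF that] by (subst ln_le_cancel_iff) auto
    then show ?thesis by simp
  qed
  have "mu d n b (F x) (F y) = ln (gm (tr (F x) (F y))) + ln (gm (tr (F y) (F x)))"
    by (intro mu_eq_ln_gm F_pos assms)
  also have "\<dots> \<le> \<kappa> * ln (gm (tr x y)) + \<kappa> * ln (gm (tr y x))"
    using *[OF assms] *[OF assms(2,1)] by simp
  also have "\<dots> = \<kappa> * mu d n b x y" using mu_eq_ln_gm[OF assms] by (simp add: distrib_left)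
  finally show ?thesis .
qed

abbreviation "G x \<equiv> nrm (F x)"

lemma mu_G_le:
  assumes "pos_entries d n x" "pos_entries d n y"
  shows "mu d n b (G x) (G y) \<le> \<kappa> * mu d n b x y"
  using mu_F_le[OF assms] mu_normalize[OF F_pos[OF assms(1)]] mu_normalize_right[OF F_pos[OF assms(2)]]
  by simp

lemma G_sphere_pos: "pos_entries d n x \<Longrightarrow> G x \<in> sphere_pos d n p"
  by (intro normalize_in_sphere_pos F_pos)

lemma iterates_in_sphere:
  assumes x0: "x 0 \<in> sphere_pos d n p" and x: "\<And>k. x (Suc k) = G (x k)"
  shows "x k \<in> sphere_pos d n p"
proof (induction k)
  case (Suc k)
  then show ?case unfolding x by (rule G_sphere_pos[OF sphere_posD(2)])
qed (rule x0)

lemma fixed_point_imp_eigen: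
  assumes "u \<in> sphere_pos d n p" "G u = u" "i < d" "j < n i"
  shows "F u i j = pnorm (n i) (p i) (F u i) * u i j"
proof -
  have "pnorm (n i) (p i) (F u i) > 0" using pnorm_block_pos[OF F_pos] sphere_posD(2) assms by auto
  moreover have "u i j = F u i j / pnorm (n i) (p i) (F u i)"
    using fun_cong[OF fun_cong[OF assms(2), of i], of j] assms(3,4) unfolding normalize_blocks_def by simp
  ultimately show ?thesis by simp
qed

lemma eigen_imp_fixed_point:
  assumes "u \<in> sphere_pos d n p" "\<And>i. i < d \<Longrightarrow> 0 < N i"
    "\<And>i j. i < d \<Longrightarrow> j < n i \<Longrightarrow> F u i j = N i * u i j"
  shows "G u = u"
proof (rule block_space_eqI)
  show "G u \<in> block_space d n" using G_sphere_pos sphere_posD assms by blast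
  show "u \<in> block_space d n" using sphere_posD assms by blast
  fix i j assume ij: "i < d" "j < n i"
  have "pnorm (n i) (p i) (F u i) = pnorm (n i) (p i) (\<lambda>j. N i * u i j)"
    using assms ij by (intro pnorm_cong) auto
  also have "\<dots> = N i" using pnorm_scale[of "p i"] p_gt_1[OF ij(1)] assms ij sphere_posD(3)[OF assms(1) ij(1)]
    by (simp add: less_imp_le)
  finally show "G u i j = u i j" unfolding normalize_blocks_def using assms(2)[OF ij(1)] assms(3)[OF ij] ij by auto
qed

lemma tendsto_G:
  assumes "\<And>s. pos_entries d n (f s)" "f \<longlonglongrightarrow> z" "pos_entries d n z"
  shows "(\<lambda>s. G (f s)) \<longlonglongrightarrow> G z"
proof (rule tendsto_normalize)
  show "(\<lambda>s. F (f s)) \<longlonglongrightarrow> F z" using F_cont assms pos_imp_nonneg_entries by blast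
  show "pnorm (n i) (p i) (F z i) \<noteq> 0" if "i < d" for i
    using pnorm_block_pos[OF F_pos[OF assms(3)] that] by simp
qed

text \<open>
  Entries stay in \<open>[0, 1]\<close>, so a subsequence converges; the bound on \<open>mu\<close> keeps the limit positive.
\<close>

lemma mu_bounded_sphere_limit:
  assumes x: "\<And>k. x k \<in> sphere_pos d n p" and y: "y \<in> sphere_pos d n p"
    and mu: "\<And>k. mu d n b (x k) y \<le> C"
  shows "\<exists>\<phi> z. strict_mono (\<phi> :: nat \<Rightarrow> nat) \<and> (\<lambda>k. x (\<phi> k)) \<longlonglongrightarrow> z \<and> z \<in> sphere_pos d n p"
proof -
  have "\<bar>x k i j\<bar> \<le> 1" if "i < d" "j < n i" for k i j
    using sphere_entry_le_1[OF sphere_pos_subset_nonneg[OF x] that] pos_entriesD[OF sphere_posD(2)[OF x] that, of k]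
    by auto
  then obtain \<phi> z where \<phi>: "strict_mono (\<phi> :: nat \<Rightarrow> nat)" "(\<lambda>k. x (\<phi> k)) \<longlonglongrightarrow> z" "z \<in> block_space d n"
    using blockvec_convergent_subsequence[of x d n 1] sphere_posD(1)[OF x] by blast
  have lim: "(\<lambda>k. x (\<phi> k) i j) \<longlonglongrightarrow> z i j" for i j using \<phi>(2) by (simp add: blockvec_tendsto_iff)
  have "0 < z i j" if ij: "i < d" "j < n i" for i j
  proof -
    have "exp (- C / b $ i) * y i j \<le> x k i j" for k
    proof -
      have "y i j \<le> exp (mu d n b y (x k) / b $ i) * x k i j" by (rule entry_le_exp_mu[OF y x ij])
      also have "\<dots> \<le> exp (C / b $ i) * x k i j"
        using mu[of k] b_pos[OF ij(1)] pos_entriesD[OF sphere_posD(2)[OF x] ij, of k]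
        by (intro mult_right_mono) (auto simp: mu_commute[of y] divide_right_mono)
      finally show ?thesis by (simp add: exp_minus field_simps)
    qed
    then have "exp (- C / b $ i) * y i j \<le> z i j" using LIMSEQ_le_const[OF lim[of i j]] by blast
    moreover have "0 < exp (- C / b $ i) * y i j"
      by (intro mult_pos_pos exp_gt_zero pos_entriesD[OF sphere_posD(2)[OF y] ij])
    ultimately show ?thesis by linarith
  qed
  then have "z \<in> sphere_pos d n p"
    using sphere_nonneg_limit[of "\<lambda>k. x (\<phi> k)", OF sphere_pos_subset_nonneg[OF x] \<phi>(2)]
    unfolding sphere_pos_def sphere_nonneg_def pos_entries_def by auto
  then show ?thesis using \<phi> by blast
qed

text \<open>
  The topology of block vectors is not defined through \<open>mu\<close>, so instead of completeness the proof uses a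
  convergent subsequence: successive distances tend to \<open>0\<close>, hence its limit is a fixed point, and then the
  contraction estimate against this fixed point gives the rate for the whole sequence.
\<close>

theorem contraction_fixed_point:
  assumes \<kappa>: "\<kappa> < 1" and x0: "x 0 \<in> sphere_pos d n p" and x: "\<And>k. x (Suc k) = G (x k)"
  shows "\<exists>u. u \<in> sphere_pos d n p \<and> G u = u \<and> x \<longlonglongrightarrow> u \<and>
    (\<forall>k. mu d n b (x k) u \<le> mu d n b (x 1) (x 0) / (1 - \<kappa>) * \<kappa> ^ k)"
proof -
  let ?m = "mu d n b"
  have xs: "x k \<in> sphere_pos d n p" for k by (rule iterates_in_sphere[of x, OF x0 x])
  note xp = sphere_posD(2)[OF xs]
  have step: "?m (x (Suc k)) (x k) \<le> \<kappa> ^ k * ?m (x 1) (x 0)" for k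
  proof (induction k)
    case (Suc k)
    have "?m (x (Suc (Suc k))) (x (Suc k)) \<le> \<kappa> * ?m (x (Suc k)) (x k)"
      unfolding x[of "Suc k"] using mu_G_le[OF xp xp, of "Suc k" k] x[of k] by simp
    also have "\<dots> \<le> \<kappa> * (\<kappa> ^ k * ?m (x 1) (x 0))" using Suc \<kappa>_nonneg by (intro mult_left_mono)
    finally show ?case by (simp add: mult.assoc)
  qed auto
  have m1: "0 \<le> ?m (x 1) (x 0)" by (rule mu_nonneg[OF xs xs])
  define C where "C = ?m (x 1) (x 0) / (1 - \<kappa>)"
  have bound: "?m (x k) (x 0) \<le> C" for k
  proof -
    (* Partial sums of the geometric series of the step lengths. *)
    have "?m (x k) (x 0) \<le> C * (1 - \<kappa> ^ k)"
    proof (induction k)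
      case 0
      show ?case using mu_self[OF xp] by simp
    next
      case (Suc k)
      have "?m (x (Suc k)) (x 0) \<le> ?m (x (Suc k)) (x k) + ?m (x k) (x 0)" by (rule mu_triangle[OF xp xp xp])
      also have "\<dots> \<le> \<kappa> ^ k * (C * (1 - \<kappa>)) + C * (1 - \<kappa> ^ k)"
        using step[of k] Suc \<kappa> unfolding C_def by simp
      also have "\<dots> = C * (1 - \<kappa> ^ Suc k)" by (simp add: algebra_simps)
      finally show ?case .
    qed
    also have "\<dots> \<le> C * 1"
    proof (rule mult_left_mono)
      show "0 \<le> C" using m1 \<kappa> unfolding C_def by simp
    qed (use \<kappa>_nonneg in simp)
    also have "\<dots> = C" by simp
    finally show ?thesis .
  qed
  obtain \<phi> u where \<phi>: "strict_mono \<phi>" "(\<lambda>k. x (\<phi> k)) \<longlonglongrightarrow> u" "u \<in> sphere_pos d n p"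
    using mu_bounded_sphere_limit[of x, OF xs x0 bound] by blast
  note up = sphere_posD(2)[OF \<phi>(3)]
  have "(\<lambda>k. ?m (x (\<phi> k)) (G (x (\<phi> k)))) \<longlonglongrightarrow> ?m u (G u)"
    using tendsto_mu[OF \<phi>(2) tendsto_G[OF xp \<phi>(2) up] up] sphere_posD(2)[OF G_sphere_pos[OF up]] by simp
  moreover have "(\<lambda>k. ?m (x (\<phi> k)) (G (x (\<phi> k)))) \<longlonglongrightarrow> 0"
  proof (rule tendsto_sandwich[where f = "\<lambda>_. 0" and h = "\<lambda>k. \<kappa> ^ \<phi> k * ?m (x 1) (x 0)"])
    have "(\<lambda>k. \<kappa> ^ k * ?m (x 1) (x 0)) \<longlonglongrightarrow> 0"
      using tendsto_mult_right[OF LIMSEQ_realpow_zero[OF \<kappa>_nonneg \<kappa>], of "?m (x 1) (x 0)"] by simp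
    from LIMSEQ_subseq_LIMSEQ[OF this \<phi>(1)] show "(\<lambda>k. \<kappa> ^ \<phi> k * ?m (x 1) (x 0)) \<longlonglongrightarrow> 0"
      by (simp add: o_def)
    show "\<forall>\<^sub>F k in sequentially. ?m (x (\<phi> k)) (G (x (\<phi> k))) \<le> \<kappa> ^ \<phi> k * ?m (x 1) (x 0)"
      using step by (intro always_eventually allI) (simp only: x mu_commute[of _ "G _"])
    show "\<forall>\<^sub>F k in sequentially. 0 \<le> ?m (x (\<phi> k)) (G (x (\<phi> k)))"
      using mu_nonneg[OF xs G_sphere_pos[OF xp]] by (intro always_eventually allI)
  qed simp
  ultimately have "?m u (G u) = 0" by (rule LIMSEQ_unique)
  then have Gu: "G u = u" using mu_zero_imp_eq[OF \<phi>(3) G_sphere_pos[OF up]] by simp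
  have geo: "?m (x k) u \<le> \<kappa> ^ k * ?m (x 0) u" for k
  proof (induction k)
    case (Suc k)
    have "?m (x (Suc k)) u \<le> \<kappa> * ?m (x k) u" using mu_G_le[OF xp up, of k] unfolding x Gu .
    also have "\<dots> \<le> \<kappa> * (\<kappa> ^ k * ?m (x 0) u)" using Suc \<kappa>_nonneg by (intro mult_left_mono)
    finally show ?case by (simp add: mult.assoc)
  qed auto
  have "?m (x 0) u \<le> ?m (x 0) (x 1) + ?m (x 1) u" by (rule mu_triangle[OF xp xp up])
  moreover have "?m (x 1) u \<le> \<kappa> * ?m (x 0) u" using geo[of 1] by simp
  ultimately have "?m (x 0) u * (1 - \<kappa>) \<le> ?m (x 1) (x 0)"
    unfolding mu_commute[of "x 0" "x 1"] by (simp add: algebra_simps)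
  then have "?m (x 0) u \<le> C" unfolding C_def using \<kappa> by (simp add: pos_le_divide_eq)
  then have rate: "?m (x k) u \<le> C * \<kappa> ^ k" for k
  proof -
    have "\<kappa> ^ k * ?m (x 0) u \<le> \<kappa> ^ k * C"
      using \<open>?m (x 0) u \<le> C\<close> \<kappa>_nonneg by (intro mult_left_mono) auto
    then show ?thesis using geo[of k] by (simp only: mult.commute[of C])
  qed
  have "(\<lambda>k. ?m (x k) u) \<longlonglongrightarrow> 0"
  proof (rule tendsto_sandwich[where f = "\<lambda>_. 0" and h = "\<lambda>k. C * \<kappa> ^ k"])
    show "(\<lambda>k. C * \<kappa> ^ k) \<longlonglongrightarrow> 0" using tendsto_mult_left[OF LIMSEQ_realpow_zero[OF \<kappa>_nonneg \<kappa>], of C] by simp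
    show "\<forall>\<^sub>F k in sequentially. ?m (x k) u \<le> C * \<kappa> ^ k" using rate by simp
    show "\<forall>\<^sub>F k in sequentially. 0 \<le> ?m (x k) u" using mu_nonneg xs \<phi>(3) by simp
  qed simp
  then have "x \<longlonglongrightarrow> u" by (rule tendsto_if_mu_tendsto_0[of x, OF xs \<phi>(3)])
  then show ?thesis using \<phi>(3) Gu rate unfolding C_def by blast
qed

end

section \<open>Collatz-Wielandt comparison and existence of eigenvectors\<close>

lemma powr_le_self:
  fixes x :: real assumes "1 \<le> x" "t \<le> 1" shows "x powr t \<le> x"
  using powr_mono[OF assms(2,1)] assms(1) by simp

lemma self_le_powr:
  fixes x :: real assumes "0 < x" "x \<le> 1" "t \<le> 1" shows "x \<le> x powr t"
  using powr_mono'[OF assms(3), of x] assms by simp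

lemma pnorm_eq_imp_eq:
  assumes "0 < q" and "\<And>j. j < N \<Longrightarrow> 0 \<le> w j" and "\<And>j. j < N \<Longrightarrow> w j \<le> v j"
    and "pnorm N q w = pnorm N q v" and "j < N"
  shows "w j = v j"
proof (rule ccontr)
  assume ne: "w j \<noteq> v j"
  have "(\<Sum>j<N. \<bar>w j\<bar> powr q) < (\<Sum>j<N. \<bar>v j\<bar> powr q)"
  proof (rule sum_strict_mono_ex1)
    have "\<bar>w l\<bar> powr q \<le> \<bar>v l\<bar> powr q" if "l < N" for l
      using assms(1) assms(2)[OF that] assms(3)[OF that] by (intro powr_mono2) auto
    then show "\<forall>l\<in>{..<N}. \<bar>w l\<bar> powr q \<le> \<bar>v l\<bar> powr q" by auto
    have "\<bar>w j\<bar> powr q < \<bar>v j\<bar> powr q"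
      using assms(1) assms(2)[OF assms(5)] assms(3)[OF assms(5)] ne by (intro powr_less_mono2) auto
    then show "\<exists>l\<in>{..<N}. \<bar>w l\<bar> powr q < \<bar>v l\<bar> powr q" using assms(5) by auto
  qed auto
  then show False using pnorm_powr[OF assms(1), of N w] pnorm_powr[OF assms(1), of N v] assms(4) by simp
qed

context weighted_blocks
begin

lemma sphere_le_imp_eq:
  assumes "w \<in> sphere_nonneg d n p" "u \<in> sphere_nonneg d n p"
    and "\<And>i j. i < d \<Longrightarrow> j < n i \<Longrightarrow> w i j \<le> u i j"
  shows "w = u"
proof (rule block_space_eqI)
  show "w \<in> block_space d n" "u \<in> block_space d n" using assms sphere_nonnegD by auto
  fix i j assume ij: "i < d" "j < n i"
  show "w i j = u i j"
  proof (rule pnorm_eq_imp_eq[of "p i" "n i"])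
    show "0 < p i" using p_gt_1[OF ij(1)] by simp
    show "pnorm (n i) (p i) (w i) = pnorm (n i) (p i) (u i)"
      using sphere_nonnegD(3)[OF assms(1) ij(1)] sphere_nonnegD(3)[OF assms(2) ij(1)] by simp
    show "0 \<le> w i j" if "j < n i" for j using nonneg_entriesD[OF sphere_nonnegD(2)[OF assms(1)] ij(1) that] .
  qed (use assms ij in auto)
qed

end

context multihom_map
begin

text \<open>
  Evaluate both hypotheses at a coordinate where the ratio \<open>x / y\<close> of block \<open>i\<close> is attained.
\<close>

lemma block_compare:
  assumes x: "nonneg_entries d n x" and y: "pos_entries d n y"
    and c: "\<And>k. k < d \<Longrightarrow> 0 < tr x y k"
    and m: "\<And>i j. i < d \<Longrightarrow> j < n i \<Longrightarrow> m i * x i j \<le> F x i j"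
    and M: "\<And>i j. i < d \<Longrightarrow> j < n i \<Longrightarrow> F y i j \<le> M i * y i j" and i: "i < d"
  shows "m i * tr x y i \<le> M i * hf (tr x y) i"
proof -
  let ?c = "tr x y"
  obtain j where j: "j < n i" "?c i = x i j / y i j" using top_ratio_attained[of n i x y] n_pos[OF i] by blast
  have yp: "0 < y i j" using pos_entriesD[OF y i j(1)] .
  have "m i * (?c i * y i j) \<le> F x i j" using m[OF i j(1)] yp j(2) by simp
  also have "\<dots> \<le> hf ?c i * F y i j"
    using i j(1) c top_ratio_bound[of _ n _ y x] pos_entriesD[OF y]
    by (intro F_le_hf x pos_imp_nonneg_entries[OF y]) auto
  also have "\<dots> \<le> hf ?c i * (M i * y i j)"
    using M[OF i j(1)] hom_factor_pos[of d ?c a i] c by (intro mult_left_mono) (auto simp: less_imp_le)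
  finally have "(m i * ?c i) * y i j \<le> (M i * hf ?c i) * y i j" by (simp add: mult_ac)
  then show ?thesis using yp by simp
qed

lemma upper_bound_pos:
  assumes y: "pos_entries d n y" and M: "\<And>i j. i < d \<Longrightarrow> j < n i \<Longrightarrow> F y i j \<le> M i * y i j" and i: "i < d"
  shows "0 < M i"
proof -
  have "0 < F y i 0" using pos_entriesD[OF F_pos[OF y] i n_pos[OF i]] .
  also have "\<dots> \<le> M i * y i 0" using M[OF i n_pos[OF i]] .
  finally show ?thesis using pos_entriesD[OF y i n_pos[OF i]] by (simp add: zero_less_mult_iff)
qed

lemma gm_compare:
  assumes x: "x \<in> sphere_nonneg d n p" and y: "y \<in> sphere_pos d n p" and m0: "\<And>i. i < d \<Longrightarrow> 0 \<le> m i"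
    and m: "\<And>i j. i < d \<Longrightarrow> j < n i \<Longrightarrow> m i * x i j \<le> F x i j"
    and M: "\<And>i j. i < d \<Longrightarrow> j < n i \<Longrightarrow> F y i j \<le> M i * y i j"
  shows "gm m * gm (tr x y) \<le> gm M * gm (tr x y) powr \<kappa>"
proof -
  note yp = sphere_posD(2)[OF y]
  have c: "0 < tr x y k" if "k < d" for k using top_ratio_sphere_pos[OF x yp that] .
  have "gm (\<lambda>i. m i * tr x y i) \<le> gm (\<lambda>i. M i * hf (tr x y) i)"
  proof (rule weighted_gm_mono)
    show "m i * tr x y i \<le> M i * hf (tr x y) i" if "i < d" for i
      by (rule block_compare[OF sphere_nonnegD(2)[OF x] yp c m M that])
    show "0 \<le> m i * tr x y i" if "i < d" for i using m0[OF that] c[OF that] by simp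
  qed (rule b_pos)
  then show ?thesis using gm_hf[OF c] by (simp add: weighted_gm_mult)
qed

lemma gm_top_ratio_ge_1:
  assumes "x \<in> sphere_nonneg d n p" "y \<in> sphere_pos d n p" shows "1 \<le> gm (tr x y)"
  using weighted_gm_mono[of d b "\<lambda>i. 1" "tr x y"] b_pos top_ratio_sphere_ge_1[OF assms] by auto

text \<open>
  Taking weighted means in \<open>block_compare\<close> leaves a power of the mean ratio \<open>g \<ge> 1\<close>, and \<open>g powr \<kappa> \<le> g\<close>.
\<close>

theorem collatz_wielandt_compare:
  assumes "\<kappa> \<le> 1" and x: "x \<in> sphere_nonneg d n p" and y: "y \<in> sphere_pos d n p"
    and m0: "\<And>i. i < d \<Longrightarrow> 0 \<le> m i"
    and m: "\<And>i j. i < d \<Longrightarrow> j < n i \<Longrightarrow> m i * x i j \<le> F x i j"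
    and M: "\<And>i j. i < d \<Longrightarrow> j < n i \<Longrightarrow> F y i j \<le> M i * y i j"
  shows "gm m \<le> gm M"
proof -
  let ?g = "gm (tr x y)"
  have g: "1 \<le> ?g" by (rule gm_top_ratio_ge_1[OF x y])
  have "gm m * ?g \<le> gm M * ?g powr \<kappa>" using gm_compare[OF x y m0 m M] .
  also have "\<dots> \<le> gm M * ?g" using powr_le_self[OF g assms(1)] by (intro mult_left_mono) auto
  finally show ?thesis using g by simp
qed

text \<open>
  Entrywise powers with \<open>e < 1\<close> turn the non-expansive case into a contractive one while keeping the
  weights \<open>b\<close>.
\<close>

lemma powr_map:
  assumes e: "0 < e"
  shows "multihom_map d n p b (\<lambda>x i j. if i < d \<and> j < n i then F x i j powr e else 0) (\<lambda>i k. e * a i k) (e * \<kappa>)"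
proof
  fix x y :: blockvec
  show "(\<lambda>i j. if i < d \<and> j < n i then F x i j powr e else 0) \<in> block_space d n"
    unfolding block_space_def by auto
  show "nonneg_entries d n (\<lambda>i j. if i < d \<and> j < n i then F x i j powr e else 0)"
    unfolding nonneg_entries_def by auto
  show "(if i < d \<and> j < n i then F x i j powr e else 0) \<le> (if i < d \<and> j < n i then F y i j powr e else 0)"
    if "nonneg_entries d n x" "\<And>i j. i < d \<Longrightarrow> j < n i \<Longrightarrow> x i j \<le> y i j" "i < d" "j < n i" for i j
    using F_mono[OF that] nonneg_entriesD[OF F_nonneg[OF that(1)] that(3,4)] e that by (auto intro!: powr_mono2)
  show "(if i < d \<and> j < n i then F (\<lambda>i j. c i * x i j) i j powr e else 0) =
      hom_factor d (\<lambda>i k. e * a i k) c i * (if i < d \<and> j < n i then F x i j powr e else 0)"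
    if "\<And>k. k < d \<Longrightarrow> 0 < c k" "nonneg_entries d n x" "i < d" "j < n i" for c i j
  proof -
    have "hom_factor d (\<lambda>i k. e * a i k) c i = hf c i powr e"
      unfolding hom_factor_def by (simp add: prod_powr_distrib powr_powr mult.commute)
    then show ?thesis using F_hom[OF that] that by (simp add: powr_mult)
  qed
  show "pos_entries d n (\<lambda>i j. if i < d \<and> j < n i then F (ones d n) i j powr e else 0)"
    using pos_entriesD[OF F_pos_ones] unfolding pos_entries_def by (auto simp: order_less_le)
  show "(\<lambda>s i j. if i < d \<and> j < n i then F (f s) i j powr e else 0)
      \<longlonglongrightarrow> (\<lambda>i j. if i < d \<and> j < n i then F x i j powr e else 0)"
    if "\<And>s. nonneg_entries d n (f s)" "f \<longlonglongrightarrow> x" for f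
    unfolding blockvec_tendsto_iff
  proof (intro allI)
    fix i j
    show "(\<lambda>s. if i < d \<and> j < n i then F (f s) i j powr e else 0)
      \<longlonglongrightarrow> (if i < d \<and> j < n i then F x i j powr e else 0)"
    proof (cases "i < d \<and> j < n i")
      case True
      have "(\<lambda>s. F (f s) i j powr e) \<longlonglongrightarrow> F x i j powr e"
        using F_cont[OF that] e nonneg_entriesD[OF F_nonneg[OF that(1)]] True
        by (intro tendsto_powr') (auto simp: blockvec_tendsto_iff)
      then show ?thesis using True by simp
    qed auto
  qed
  show "(\<Sum>i<d. b $ i * (e * a i k)) = e * \<kappa> * b $ k" if "k < d" for k
    using weights[OF that] by (simp add: mult_ac sum_distrib_left[symmetric])
  show "0 \<le> e * \<kappa>" using e \<kappa>_nonneg by simp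
qed

text \<open>
  Fixed points of the contractive maps \<open>F(x) powr e\<close> for \<open>e\<close> tending to \<open>1\<close>, along a subsequence on which they
  converge. The approximants are kept, since they are positive while their limit need not be.
\<close>

lemma regularised_eigenvectors:
  assumes \<kappa>: "\<kappa> \<le> 1"
  obtains U e N u where
    "\<And>s. U s \<in> sphere_pos d n p" "\<And>s. 1/2 \<le> e s" "\<And>s. e s < 1" "e \<longlonglongrightarrow> (1::real)"
    "\<And>s i. i < d \<Longrightarrow> 0 < N s i"
    "\<And>s i j. i < d \<Longrightarrow> j < n i \<Longrightarrow> F (U s) i j powr e s = N s i * U s i j"
    "U \<longlonglongrightarrow> u" "u \<in> sphere_nonneg d n p"
    "\<And>i. i < d \<Longrightarrow> (\<lambda>s. N s i) \<longlonglongrightarrow> pnorm (n i) (p i) (F u i)"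
    "\<And>i j. i < d \<Longrightarrow> j < n i \<Longrightarrow> F u i j = pnorm (n i) (p i) (F u i) * u i j"
proof -
  (* \<open>1/2\<close> is an arbitrary positive lower bound that keeps \<open>1 / e\<close> bounded. *)
  define e0 where "e0 = (\<lambda>s::nat. 1 - inverse (real (Suc (Suc s))))"
  have e0: "1/2 \<le> e0 s" "e0 s < 1" for s unfolding e0_def by (auto simp: field_simps)
  have e0_lim: "e0 \<longlonglongrightarrow> 1"
    unfolding e0_def using LIMSEQ_inverse_real_of_nat_add_minus[of 1] LIMSEQ_Suc by fastforce
  define Fp where "Fp = (\<lambda>e x i j. if i < d \<and> j < n i then F x i j powr e else (0::real))"
  have "\<exists>v\<in>sphere_pos d n p. nrm (Fp (e0 s) v) = v" for s
  proof -
    interpret P: multihom_map d n p b "Fp (e0 s)" "\<lambda>i k. e0 s * a i k" "e0 s * \<kappa>"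
      unfolding Fp_def by (rule powr_map) (use e0(1)[of s] in linarith)
    have "e0 s * \<kappa> \<le> e0 s" using e0(1)[of s] \<kappa> by (intro mult_left_le) auto
    then have k: "e0 s * \<kappa> < 1" using e0(2)[of s] by linarith
    define x where "x = rec_nat (nrm (ones d n)) (\<lambda>_ y. nrm (Fp (e0 s) y))"
    have "x 0 \<in> sphere_pos d n p" "x (Suc k) = nrm (Fp (e0 s) (x k))" for k
      unfolding x_def using sphere_pos_nonempty by auto
    from P.contraction_fixed_point[of x, OF k this] show ?thesis by blast
  qed
  then obtain V where V: "\<And>s. V s \<in> sphere_pos d n p" "\<And>s. nrm (Fp (e0 s) (V s)) = V s" by metis
  have "\<bar>V s i j\<bar> \<le> 1" if "i < d" "j < n i" for s i j
    using sphere_entry_le_1[OF sphere_pos_subset_nonneg[OF V(1)] that, of s] pos_entriesD[OF sphere_posD(2)[OF V(1)] that, of s]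
    by linarith
  then obtain \<phi> u where \<phi>: "strict_mono (\<phi> :: nat \<Rightarrow> nat)" "(\<lambda>s. V (\<phi> s)) \<longlonglongrightarrow> u" "u \<in> block_space d n"
    using blockvec_convergent_subsequence[of V d n 1] sphere_posD(1)[OF V(1)] by blast
  define U where "U = (\<lambda>s. V (\<phi> s))"
  define e where "e = (\<lambda>s. e0 (\<phi> s))"
  define N where "N = (\<lambda>s i. pnorm (n i) (p i) (Fp (e s) (U s) i))"
  have U: "U s \<in> sphere_pos d n p" for s unfolding U_def by (rule V)
  have e: "1/2 \<le> e s" "e s < 1" for s unfolding e_def by (rule e0)+
  have e_lim: "e \<longlonglongrightarrow> 1" unfolding e_def using LIMSEQ_subseq_LIMSEQ[OF e0_lim \<phi>(1)] by (simp add: o_def)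
  have eig: "F (U s) i j powr e s = N s i * U s i j" and Npos: "0 < N s i" if ij: "i < d" "j < n i" for s i j
  proof -
    interpret P: multihom_map d n p b "Fp (e s)" "\<lambda>i k. e s * a i k" "e s * \<kappa>"
      unfolding Fp_def by (rule powr_map) (use e(1)[of s] in linarith)
    have "nrm (Fp (e s) (U s)) = U s" unfolding e_def U_def by (rule V)
    from P.fixed_point_imp_eigen[OF U this ij] show "F (U s) i j powr e s = N s i * U s i j"
      unfolding N_def using ij by (simp add: Fp_def)
    show "0 < N s i" unfolding N_def by (rule pnorm_block_pos[OF P.F_pos[OF sphere_posD(2)[OF U]] ij(1)])
  qed
  have U_lim: "U \<longlonglongrightarrow> u" unfolding U_def by (rule \<phi>(2))
  then have U_lim': "(\<lambda>s. U s i j) \<longlonglongrightarrow> u i j" for i j by (simp add: blockvec_tendsto_iff)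
  have u: "u \<in> sphere_nonneg d n p"
    by (rule sphere_nonneg_limit[of U, OF sphere_pos_subset_nonneg[OF U] U_lim])
  have nn: "nonneg_entries d n (U s)" for s by (rule pos_imp_nonneg_entries[OF sphere_posD(2)[OF U]])
  have F_lim: "(\<lambda>s. F (U s) i j powr e s) \<longlonglongrightarrow> F u i j" if ij: "i < d" "j < n i" for i j
  proof -
    have "(\<lambda>s. F (U s) i j powr e s) \<longlonglongrightarrow> F u i j powr 1"
      using F_cont[OF nn U_lim] e_lim nonneg_entriesD[OF F_nonneg[OF nn] ij]
      by (intro tendsto_powr') (auto simp: blockvec_tendsto_iff)
    then show ?thesis using nonneg_entriesD[OF F_nonneg[OF sphere_nonnegD(2)[OF u]] ij] by simp
  qed
  have N_lim: "(\<lambda>s. N s i) \<longlonglongrightarrow> pnorm (n i) (p i) (F u i)" if i: "i < d" for i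
    unfolding N_def using p_gt_1[OF i] F_lim[OF i] i by (intro tendsto_pnorm) (auto simp: Fp_def)
  have "F u i j = pnorm (n i) (p i) (F u i) * u i j" if ij: "i < d" "j < n i" for i j
    using LIMSEQ_unique[OF F_lim[OF ij]] tendsto_mult[OF N_lim[OF ij(1)] U_lim'[of i j]] eig[OF ij] by simp
  moreover have "0 < N s i" if "i < d" for s i using Npos[OF that n_pos[OF that]] .
  ultimately show ?thesis using that[of U e N u] U e e_lim eig U_lim u N_lim by blast
qed

text \<open>
  From \<open>F U = (N U) powr (1 / e)\<close> and \<open>U powr (1 / e) \<le> U\<close>, because the entries are at most \<open>1\<close>.
\<close>

lemma regularised_upper_bound:
  assumes U: "U \<in> sphere_pos d n p" and e: "1/2 \<le> e" "e < (1::real)" and N: "\<And>i. i < d \<Longrightarrow> 0 < N i"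
    and eig: "\<And>i j. i < d \<Longrightarrow> j < n i \<Longrightarrow> F U i j powr e = N i * U i j" and ij: "i < d" "j < n i"
  shows "F U i j \<le> N i powr (1 / e) * U i j"
proof -
  have Up: "0 < U i j" "U i j \<le> 1"
    using pos_entriesD[OF sphere_posD(2)[OF U] ij] sphere_entry_le_1[OF sphere_pos_subset_nonneg[OF U] ij] by auto
  have "0 < F U i j" using pos_entriesD[OF F_pos[OF sphere_posD(2)[OF U]] ij] .
  then have "F U i j = (F U i j powr e) powr (1 / e)" using e by (simp add: powr_powr)
  also have "\<dots> = N i powr (1 / e) * U i j powr (1 / e)" using eig[OF ij] by (simp add: powr_mult)
  also have "U i j powr (1 / e) \<le> U i j powr 1"
    using Up e by (intro powr_mono') (auto simp: field_simps)
  finally show ?thesis using Up by (simp add: mult_left_mono)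
qed

text \<open>
  The limit eigenvector carries block eigenvalues whose mean is also an infimum of upper bounds over
  positive vectors: the approximants are the witnesses for the infimum.
\<close>

theorem collatz_wielandt_eigenvector:
  assumes \<kappa>: "\<kappa> \<le> 1"
  shows "\<exists>u N. u \<in> sphere_nonneg d n p \<and> (\<forall>i<d. 0 \<le> N i) \<and>
    (\<forall>i<d. \<forall>j<n i. F u i j = N i * u i j) \<and>
    (\<forall>\<delta>>0. \<exists>z\<in>sphere_pos d n p. \<exists>M. (\<forall>i<d. \<forall>j<n i. F z i j \<le> M i * z i j) \<and> gm M < gm N + \<delta>)"
proof -
  obtain U e N u where *:
    "\<And>s. U s \<in> sphere_pos d n p" "\<And>s. 1/2 \<le> e s" "\<And>s. e s < 1" "e \<longlonglongrightarrow> (1::real)"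
    "\<And>s i. i < d \<Longrightarrow> 0 < N s i"
    "\<And>s i j. i < d \<Longrightarrow> j < n i \<Longrightarrow> F (U s) i j powr e s = N s i * U s i j"
    "U \<longlonglongrightarrow> u" "u \<in> sphere_nonneg d n p"
    "\<And>i. i < d \<Longrightarrow> (\<lambda>s. N s i) \<longlonglongrightarrow> pnorm (n i) (p i) (F u i)"
    "\<And>i j. i < d \<Longrightarrow> j < n i \<Longrightarrow> F u i j = pnorm (n i) (p i) (F u i) * u i j"
    using regularised_eigenvectors[OF \<kappa>] by metis
  let ?N = "\<lambda>i. pnorm (n i) (p i) (F u i)"
  have e0: "0 < e s" for s using *(2)[of s] by linarith
  have ie: "(\<lambda>s. 1 / e s) \<longlonglongrightarrow> 1" using tendsto_divide[OF tendsto_const *(4), of 1] by simp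
  have "(\<lambda>s. gm (\<lambda>i. N s i powr (1 / e s))) \<longlonglongrightarrow> gm ?N"
  proof (rule tendsto_weighted_gm)
    show "(\<lambda>s. N s i powr (1 / e s)) \<longlonglongrightarrow> ?N i" if "i < d" for i
    proof -
      have "(\<lambda>s. N s i powr (1 / e s)) \<longlonglongrightarrow> ?N i powr 1"
        using *(5)[OF that] by (intro tendsto_powr' *(9) that ie) (auto simp: less_imp_le)
      then show ?thesis by simp
    qed
  qed (auto intro: b_pos)
  then have lim: "\<forall>\<^sub>F s in sequentially. gm (\<lambda>i. N s i powr (1 / e s)) < gm ?N + \<delta>" if "0 < \<delta>" for \<delta>
    by (rule order_tendstoD) (use that in simp)
  have "\<exists>z\<in>sphere_pos d n p. \<exists>M. (\<forall>i<d. \<forall>j<n i. F z i j \<le> M i * z i j) \<and> gm M < gm ?N + \<delta>" if \<delta>: "0 < \<delta>" for \<delta>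
  proof -
    obtain s where s: "gm (\<lambda>i. N s i powr (1 / e s)) < gm ?N + \<delta>"
      using eventually_happens[OF lim[OF \<delta>]] by auto
    have "F (U s) i j \<le> N s i powr (1 / e s) * U s i j" if "i < d" "j < n i" for i j
      by (rule regularised_upper_bound[OF *(1) *(2) *(3) *(5) *(6) that])
    then show ?thesis using s *(1)[of s] by (intro bexI[of _ "U s"] exI[of _ "\<lambda>i. N s i powr (1 / e s)"]) auto
  qed
  then show ?thesis using *(8,10) by (intro exI[of _ u] exI[of _ ?N]) auto
qed

end

section \<open>The dependency graph\<close>

definition coord_set :: "nat \<Rightarrow> (nat \<Rightarrow> nat) \<Rightarrow> (nat \<times> nat) set" where
  "coord_set d n = (SIGMA i:{..<d}. {..<n i})"

lemma finite_coord_set: "finite (coord_set d n)"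
  unfolding coord_set_def by auto

lemma in_coord_set: "(i, j) \<in> coord_set d n \<longleftrightarrow> i < d \<and> j < n i"
  unfolding coord_set_def by auto

context weighted_blocks
begin

text \<open>
  Each of the other factors is at least \<open>q powr (b $ k)\<close>; divide by them.
\<close>

lemma gm_bounded_imp_entry_bounded:
  assumes q: "0 < q" and i: "i < d"
  shows "\<exists>K. \<forall>c. (\<forall>k<d. q \<le> c k) \<and> gm c \<le> B \<longrightarrow> c i \<le> K"
proof -
  define Q where "Q = (\<Prod>k\<in>{..<d} - {i}. q powr (b $ k))"
  have Q: "0 < Q" unfolding Q_def using q by (intro prod_pos) auto
  have "c i \<le> (B / Q) powr (1 / b $ i)" if c: "\<forall>k<d. q \<le> c k" "gm c \<le> B" for c
  proof -
    have ci: "0 < c i" using c(1) q i less_le_trans by blast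
    have "Q \<le> (\<Prod>k\<in>{..<d} - {i}. c k powr (b $ k))"
      unfolding Q_def using c(1) q b_pos by (intro prod_mono) (auto intro!: powr_mono2 simp: less_imp_le)
    then have "c i powr (b $ i) * Q \<le> c i powr (b $ i) * (\<Prod>k\<in>{..<d} - {i}. c k powr (b $ k))"
      by (intro mult_left_mono) auto
    also have "\<dots> = gm c" unfolding weighted_gm_def using i by (subst prod.remove[of _ i]) auto
    finally have "c i powr (b $ i) \<le> B / Q" using c(2) Q by (simp add: field_simps)
    then have "(c i powr (b $ i)) powr (1 / b $ i) \<le> (B / Q) powr (1 / b $ i)"
      using b_pos[OF i] by (intro powr_mono2) auto
    then show ?thesis using b_pos[OF i] ci by (simp add: powr_powr)
  qed
  then show ?thesis by blast
qed

end

text \<open>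
  The two properties of a dependency edge from \<open>(i, j)\<close> to \<open>(k, l)\<close>: equality of values at \<open>(i, j)\<close> for \<open>w \<le> v\<close>
  propagates to equality at \<open>(k, l)\<close>, and a large entry at \<open>(k, l)\<close> makes the value at \<open>(i, j)\<close> large as long as no
  entry drops below \<open>1\<close>.
\<close>

locale multihom_graph = multihom_map +
  fixes E :: "((nat \<times> nat) \<times> (nat \<times> nat)) set"
  assumes E_coords: "E \<subseteq> coord_set d n \<times> coord_set d n"
    and F_touch: "\<lbrakk>((i, j), (k, l)) \<in> E; nonneg_entries d n w; pos_entries d n v;
      \<And>i j. i < d \<Longrightarrow> j < n i \<Longrightarrow> w i j \<le> v i j; F w i j = F v i j\<rbrakk> \<Longrightarrow> w k l = v k l"
    and F_growth: "((i, j), (k, l)) \<in> E \<Longrightarrow> \<exists>\<delta>>0. \<exists>\<alpha>>0. \<forall>w. (\<forall>i<d. \<forall>j<n i. 1 \<le> w i j)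
      \<longrightarrow> \<delta> * w k l powr \<alpha> \<le> F w i j"
begin

definition "strongly_connected \<longleftrightarrow> (\<forall>c\<in>coord_set d n. \<forall>c'\<in>coord_set d n. (c, c') \<in> E\<^sup>*)"

text \<open>
  For a family of approximate eigenvectors with entries at least \<open>1\<close> and bounded block eigenvalues, a bound at
  the tail of an edge gives a bound at its head that is uniform in the family index \<open>s\<close>.
\<close>

lemma edge_bound:
  assumes E: "((i, j), (k, l)) \<in> E"
    and w1: "\<And>s i j. i < d \<Longrightarrow> j < n i \<Longrightarrow> 1 \<le> W s i j"
    and e: "\<And>s. 1/2 \<le> e s" "\<And>s. e s \<le> (1::real)"
    and D: "\<And>s. D s i \<le> K" and FW: "\<And>s. F (W s) i j powr e s = D s i * W s i j"
  shows "\<exists>B'. \<forall>s. W s i j \<le> B \<longrightarrow> W s k l \<le> B'"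
proof -
  have c: "i < d" "j < n i" "k < d" "l < n k" using E E_coords by (auto simp: in_coord_set)
  obtain \<delta> \<alpha> where \<delta>: "0 < \<delta>" "0 < \<alpha>"
    and gr: "\<And>w. (\<forall>i<d. \<forall>j<n i. 1 \<le> w i j) \<Longrightarrow> \<delta> * w k l powr \<alpha> \<le> F w i j"
    using F_growth[OF E] by blast
  define H where "H = max 1 (K * B)"
  have "W s k l \<le> (H powr 2 / \<delta>) powr (1 / \<alpha>)" if B: "W s i j \<le> B" for s
  proof -
    have W: "nonneg_entries d n (W s)" using w1[of _ _ s] unfolding nonneg_entries_def
      by (metis order_trans zero_le_one)
    have F0: "0 \<le> F (W s) i j" using nonneg_entriesD[OF F_nonneg[OF W] c(1,2)] .
    have "0 \<le> D s i"
    proof (rule ccontr)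
      assume "\<not> 0 \<le> D s i"
      then have "D s i * W s i j < 0" using w1[OF c(1,2), of s] by (intro mult_neg_pos) auto
      then show False using FW[of s] powr_ge_zero[of "F (W s) i j" "e s"] by simp
    qed
    then have "D s i * W s i j \<le> K * B" using D[of s] B w1[OF c(1,2), of s] by (intro mult_mono) auto
    then have "F (W s) i j powr e s \<le> H" using FW[of s] unfolding H_def by simp
    then have "(F (W s) i j powr e s) powr (1 / e s) \<le> H powr (1 / e s)"
      using e(1)[of s] by (intro powr_mono2) auto
    also have "\<dots> \<le> H powr 2" using e(1)[of s] unfolding H_def by (intro powr_mono) (auto simp: field_simps)
    finally have "F (W s) i j \<le> H powr 2" using F0 e(1)[of s] by (auto simp: powr_powr)
    moreover have "\<delta> * W s k l powr \<alpha> \<le> F (W s) i j" using w1 by (intro gr) auto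
    ultimately have "W s k l powr \<alpha> \<le> H powr 2 / \<delta>" using \<delta>(1) by (simp add: field_simps)
    then have "(W s k l powr \<alpha>) powr (1 / \<alpha>) \<le> (H powr 2 / \<delta>) powr (1 / \<alpha>)"
      using \<delta>(2) by (intro powr_mono2) auto
    then show ?thesis using \<delta>(2) w1[OF c(3,4), of s] by (simp add: powr_powr)
  qed
  then show ?thesis by blast
qed

lemma path_bound:
  assumes path: "(c, c') \<in> E\<^sup>*"
    and edge: "\<And>i j k l B. ((i, j), (k, l)) \<in> E \<Longrightarrow> \<exists>B'. \<forall>s. W s i j \<le> B \<longrightarrow> W s k l \<le> (B' :: real)"
  shows "\<exists>B'. \<forall>s. W s (fst c) (snd c) \<le> B \<longrightarrow> W s (fst c') (snd c') \<le> B'"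
  using path
proof (induction rule: rtrancl_induct)
  case base
  then show ?case by blast
next
  case (step y z)
  then obtain B1 where B1: "\<forall>s. W s (fst c) (snd c) \<le> B \<longrightarrow> W s (fst y) (snd y) \<le> B1" by blast
  have "((fst y, snd y), (fst z, snd z)) \<in> E" using step(2) by simp
  from edge[OF this, of B1] B1 show ?case by blast
qed

text \<open>
  Divide each block by its minimal entry. The scaled vectors \<open>W\<close> are again approximate eigenvectors, with
  block eigenvalues \<open>D\<close> whose mean is not larger than before, since the minima are at most \<open>1\<close>
  and \<open>\<kappa> \<le> 1\<close>. At a
  minimal entry \<open>W = 1\<close>, which bounds every \<open>D\<close> below by a value of the map at the all-ones vector, so \<open>D\<close> is
  bounded above as well. Starting from a minimal entry, boundedness spreads along the paths of the graph.
\<close>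

lemma min_scaled_bounded:
  assumes \<kappa>: "\<kappa> \<le> 1" and conn: strongly_connected
    and U: "\<And>s. U s \<in> sphere_pos d n p" and e: "\<And>s. 1/2 \<le> e s" "\<And>s. e s < (1::real)"
    and N: "\<And>s i. i < d \<Longrightarrow> 0 < N s i"
    and eig: "\<And>s i j. i < d \<Longrightarrow> j < n i \<Longrightarrow> F (U s) i j powr e s = N s i * U s i j"
    and NB: "\<And>s. gm (N s) \<le> B"
  shows "\<exists>K>0. \<forall>s. \<forall>i<d. \<forall>j<n i. \<forall>l<n i. U s i j \<le> K * U s i l"
proof -
  define m where "m = (\<lambda>s i. Min (U s i ` {..<n i}))"
  have Up: "0 < U s i j" if "i < d" "j < n i" for s i j using pos_entriesD[OF sphere_posD(2)[OF U] that] .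
  have ne: "{..<n i} \<noteq> {}" if "i < d" for i using n_pos[OF that] by auto
  have m_le: "m s i \<le> U s i j" if "j < n i" for s i j unfolding m_def using that by (intro Min_le) auto
  have m_at: "\<exists>j<n i. m s i = U s i j" if i: "i < d" for s i
  proof -
    have "m s i \<in> U s i ` {..<n i}" unfolding m_def using ne[OF i] by (intro Min_in) auto
    then show ?thesis by auto
  qed
  have m_pos: "0 < m s i" and m_le1: "m s i \<le> 1" if i: "i < d" for s i
  proof -
    obtain j where j: "j < n i" "m s i = U s i j" using m_at[OF i] by blast
    then show "0 < m s i" using Up[OF i] by simp
    show "m s i \<le> 1" using j sphere_entry_le_1[OF sphere_pos_subset_nonneg[OF U] i j(1), of s] by simp
  qed
  define W where "W = (\<lambda>s i j. (1 / m s i) * U s i j)"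
  have W1: "1 \<le> W s i j" if "i < d" "j < n i" for s i j
    unfolding W_def using m_le[OF that(2), of s] m_pos[OF that(1), of s] by (simp add: field_simps)
  define D where "D = (\<lambda>s i. hf (\<lambda>i. 1 / m s i) i powr e s * N s i * m s i)"
  have FW: "F (W s) i j powr e s = D s i * W s i j" if ij: "i < d" "j < n i" for s i j
  proof -
    have "F (W s) i j = hf (\<lambda>i. 1 / m s i) i * F (U s) i j"
      unfolding W_def using m_pos ij by (intro F_hom pos_imp_nonneg_entries[OF sphere_posD(2)[OF U]]) auto
    then show ?thesis using eig[OF ij, of s] m_pos[OF ij(1), of s] unfolding D_def W_def by (simp add: powr_mult)
  qed
  have gmD: "gm (D s) \<le> B" for s
  proof -
    have mp: "0 < gm (m s)" using m_pos by (intro weighted_gm_pos) auto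
    have m1: "gm (m s) \<le> 1" using weighted_gm_mono[of d b "m s" "\<lambda>_. 1"] b_pos m_pos m_le1 by (auto simp: less_imp_le)
    have "gm (D s) = gm (hf (\<lambda>i. 1 / m s i)) powr e s * gm (N s) * gm (m s)"
      unfolding D_def by (simp add: weighted_gm_mult weighted_gm_powr)
    also have "gm (hf (\<lambda>i. 1 / m s i)) = (1 / gm (m s)) powr \<kappa>"
      using gm_hf[of "\<lambda>i. 1 / m s i"] m_pos weighted_gm_divide[of d b "\<lambda>_. 1" "m s"] by simp
    finally have "gm (D s) = gm (N s) * (gm (m s) * (1 / gm (m s)) powr (\<kappa> * e s))" by (simp add: powr_powr)
    also have "(1 / gm (m s)) powr (\<kappa> * e s) \<le> 1 / gm (m s)"
    proof (rule powr_le_self)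
      show "1 \<le> 1 / gm (m s)" using m1 mp by simp
      show "\<kappa> * e s \<le> 1" using \<kappa> \<kappa>_nonneg e[of s] by (intro mult_le_one) auto
    qed
    finally have "gm (D s) \<le> gm (N s)" using mp by (simp add: mult_left_mono)
    then show ?thesis using NB[of s] by linarith
  qed
  (* A common lower bound at most \<open>1\<close>, so that it survives the powers \<open>e s < 1\<close>. *)
  define q where "q = Min (insert 1 ((\<lambda>c. F (ones d n) (fst c) (snd c)) ` coord_set d n))"
  have q0: "0 < q" unfolding q_def using pos_entriesD[OF F_pos_ones]
    by (subst Min_gr_iff) (auto simp: finite_coord_set in_coord_set)
  have q1: "q \<le> 1" unfolding q_def by (intro Min_le) (auto simp: finite_coord_set)
  have qF: "q \<le> F (ones d n) i j" if "i < d" "j < n i" for i j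
    unfolding q_def using that
    by (intro Min_le) (auto simp: finite_coord_set in_coord_set intro!: image_eqI[of _ _ "(i, j)"])
  have Dq: "q \<le> D s i" if i: "i < d" for s i
  proof -
    obtain j where j: "j < n i" "m s i = U s i j" using m_at[OF i] by blast
    have "W s i j = 1" unfolding W_def using j m_pos[OF i, of s] by simp
    then have "D s i = F (W s) i j powr e s" using FW[OF i j(1), of s] by simp
    moreover have "F (ones d n) i j \<le> F (W s) i j"
      using W1 i j by (intro F_mono pos_imp_nonneg_entries[OF pos_entries_ones]) (auto simp: ones_def)
    then have "q powr e s \<le> F (W s) i j powr e s"
      using qF[OF i j(1)] q0 e(1)[of s] by (intro powr_mono2) auto
    moreover have "q \<le> q powr e s" using self_le_powr[OF q0 q1] e(2)[of s] by simp
    ultimately show ?thesis by linarith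
  qed
  have edge: "\<exists>B'. \<forall>s. W s i j \<le> B0 \<longrightarrow> W s k l \<le> B'" if E: "((i, j), (k, l)) \<in> E" for i j k l B0
  proof -
    have c: "i < d" "j < n i" using E E_coords by (auto simp: in_coord_set)
    obtain K where "\<forall>c. (\<forall>k<d. q \<le> c k) \<and> gm c \<le> B \<longrightarrow> c i \<le> K"
      using gm_bounded_imp_entry_bounded[OF q0 c(1)] by blast
    then have "D s i \<le> K" for s using Dq gmD by blast
    then show ?thesis using edge_bound[of i j k l W e D K, OF E W1 e(1) less_imp_le[OF e(2)] _ FW[OF c]] by blast
  qed
  have "\<exists>B'. \<forall>s. W s (fst c) (snd c) \<le> 1 \<longrightarrow> W s (fst c') (snd c') \<le> B'"
    if "c \<in> coord_set d n" "c' \<in> coord_set d n" for c c'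
    using that conn unfolding strongly_connected_def by (intro path_bound edge) auto
  then obtain B' where B': "\<And>c c' s. \<lbrakk>c \<in> coord_set d n; c' \<in> coord_set d n; W s (fst c) (snd c) \<le> 1\<rbrakk>
      \<Longrightarrow> W s (fst c') (snd c') \<le> B' c c'" by metis
  define K where "K = Max (insert 1 ((\<lambda>(c, c'). B' c c') ` (coord_set d n \<times> coord_set d n)))"
  have K1: "1 \<le> K" unfolding K_def by (intro Max_ge) (auto simp: finite_coord_set)
  have BK: "B' c c' \<le> K" if "c \<in> coord_set d n" "c' \<in> coord_set d n" for c c'
    unfolding K_def using that by (intro Max_ge) (auto simp: finite_coord_set)
  have "U s i j \<le> K * U s i l" if i: "i < d" and j: "j < n i" and l: "l < n i" for s i j l
  proof -
    obtain j0 where j0: "j0 < n i" "m s i = U s i j0" using m_at[OF i] by blast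
    have "W s i j0 = 1" unfolding W_def using j0 m_pos[OF i, of s] by simp
    then have "W s i j \<le> B' (i, j0) (i, j)" using B'[of "(i, j0)" "(i, j)" s] i j j0 by (simp add: in_coord_set)
    also have "\<dots> \<le> K" using i j j0 by (intro BK) (auto simp: in_coord_set)
    finally have "U s i j \<le> K * m s i" unfolding W_def using m_pos[OF i, of s] by (simp add: field_simps)
    also have "\<dots> \<le> K * U s i l" using K1 m_le[OF l, of s] by (intro mult_left_mono) auto
    finally show ?thesis .
  qed
  then show ?thesis using K1 by (intro exI[of _ K]) auto
qed

text \<open>
  The bound on the ratios inside a block passes to the limit of the approximants, and a block of norm \<open>1\<close> has
  at least one positive entry.
\<close>

theorem strongly_connected_positive_eigenvector:
  assumes \<kappa>: "\<kappa> \<le> 1" and conn: strongly_connected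
  shows "\<exists>u\<in>sphere_pos d n p. G u = u"
proof -
  obtain U e N u where *:
    "\<And>s. U s \<in> sphere_pos d n p" "\<And>s. 1/2 \<le> e s" "\<And>s. e s < 1" "e \<longlonglongrightarrow> (1::real)"
    "\<And>s i. i < d \<Longrightarrow> 0 < N s i"
    "\<And>s i j. i < d \<Longrightarrow> j < n i \<Longrightarrow> F (U s) i j powr e s = N s i * U s i j"
    "U \<longlonglongrightarrow> u" "u \<in> sphere_nonneg d n p"
    "\<And>i. i < d \<Longrightarrow> (\<lambda>s. N s i) \<longlonglongrightarrow> pnorm (n i) (p i) (F u i)"
    "\<And>i j. i < d \<Longrightarrow> j < n i \<Longrightarrow> F u i j = pnorm (n i) (p i) (F u i) * u i j"
    using regularised_eigenvectors[OF \<kappa>] by metis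
  have "(\<lambda>s. gm (N s)) \<longlonglongrightarrow> gm (\<lambda>i. pnorm (n i) (p i) (F u i))"
  proof -
    have "(\<lambda>s. gm (\<lambda>i. max 0 (N s i))) \<longlonglongrightarrow> gm (\<lambda>i. pnorm (n i) (p i) (F u i))"
    proof (rule tendsto_weighted_gm)
      show "(\<lambda>s. max 0 (N s i)) \<longlonglongrightarrow> pnorm (n i) (p i) (F u i)" if "i < d" for i
        using tendsto_max[OF tendsto_const *(9)[OF that], of 0] by simp
    qed (auto intro: b_pos)
    moreover have "gm (\<lambda>i. max 0 (N s i)) = gm (N s)" for s
      using *(5) by (intro weighted_gm_cong) (simp add: less_imp_le max_absorb2)
    ultimately show ?thesis by simp
  qed
  then have "Bseq (\<lambda>s. gm (N s))" by (intro convergent_imp_Bseq convergentI)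
  then obtain B where "\<forall>s. norm (gm (N s)) \<le> B" by (rule BseqE) blast
  then have "gm (N s) \<le> B" for s by simp
  then obtain K where K: "0 < K" "\<And>s i j l. i < d \<Longrightarrow> j < n i \<Longrightarrow> l < n i \<Longrightarrow> U s i j \<le> K * U s i l"
    using min_scaled_bounded[OF \<kappa> conn *(1,2,3,5,6)] by metis
  have up: "0 < u i l" if i: "i < d" and l: "l < n i" for i l
  proof -
    obtain j where j: "j < n i" "0 < u i j" using sphere_nonzero_entry[OF *(8) i] by blast
    have lim: "(\<lambda>s. U s i j) \<longlonglongrightarrow> u i j" for i j using *(7) by (simp add: blockvec_tendsto_iff)
    have "u i j \<le> K * u i l"
      by (rule LIMSEQ_le[OF lim tendsto_mult[OF tendsto_const lim]]) (use K(2) i j l in auto)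
    then have "0 < K * u i l" using j by linarith
    then show ?thesis using K(1) by (simp add: zero_less_mult_iff)
  qed
  then have u: "u \<in> sphere_pos d n p"
    using *(8) unfolding sphere_pos_def sphere_nonneg_def pos_entries_def by auto
  moreover have "G u = u"
    by (rule eigen_imp_fixed_point[OF u pnorm_block_pos[OF F_pos[OF sphere_posD(2)[OF u]]] *(10)])
  ultimately show ?thesis by blast
qed

text \<open>
  The eigenvector equations turn equality \<open>w = v\<close> in a coordinate into equality of the values there, so equality
  moves along edges.
\<close>

lemma touch_path:
  assumes path: "(c, c') \<in> E\<^sup>*" and w: "nonneg_entries d n w" and v: "pos_entries d n v"
    and le: "\<And>i j. i < d \<Longrightarrow> j < n i \<Longrightarrow> w i j \<le> v i j"
    and Fw: "\<And>i j. i < d \<Longrightarrow> j < n i \<Longrightarrow> F w i j = N i * w i j"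
    and Fv: "\<And>i j. i < d \<Longrightarrow> j < n i \<Longrightarrow> F v i j = N i * v i j"
    and c: "w (fst c) (snd c) = v (fst c) (snd c)"
  shows "w (fst c') (snd c') = v (fst c') (snd c')"
  using path
proof (induction rule: rtrancl_induct)
  case (step y z)
  have E: "((fst y, snd y), (fst z, snd z)) \<in> E" using step(2) by simp
  then have y: "fst y < d" "snd y < n (fst y)"
    using subsetD[OF E_coords E] by (auto simp: in_coord_set simp del: prod.collapse)
  have "F w (fst y) (snd y) = F v (fst y) (snd y)" using Fw[OF y] Fv[OF y] step(3) by simp
  from F_touch[OF E w v le this] show ?case .
qed (rule c)

end

context multihom_map
begin

lemma gm_top_ratio_eq_1_imp_eq:
  assumes w: "w \<in> sphere_nonneg d n p" and u: "u \<in> sphere_pos d n p" and g: "gm (tr w u) \<le> 1"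
  shows "w = u"
proof (rule sphere_le_imp_eq[OF w sphere_pos_subset_nonneg[OF u]])
  fix i j assume ij: "i < d" "j < n i"
  have "tr w u i \<le> 1"
  proof (rule ccontr)
    assume "\<not> tr w u i \<le> 1"
    then have "gm (\<lambda>_. 1) < gm (tr w u)"
      using b_pos top_ratio_sphere_ge_1[OF w u] ij by (intro weighted_gm_strict_mono[of d b _ _ i]) auto
    then show False using g by simp
  qed
  moreover have y: "0 < u i j" using pos_entriesD[OF sphere_posD(2)[OF u] ij] .
  ultimately have "tr w u i * u i j \<le> 1 * u i j" by (intro mult_right_mono) auto
  then show "w i j \<le> u i j" using top_ratio_bound[of j n i u w, OF ij(2) y] by simp
qed

text \<open>
  The mean ratio \<open>g \<ge> 1\<close> satisfies \<open>g \<le> g powr \<kappa>\<close>, which for \<open>\<kappa> < 1\<close> forces \<open>g = 1\<close>.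
\<close>

lemma subhomogeneous_unique_eigenvector:
  assumes "\<kappa> < 1" and w: "w \<in> sphere_nonneg d n p" and u: "u \<in> sphere_pos d n p"
    and Fw: "\<And>i j. i < d \<Longrightarrow> j < n i \<Longrightarrow> F w i j = N i * w i j"
    and Fu: "\<And>i j. i < d \<Longrightarrow> j < n i \<Longrightarrow> F u i j = N i * u i j"
  shows "w = u"
proof -
  have N: "0 < N i" if "i < d" for i using upper_bound_pos[OF sphere_posD(2)[OF u] _ that, of N] Fu by auto
  have gN: "0 < gm N" using N by (rule weighted_gm_pos)
  let ?g = "gm (tr w u)"
  have g1: "1 \<le> ?g" by (rule gm_top_ratio_ge_1[OF w u])
  have "gm N * ?g \<le> gm N * ?g powr \<kappa>" using N Fw Fu by (intro gm_compare[OF w u]) (auto simp: less_imp_le)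
  then have "?g \<le> ?g powr \<kappa>" using gN by simp
  have "?g \<le> 1"
  proof (rule ccontr)
    assume "\<not> ?g \<le> 1"
    then have "?g powr \<kappa> < ?g powr 1" using \<open>\<kappa> < 1\<close> by (intro powr_less_mono) auto
    then show False using \<open>?g \<le> ?g powr \<kappa>\<close> g1 by simp
  qed
  then show ?thesis by (rule gm_top_ratio_eq_1_imp_eq[OF w u])
qed

end

context multihom_graph
begin

text \<open>
  For \<open>\<kappa> = 1\<close> the comparison is an equality of means, hence an equality in each block: the maximal ratios \<open>c\<close>
  reproduce themselves under the homogeneity factor. So \<open>v = c u\<close> is an eigenvector for the same
  eigenvalues that lies above \<open>w\<close> and touches it in some coordinate, hence everywhere.
\<close>

lemma strongly_connected_unique_eigenvector:
  assumes \<kappa>: "\<kappa> = 1" and conn: strongly_connected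
    and w: "w \<in> sphere_nonneg d n p" and u: "u \<in> sphere_pos d n p"
    and Fw: "\<And>i j. i < d \<Longrightarrow> j < n i \<Longrightarrow> F w i j = N i * w i j"
    and Fu: "\<And>i j. i < d \<Longrightarrow> j < n i \<Longrightarrow> F u i j = N i * u i j"
  shows "w = u"
proof -
  let ?c = "tr w u"
  note up = sphere_posD(2)[OF u]
  have N: "0 < N i" if "i < d" for i using upper_bound_pos[OF up _ that, of N] Fu by auto
  have c: "0 < ?c k" if "k < d" for k using top_ratio_sphere_pos[OF w up that] .
  have chf: "?c i \<le> hf ?c i" if i: "i < d" for i
  proof -
    have "N i * ?c i \<le> N i * hf ?c i"
      using Fw Fu i c by (intro block_compare[OF sphere_nonnegD(2)[OF w] up]) auto
    then show ?thesis using N[OF i] by simp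
  qed
  have ceq: "hf ?c i = ?c i" if i: "i < d" for i
  proof (rule ccontr)
    assume "hf ?c i \<noteq> ?c i"
    then have "gm ?c < gm (hf ?c)"
      using chf[OF i] by (intro weighted_gm_strict_mono[OF b_pos c chf i]) auto
    then show False using gm_hf[OF c] \<kappa> by simp
  qed
  define v where "v = (\<lambda>i j. ?c i * u i j)"
  have vp: "pos_entries d n v" unfolding v_def pos_entries_def using c pos_entriesD[OF up] by auto
  have Fv: "F v i j = N i * v i j" if "i < d" "j < n i" for i j
    using F_hom[of ?c u i j, OF c pos_imp_nonneg_entries[OF up] that] Fu[OF that] ceq[OF that(1)]
    unfolding v_def by simp
  have wv: "w i j \<le> v i j" if "i < d" "j < n i" for i j
    unfolding v_def using top_ratio_bound[of j n i u w] pos_entriesD[OF up that] that by simp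
  obtain j0 where j0: "j0 < n 0" "?c 0 = w 0 j0 / u 0 j0" using top_ratio_attained[of n 0 w u] n_pos[OF d_pos] by blast
  then have t0: "w 0 j0 = v 0 j0" unfolding v_def using pos_entriesD[OF up d_pos j0(1)] by simp
  have weq: "w i j = ?c i * u i j" if ij: "i < d" "j < n i" for i j
  proof -
    have "((0, j0), (i, j)) \<in> E\<^sup>*"
      using conn ij d_pos j0 unfolding strongly_connected_def by (auto simp: in_coord_set)
    from touch_path[OF this sphere_nonnegD(2)[OF w] vp wv Fw Fv] t0 show ?thesis unfolding v_def by simp
  qed
  have "?c i = 1" if i: "i < d" for i
  proof -
    have p: "0 < p i" using p_gt_1[OF i] by simp
    have "pnorm (n i) (p i) (w i) = pnorm (n i) (p i) (\<lambda>j. ?c i * u i j)" using weq[OF i] by (intro pnorm_cong) auto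
    then show ?thesis using pnorm_scale[OF p] sphere_posD(3)[OF u i] sphere_nonnegD(3)[OF w i] c[OF i] by simp
  qed
  then have "w i j = u i j" if "i < d" "j < n i" for i j using weq[OF that] that by simp
  then show ?thesis by (intro block_space_eqI[OF sphere_nonnegD(1)[OF w] sphere_posD(1)[OF u]])
qed

end

context multihom_map
begin

section \<open>Growth of the iterates\<close>

text \<open>
  Each application of the map replaces the factors by their homogeneity factor, which has the same mean for \<open>\<kappa> = 1\<close>.
\<close>

lemma funpow_F_le:
  assumes \<kappa>: "\<kappa> = 1" and x: "nonneg_entries d n x" and y: "nonneg_entries d n y"
    and c: "\<And>i. i < d \<Longrightarrow> 0 < c i" and le: "\<And>i j. i < d \<Longrightarrow> j < n i \<Longrightarrow> x i j \<le> c i * y i j"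
  shows "\<exists>h. (\<forall>i<d. 0 < h i) \<and> gm h = gm c \<and>
    (\<forall>i<d. \<forall>j<n i. (F ^^ k) x i j \<le> h i * (F ^^ k) y i j)"
proof (induction k)
  case 0
  then show ?case using c le by (intro exI[of _ c]) auto
next
  case (Suc k)
  then obtain h where h: "\<And>i. i < d \<Longrightarrow> 0 < h i" "gm h = gm c"
    "\<And>i j. i < d \<Longrightarrow> j < n i \<Longrightarrow> (F ^^ k) x i j \<le> h i * (F ^^ k) y i j" by blast
  have "F ((F ^^ k) x) i j \<le> hf h i * F ((F ^^ k) y) i j" if "i < d" "j < n i" for i j
    by (rule F_le_hf[OF funpow_F_nonneg[OF x] funpow_F_nonneg[OF y] h(1,3) that])
  then show ?case using hom_factor_pos[OF h(1)] gm_hf[of h] h(1,2) \<kappa>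
    by (intro exI[of _ "hf h"]) auto
qed

lemma funpow_F_sup_eigen:
  assumes \<kappa>: "\<kappa> = 1" and z: "nonneg_entries d n z" and M: "\<And>i. i < d \<Longrightarrow> 0 < M i"
    and Fz: "\<And>i j. i < d \<Longrightarrow> j < n i \<Longrightarrow> F z i j \<le> M i * z i j"
  shows "\<exists>h. (\<forall>i<d. 0 < h i) \<and> gm h = gm M ^ k \<and> (\<forall>i<d. \<forall>j<n i. (F ^^ k) z i j \<le> h i * z i j)"
proof (induction k)
  case 0
  then show ?case by (intro exI[of _ "\<lambda>_. 1"]) auto
next
  case (Suc k)
  then obtain h where h: "\<And>i. i < d \<Longrightarrow> 0 < h i" "gm h = gm M ^ k"
    "\<And>i j. i < d \<Longrightarrow> j < n i \<Longrightarrow> (F ^^ k) z i j \<le> h i * z i j" by blast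
  have "F ((F ^^ k) z) i j \<le> (hf h i * M i) * z i j" if ij: "i < d" "j < n i" for i j
  proof -
    have "F ((F ^^ k) z) i j \<le> hf h i * F z i j"
      by (rule F_le_hf[OF funpow_F_nonneg[OF z] z h(1,3) ij])
    also have "\<dots> \<le> hf h i * (M i * z i j)"
      using hom_factor_pos[of d h a i] h(1) Fz[OF ij] by (intro mult_left_mono) (auto simp: less_imp_le)
    finally show ?thesis by (simp add: mult.assoc)
  qed
  moreover have "gm (\<lambda>i. hf h i * M i) = gm M ^ Suc k"
    using gm_hf[of h] h(1,2) \<kappa> by (simp add: weighted_gm_mult)
  ultimately show ?case using hom_factor_pos[OF h(1)] M by (intro exI[of _ "\<lambda>i. hf h i * M i"]) auto
qed

lemma funpow_F_sub_eigen:
  assumes \<kappa>: "\<kappa> = 1" and z: "nonneg_entries d n z" and M: "\<And>i. i < d \<Longrightarrow> 0 < M i"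
    and Fz: "\<And>i j. i < d \<Longrightarrow> j < n i \<Longrightarrow> M i * z i j \<le> F z i j"
  shows "\<exists>h. (\<forall>i<d. 0 < h i) \<and> gm h = gm M ^ k \<and> (\<forall>i<d. \<forall>j<n i. h i * z i j \<le> (F ^^ k) z i j)"
proof (induction k)
  case 0
  then show ?case by (intro exI[of _ "\<lambda>_. 1"]) auto
next
  case (Suc k)
  then obtain h where h: "\<And>i. i < d \<Longrightarrow> 0 < h i" "gm h = gm M ^ k"
    "\<And>i j. i < d \<Longrightarrow> j < n i \<Longrightarrow> h i * z i j \<le> (F ^^ k) z i j" by blast
  have "(hf h i * M i) * z i j \<le> F ((F ^^ k) z) i j" if ij: "i < d" "j < n i" for i j
  proof -
    have "hf h i * (M i * z i j) \<le> hf h i * F z i j"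
      using hom_factor_pos[of d h a i] h(1) Fz[OF ij] by (intro mult_left_mono) (auto simp: less_imp_le)
    also have "\<dots> \<le> F ((F ^^ k) z) i j"
      by (rule hf_le_F[OF funpow_F_nonneg[OF z] z h(1,3) ij])
    finally show ?thesis by (simp add: mult.assoc)
  qed
  moreover have "gm (\<lambda>i. hf h i * M i) = gm M ^ Suc k"
    using gm_hf[of h] h(1,2) \<kappa> by (simp add: weighted_gm_mult)
  ultimately show ?case using hom_factor_pos[OF h(1)] M by (intro exI[of _ "\<lambda>i. hf h i * M i"]) auto
qed

abbreviation "np \<equiv> norm_product d n p b"

lemma norm_product_eq_gm: "np x = gm (\<lambda>i. pnorm (n i) (p i) (x i))"
  unfolding norm_product_def weighted_gm_def ..

lemma norm_product_le:
  assumes "nonneg_entries d n x" "\<And>i. i < d \<Longrightarrow> 0 \<le> h i"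
    and "\<And>i j. i < d \<Longrightarrow> j < n i \<Longrightarrow> x i j \<le> h i * y i j"
  shows "np x \<le> gm h * np y"
proof -
  have "pnorm (n i) (p i) (x i) \<le> h i * pnorm (n i) (p i) (y i)" if i: "i < d" for i
  proof -
    have p: "0 < p i" using p_gt_1[OF i] by simp
    have "pnorm (n i) (p i) (x i) \<le> pnorm (n i) (p i) (\<lambda>j. h i * y i j)"
    proof (rule pnorm_mono[OF p])
      fix j assume "j < n i"
      then show "\<bar>x i j\<bar> \<le> \<bar>h i * y i j\<bar>"
        using nonneg_entriesD[OF assms(1) i, of j] assms(3)[OF i, of j] by linarith
    qed
    then show ?thesis using pnorm_scale[OF p] assms(2)[OF i] by simp
  qed
  then have "np x \<le> gm (\<lambda>i. h i * pnorm (n i) (p i) (y i))"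
    unfolding norm_product_eq_gm by (intro weighted_gm_mono b_pos) auto
  then show ?thesis by (simp add: weighted_gm_mult norm_product_eq_gm)
qed

lemma norm_product_sphere: "x \<in> sphere_nonneg d n p \<Longrightarrow> np x = 1"
  unfolding norm_product_eq_gm using weighted_gm_cong[of d _ "\<lambda>_. 1"] sphere_nonnegD(3)[of x] by simp

text \<open>
  Combines \<open>x \<le> c z\<close> with the super-eigenvector \<open>z\<close>: the iterates of \<open>x\<close> grow at most like the powers of the mean of \<open>M\<close>.
\<close>

lemma norm_product_funpow_upper:
  assumes \<kappa>: "\<kappa> = 1" and x: "nonneg_entries d n x" and z: "z \<in> sphere_pos d n p"
    and c: "\<And>i. i < d \<Longrightarrow> 0 < c i" and le: "\<And>i j. i < d \<Longrightarrow> j < n i \<Longrightarrow> x i j \<le> c i * z i j"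
    and Fz: "\<And>i j. i < d \<Longrightarrow> j < n i \<Longrightarrow> F z i j \<le> M i * z i j"
  shows "np ((F ^^ k) x) \<le> gm c * gm M ^ k"
proof -
  note zp = sphere_posD(2)[OF z]
  note zn = pos_imp_nonneg_entries[OF zp]
  have M: "0 < M i" if "i < d" for i using upper_bound_pos[OF zp Fz that] .
  obtain h where h: "\<forall>i<d. 0 < h i" "gm h = gm c" "\<forall>i<d. \<forall>j<n i. (F ^^ k) x i j \<le> h i * (F ^^ k) z i j"
    using funpow_F_le[OF \<kappa> x zn c le] by blast
  obtain h' where h': "\<forall>i<d. 0 < h' i" "gm h' = gm M ^ k" "\<forall>i<d. \<forall>j<n i. (F ^^ k) z i j \<le> h' i * z i j"
    using funpow_F_sup_eigen[OF \<kappa> zn M Fz] by blast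
  have "np ((F ^^ k) x) \<le> gm h * np ((F ^^ k) z)"
    using h by (intro norm_product_le funpow_F_nonneg x) (auto simp: less_imp_le)
  also have "\<dots> \<le> gm h * (gm h' * np z)"
    using h' by (intro mult_left_mono norm_product_le funpow_F_nonneg zn) (auto simp: less_imp_le)
  finally show ?thesis using h(2) h'(2) norm_product_sphere[OF sphere_pos_subset_nonneg[OF z]] by simp
qed

text \<open>
  Dual to the upper estimate: \<open>u\<close> is a sub-eigenvector below a multiple of \<open>y\<close>.
\<close>

lemma norm_product_funpow_lower:
  assumes \<kappa>: "\<kappa> = 1" and y: "nonneg_entries d n y" and u: "u \<in> sphere_nonneg d n p"
    and c: "\<And>i. i < d \<Longrightarrow> 0 < c i" and le: "\<And>i j. i < d \<Longrightarrow> j < n i \<Longrightarrow> u i j \<le> c i * y i j"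
    and M: "\<And>i. i < d \<Longrightarrow> 0 < M i" and Fu: "\<And>i j. i < d \<Longrightarrow> j < n i \<Longrightarrow> M i * u i j \<le> F u i j"
  shows "gm M ^ k \<le> gm c * np ((F ^^ k) y)"
proof -
  note un = sphere_nonnegD(2)[OF u]
  obtain h where h: "\<forall>i<d. 0 < h i" "gm h = gm c" "\<forall>i<d. \<forall>j<n i. (F ^^ k) u i j \<le> h i * (F ^^ k) y i j"
    using funpow_F_le[OF \<kappa> un y c le] by blast
  obtain h' where h': "\<forall>i<d. 0 < h' i" "gm h' = gm M ^ k" "\<forall>i<d. \<forall>j<n i. h' i * u i j \<le> (F ^^ k) u i j"
    using funpow_F_sub_eigen[OF \<kappa> un M Fu] by blast
  have "np u \<le> gm (\<lambda>i. 1 / h' i) * np ((F ^^ k) u)"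
    using h' by (intro norm_product_le un) (auto simp: less_imp_le field_simps)
  also have "gm (\<lambda>i. 1 / h' i) = 1 / gm M ^ k" using h'(2) weighted_gm_divide[of d b "\<lambda>_. 1" h'] by simp
  finally have "gm M ^ k \<le> np ((F ^^ k) u)"
    using weighted_gm_pos[of d M b] M norm_product_sphere[OF u] by (simp add: field_simps)
  also have "\<dots> \<le> gm h * np ((F ^^ k) y)"
    using h by (intro norm_product_le funpow_F_nonneg un) (auto simp: less_imp_le)
  finally show ?thesis using h(2) by simp
qed

section \<open>Monotonicity of the Collatz-Wielandt bounds\<close>

lemma F_normalize:
  assumes y: "pos_entries d n y" and ij: "i < d" "j < n i"
  shows "F (nrm y) i j = hf (\<lambda>i. 1 / pnorm (n i) (p i) (y i)) i * F y i j"
proof -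
  let ?c = "\<lambda>i. 1 / pnorm (n i) (p i) (y i)"
  have eq: "nrm y i j = ?c i * y i j" if "i < d" "j < n i" for i j using that unfolding normalize_blocks_def by simp
  have c: "0 < ?c i" if "i < d" for i using pnorm_block_pos[OF y that] by simp
  note nonneg = pos_imp_nonneg_entries[OF y] pos_imp_nonneg_entries[OF sphere_posD(2)[OF normalize_in_sphere_pos[OF y]]]
  have "F (nrm y) i j \<le> hf ?c i * F y i j" using eq c nonneg by (intro F_le_hf ij) auto
  moreover have "hf ?c i * F y i j \<le> F (nrm y) i j" using eq c nonneg by (intro hf_le_F ij) auto
  ultimately show ?thesis by simp
qed

abbreviation "low_ratio x i \<equiv> Min ((\<lambda>j. F x i j / x i j) ` {..<n i})"

text \<open>
  With \<open>M\<close> the maximal ratios of \<open>F x / x\<close> and \<open>N\<close> the norms of \<open>F x\<close>, the next ratios are at most the factor of \<open>M / N\<close>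
  times \<open>N\<close>. Writing \<open>M\<close> and \<open>N\<close> also for the means, the mean of this bound is \<open>(M / N) powr \<kappa> * N \<le> M\<close>, because
  \<open>N \<le> M\<close> on the sphere.
\<close>

lemma upper_step:
  assumes \<kappa>: "\<kappa> \<le> 1" and x: "x \<in> sphere_pos d n p"
  shows "gm (tr (F (G x)) (G x)) \<le> gm (tr (F x) x)"
proof -
  note xp = sphere_posD(2)[OF x]
  let ?N = "\<lambda>i. pnorm (n i) (p i) (F x i)"
  let ?M = "tr (F x) x"
  have N: "0 < ?N i" if "i < d" for i using pnorm_block_pos[OF F_pos[OF xp] that] .
  have M: "0 < ?M i" if "i < d" for i using top_ratio_pos'[OF F_pos[OF xp] xp that] .
  have FM: "F x i j \<le> ?M i * x i j" if "i < d" "j < n i" for i j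
    using top_ratio_bound[of j n i x "F x"] that pos_entriesD[OF xp that] by simp
  have NM: "?N i \<le> ?M i" if i: "i < d" for i
  proof -
    have p: "0 < p i" using p_gt_1[OF i] by simp
    have "?N i \<le> pnorm (n i) (p i) (\<lambda>j. ?M i * x i j)"
    proof (rule pnorm_mono[OF p])
      fix j assume j: "j < n i"
      show "\<bar>F x i j\<bar> \<le> \<bar>?M i * x i j\<bar>" using FM[OF i j] pos_entriesD[OF F_pos[OF xp] i j] by linarith
    qed
    then show ?thesis using pnorm_scale[OF p] M[OF i] sphere_posD(3)[OF x i] by simp
  qed
  have *: "tr (F (G x)) (G x) i \<le> hf (\<lambda>i. ?M i / ?N i) i * ?N i" if i: "i < d" for i
  proof -
    have "F (G x) i j / G x i j \<le> hf (\<lambda>i. ?M i / ?N i) i * ?N i" if j: "j < n i" for j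
    proof -
      have Fp: "0 < F x i j" using pos_entriesD[OF F_pos[OF xp] i j] .
      have "F (F x) i j \<le> hf ?M i * F x i j"
        using FM M i j by (intro F_le_hf F_nonneg pos_imp_nonneg_entries xp) auto
      then have "F (G x) i j \<le> hf (\<lambda>i. 1 / ?N i) i * (hf ?M i * F x i j)"
        unfolding F_normalize[OF F_pos[OF xp] i j] using hom_factor_pos[of d "\<lambda>i. 1 / ?N i" a i] N
        by (intro mult_left_mono) (auto simp: less_imp_le)
      also have "\<dots> = (hf (\<lambda>i. ?M i / ?N i) i * ?N i) * G x i j"
        using N[OF i] i j unfolding hom_factor_def normalize_blocks_def
        by (simp add: powr_divide prod_dividef field_simps)
      finally show ?thesis
        using pos_entriesD[OF sphere_posD(2)[OF G_sphere_pos[OF xp]] i j] by (simp add: divide_le_eq)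
    qed
    then show ?thesis using top_ratio_le_iff[of n i] n_pos[OF i] by blast
  qed
  have gN: "0 < gm ?N" and gM: "0 < gm ?M" using N M by (auto intro: weighted_gm_pos)
  have gNM: "gm ?N \<le> gm ?M" using N NM b_pos by (intro weighted_gm_mono) (auto simp: less_imp_le)
  have "gm (tr (F (G x)) (G x)) \<le> gm (\<lambda>i. hf (\<lambda>i. ?M i / ?N i) i * ?N i)"
    using top_ratio_pos'[OF F_pos[OF sphere_posD(2)[OF G_sphere_pos[OF xp]]] sphere_posD(2)[OF G_sphere_pos[OF xp]]] *
    by (intro weighted_gm_mono b_pos) (auto simp: less_imp_le)
  also have "\<dots> = (gm ?M / gm ?N) powr \<kappa> * gm ?N"
    using gm_hf[of "\<lambda>i. ?M i / ?N i"] M N by (simp add: weighted_gm_mult weighted_gm_divide)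
  also have "\<dots> \<le> (gm ?M / gm ?N) * gm ?N"
    using gNM gN by (intro mult_right_mono powr_le_self \<kappa>) auto
  also have "\<dots> = gm ?M" using gN by simp
  finally show ?thesis .
qed

lemma low_ratio_le: "j < n i \<Longrightarrow> low_ratio x i \<le> F x i j / x i j"
  by (intro Min_le) auto

lemma low_ratio_pos:
  assumes "pos_entries d n x" "i < d" shows "0 < low_ratio x i"
proof -
  have "{..<n i} \<noteq> {}" using n_pos[OF assms(2)] by auto
  then show ?thesis using pos_entriesD[OF F_pos[OF assms(1)] assms(2)] pos_entriesD[OF assms]
    by (subst Min_gr_iff) auto
qed

text \<open>
  The same computation as for the upper bounds with all inequalities reversed: now \<open>M\<close> are the minimal
  ratios, and \<open>M \<le> N\<close>.
\<close>

lemma lower_step: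
  assumes \<kappa>: "\<kappa> \<le> 1" and x: "x \<in> sphere_pos d n p"
  shows "gm (low_ratio x) \<le> gm (low_ratio (G x))"
proof -
  note xp = sphere_posD(2)[OF x]
  let ?N = "\<lambda>i. pnorm (n i) (p i) (F x i)"
  let ?M = "low_ratio x"
  have N: "0 < ?N i" if "i < d" for i using pnorm_block_pos[OF F_pos[OF xp] that] .
  have M: "0 < ?M i" if "i < d" for i using low_ratio_pos[OF xp that] .
  have FM: "?M i * x i j \<le> F x i j" if "i < d" "j < n i" for i j
    using low_ratio_le[of j i x] that pos_entriesD[OF xp that] by (simp add: le_divide_eq)
  have NM: "?M i \<le> ?N i" if i: "i < d" for i
  proof -
    have p: "0 < p i" using p_gt_1[OF i] by simp
    have "pnorm (n i) (p i) (\<lambda>j. ?M i * x i j) \<le> ?N i"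
    proof (rule pnorm_mono[OF p])
      fix j assume j: "j < n i"
      have "0 < ?M i * x i j" using M[OF i] pos_entriesD[OF xp i j] by simp
      then show "\<bar>?M i * x i j\<bar> \<le> \<bar>F x i j\<bar>" using FM[OF i j] by linarith
    qed
    then show ?thesis using pnorm_scale[OF p] M[OF i] sphere_posD(3)[OF x i] by simp
  qed
  have *: "hf (\<lambda>i. ?M i / ?N i) i * ?N i \<le> low_ratio (G x) i" if i: "i < d" for i
  proof -
    have "hf (\<lambda>i. ?M i / ?N i) i * ?N i \<le> F (G x) i j / G x i j" if j: "j < n i" for j
    proof -
      have Fp: "0 < F x i j" using pos_entriesD[OF F_pos[OF xp] i j] .
      have "hf ?M i * F x i j \<le> F (F x) i j"
        using FM M i j by (intro hf_le_F F_nonneg pos_imp_nonneg_entries xp) auto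
      then have le: "hf (\<lambda>i. 1 / ?N i) i * (hf ?M i * F x i j) \<le> F (G x) i j"
        unfolding F_normalize[OF F_pos[OF xp] i j] using hom_factor_pos[of d "\<lambda>i. 1 / ?N i" a i] N
        by (intro mult_left_mono) (auto simp: less_imp_le)
      have "(hf (\<lambda>i. ?M i / ?N i) i * ?N i) * G x i j = hf (\<lambda>i. 1 / ?N i) i * (hf ?M i * F x i j)"
        using N[OF i] i j unfolding hom_factor_def normalize_blocks_def
        by (simp add: powr_divide prod_dividef field_simps)
      then show ?thesis
        using le pos_entriesD[OF sphere_posD(2)[OF G_sphere_pos[OF xp]] i j] by (simp add: le_divide_eq)
    qed
    then show ?thesis using n_pos[OF i] by (subst Min_ge_iff) auto
  qed
  have gN: "0 < gm ?N" and gM: "0 < gm ?M" using N M by (auto intro: weighted_gm_pos)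
  have gNM: "gm ?M \<le> gm ?N" using M NM b_pos by (intro weighted_gm_mono) (auto simp: less_imp_le)
  have "gm ?M = (gm ?M / gm ?N) * gm ?N" using gN by simp
  also have "\<dots> \<le> (gm ?M / gm ?N) powr \<kappa> * gm ?N"
    using gNM gN gM by (intro mult_right_mono self_le_powr \<kappa>) auto
  also have "\<dots> = gm (\<lambda>i. hf (\<lambda>i. ?M i / ?N i) i * ?N i)"
    using gm_hf[of "\<lambda>i. ?M i / ?N i"] M N by (simp add: weighted_gm_mult weighted_gm_divide)
  also have "\<dots> \<le> gm (low_ratio (G x))"
  proof (rule weighted_gm_mono[OF b_pos _ *])
    show "0 \<le> hf (\<lambda>i. ?M i / ?N i) i * ?N i" if "i < d" for i
      using hom_factor_pos[of d "\<lambda>i. ?M i / ?N i" a i] M N that by (intro mult_nonneg_nonneg) (auto simp: less_imp_le)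
  qed
  finally show ?thesis .
qed

section \<open>Convergence for primitive dependency graphs\<close>

lemma normalize_scaled:
  assumes "\<And>i. i < d \<Longrightarrow> 0 < c i" "\<And>i j. i < d \<Longrightarrow> j < n i \<Longrightarrow> x i j = c i * y i j"
  shows "nrm x = nrm y"
proof (intro ext)
  fix i j
  show "nrm x i j = nrm y i j"
  proof (cases "i < d \<and> j < n i")
    case True
    have "pnorm (n i) (p i) (x i) = pnorm (n i) (p i) (\<lambda>j. c i * y i j)"
      using assms(2) True by (intro pnorm_cong) auto
    also have "\<dots> = c i * pnorm (n i) (p i) (y i)"
      using pnorm_scale[of "p i"] p_gt_1[of i] assms(1)[of i] True by (simp add: less_imp_le)
    finally have N: "pnorm (n i) (p i) (x i) = c i * pnorm (n i) (p i) (y i)" .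
    show ?thesis using True assms(1)[of i] assms(2)[of i j] unfolding normalize_blocks_def N by simp
  qed (auto simp: normalize_blocks_def)
qed

lemma funpow_G:
  assumes "z \<in> sphere_pos d n p"
  shows "(G ^^ k) z = nrm ((F ^^ k) z)"
proof (induction k)
  case 0
  have "nrm z = z"
  proof (intro ext)
    show "nrm z i j = z i j" for i j
      using sphere_posD(3)[OF assms, of i] sphere_posD(1)[OF assms]
      unfolding normalize_blocks_def block_space_def by auto
  qed
  then show ?case by simp
next
  case (Suc k)
  let ?y = "(F ^^ k) z"
  have y: "pos_entries d n ?y" by (rule funpow_F_pos[OF sphere_posD(2)[OF assms]])
  let ?c = "\<lambda>i. 1 / pnorm (n i) (p i) (?y i)"
  have c: "0 < ?c i" if "i < d" for i using pnorm_block_pos[OF y that] by simp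
  have "nrm (F (nrm ?y)) = nrm (F ?y)"
    using hom_factor_pos[of d ?c a] c F_normalize[OF y] by (intro normalize_scaled[of "hf ?c"]) auto
  then show ?case using Suc by simp
qed

end

context multihom_graph
begin

text \<open>
  Each application of the map accounts for one edge of the walk.
\<close>

lemma touch_funpow:
  assumes "(c, c') \<in> E ^^ k" and w: "nonneg_entries d n w" and v: "pos_entries d n v"
    and le: "\<And>i j. i < d \<Longrightarrow> j < n i \<Longrightarrow> w i j \<le> v i j"
    and t: "(F ^^ k) w (fst c) (snd c) = (F ^^ k) v (fst c) (snd c)"
  shows "w (fst c') (snd c') = v (fst c') (snd c')"
  using assms(1) t
proof (induction k arbitrary: c)
  case (Suc k)
  have mono: "(F ^^ k) w i j \<le> (F ^^ k) v i j" if "i < d" "j < n i" for i j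
    using that
  proof (induction k arbitrary: i j)
    case (Suc k)
    then show ?case using F_mono[OF funpow_F_nonneg[OF w]] by simp
  qed (use le in auto)
  obtain c'' where c'': "(c, c'') \<in> E" "(c'', c') \<in> E ^^ k" using Suc.prems(1) relpow_Suc_D2 by metis
  have E: "((fst c, snd c), (fst c'', snd c'')) \<in> E" using c'' by simp
  have "(F ^^ k) w (fst c'') (snd c'') = (F ^^ k) v (fst c'') (snd c'')"
    using F_touch[OF E funpow_F_nonneg[OF w] funpow_F_pos[OF v] mono] Suc.prems(2) by simp
  then show ?case by (rule Suc.IH[OF c''(2)])
qed auto

text \<open>
  If \<open>z\<close> and \<open>v = c u\<close> with \<open>z \<le> v\<close> still touched after \<open>K\<close> steps, they would agree everywhere, making \<open>z\<close> a block
  multiple of \<open>u\<close> and hence \<open>z = u\<close>. So one half of \<open>mu\<close> decreases strictly, and the other does not increase.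
\<close>

lemma mu_funpow_less:
  assumes \<kappa>: "\<kappa> = 1" and prim: "\<And>c c'. c \<in> coord_set d n \<Longrightarrow> c' \<in> coord_set d n \<Longrightarrow> (c, c') \<in> E ^^ K"
    and z: "z \<in> sphere_pos d n p" and u: "u \<in> sphere_pos d n p" and ne: "z \<noteq> u"
  shows "mu d n b ((F ^^ K) z) ((F ^^ K) u) < mu d n b z u"
proof -
  note zp = sphere_posD(2)[OF z] and up = sphere_posD(2)[OF u]
  note zn = pos_imp_nonneg_entries[OF zp] and un = pos_imp_nonneg_entries[OF up]
  have le: "gm (tr ((F ^^ K) x) ((F ^^ K) y)) \<le> gm (tr x y)"
    if x: "pos_entries d n x" and y: "pos_entries d n y" for x y
  proof (induction K)
    case (Suc k)
    have "gm (tr (F ((F ^^ k) x)) (F ((F ^^ k) y))) \<le> gm (tr ((F ^^ k) x) ((F ^^ k) y)) powr \<kappa>"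
      by (rule gm_top_ratio_F_le[OF funpow_F_pos[OF x] funpow_F_pos[OF y]])
    then show ?case using Suc \<kappa> by simp
  qed simp
  let ?c = "tr z u"
  have c: "0 < ?c i" if "i < d" for i using top_ratio_pos'[OF zp up that] .
  define v where "v = (\<lambda>i j. ?c i * u i j)"
  have vp: "pos_entries d n v" unfolding v_def pos_entries_def using c pos_entriesD[OF up] by auto
  have zv: "z i j \<le> v i j" if "i < d" "j < n i" for i j
    unfolding v_def using top_ratio_bound[of j n i u z] pos_entriesD[OF up that] that by simp
  have "\<exists>h. (\<forall>i<d. 0 < h i) \<and> gm h = gm ?c \<and> (\<forall>i<d. \<forall>j<n i. (F ^^ K) v i j \<le> h i * (F ^^ K) u i j)"
    by (rule funpow_F_le[OF \<kappa> pos_imp_nonneg_entries[OF vp] un c]) (auto simp: v_def)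
  then obtain h where h: "\<And>i. i < d \<Longrightarrow> 0 < h i" "gm h = gm ?c"
    "\<And>i j. i < d \<Longrightarrow> j < n i \<Longrightarrow> (F ^^ K) v i j \<le> h i * (F ^^ K) u i j" by blast
  have mono: "(F ^^ k) z i j \<le> (F ^^ k) v i j" if "i < d" "j < n i" for i j k
    using that
  proof (induction k arbitrary: i j)
    case (Suc k)
    then show ?case using F_mono[OF funpow_F_nonneg[OF zn]] by simp
  qed (use zv in auto)
  have strict: "(F ^^ K) z i j < (F ^^ K) v i j" if ij: "i < d" "j < n i" for i j
  proof (rule ccontr)
    assume "\<not> (F ^^ K) z i j < (F ^^ K) v i j"
    then have eq: "(F ^^ K) z i j = (F ^^ K) v i j" using mono[OF ij, of K] by simp
    have zc: "z k l = ?c k * u k l" if kl: "k < d" "l < n k" for k l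
    proof -
      have "((i, j), (k, l)) \<in> E ^^ K" using ij kl by (intro prim) (auto simp: in_coord_set)
      from touch_funpow[OF this zn vp zv] eq show ?thesis unfolding v_def by simp
    qed
    have c1: "?c k = 1" if k: "k < d" for k
    proof -
      have p: "0 < p k" using p_gt_1[OF k] by simp
      have "pnorm (n k) (p k) (z k) = pnorm (n k) (p k) (\<lambda>j. ?c k * u k j)" using zc[OF k] by (intro pnorm_cong) auto
      then show ?thesis using pnorm_scale[OF p] sphere_posD(3)[OF u k] sphere_posD(3)[OF z k] c[OF k] by simp
    qed
    have "z = u" by (rule block_space_eqI[OF sphere_posD(1)[OF z] sphere_posD(1)[OF u]]) (use zc c1 in simp)
    with ne show False by simp
  qed
  have FKu: "pos_entries d n ((F ^^ K) u)" and FKz: "pos_entries d n ((F ^^ K) z)"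
    by (rule funpow_F_pos[OF up], rule funpow_F_pos[OF zp])
  have trh: "tr ((F ^^ K) z) ((F ^^ K) u) i < h i" if i: "i < d" for i
  proof -
    obtain j where j: "j < n i" "tr ((F ^^ K) z) ((F ^^ K) u) i = (F ^^ K) z i j / (F ^^ K) u i j"
      using top_ratio_attained[of n i] n_pos[OF i] by blast
    have "(F ^^ K) z i j < h i * (F ^^ K) u i j" using strict[OF i j(1)] h(3)[OF i j(1)] by linarith
    then show ?thesis using j(2) pos_entriesD[OF FKu i j(1)] by (simp add: divide_less_eq)
  qed
  have g1: "gm (tr ((F ^^ K) z) ((F ^^ K) u)) < gm ?c"
    unfolding h(2)[symmetric]
    using b_pos top_ratio_pos'[OF FKz FKu] trh d_pos
    by (intro weighted_gm_strict_mono[of d b _ _ 0]) (auto simp: less_imp_le)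
  have g2: "gm (tr ((F ^^ K) u) ((F ^^ K) z)) \<le> gm (tr u z)" by (rule le[OF up zp])
  have "ln (gm (tr ((F ^^ K) z) ((F ^^ K) u))) < ln (gm ?c)"
    using g1 gm_top_pos[OF FKz FKu] gm_top_pos[OF zp up] by simp
  moreover have "ln (gm (tr ((F ^^ K) u) ((F ^^ K) z))) \<le> ln (gm (tr u z))"
    using g2 gm_top_pos[OF FKu FKz] gm_top_pos[OF up zp] by simp
  ultimately show ?thesis using mu_eq_ln_gm[OF FKz FKu] mu_eq_ln_gm[OF zp up] by simp
qed

text \<open>
  \<open>mu (x k) u\<close> decreases to some \<open>L\<close>. A limit point \<open>z\<close> of the orbit and its \<open>K\<close>-th image are both at distance \<open>L\<close>
  from \<open>u\<close>, which contradicts the strict decrease unless \<open>z = u\<close>; then \<open>L = 0\<close>.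
\<close>

theorem primitive_convergence:
  assumes \<kappa>: "\<kappa> = 1" and prim: "\<And>c c'. c \<in> coord_set d n \<Longrightarrow> c' \<in> coord_set d n \<Longrightarrow> (c, c') \<in> E ^^ K"
    and u: "u \<in> sphere_pos d n p" and Gu: "G u = u"
    and x0: "x 0 \<in> sphere_pos d n p" and x: "\<And>k. x (Suc k) = G (x k)"
  shows "x \<longlonglongrightarrow> u"
proof -
  let ?m = "mu d n b"
  have xs: "x k \<in> sphere_pos d n p" for k by (rule iterates_in_sphere[of x, OF x0 x])
  note xp = sphere_posD(2)[OF xs] and up = sphere_posD(2)[OF u]
  have dec: "?m (x (Suc k)) u \<le> ?m (x k) u" for k
    using mu_G_le[OF xp up, of k] \<kappa> unfolding x Gu by simp
  then have decs: "decseq (\<lambda>k. ?m (x k) u)" by (rule decseq_SucI)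
  obtain L where L: "(\<lambda>k. ?m (x k) u) \<longlonglongrightarrow> L"
    using decseq_convergent[OF decs, of 0] mu_nonneg[OF xs u] by blast
  have "?m (x k) u \<le> ?m (x 0) u" for k using decseqD[OF decs, of 0 k] by simp
  then obtain \<phi> z where \<phi>: "strict_mono (\<phi> :: nat \<Rightarrow> nat)" "(\<lambda>k. x (\<phi> k)) \<longlonglongrightarrow> z" "z \<in> sphere_pos d n p"
    using mu_bounded_sphere_limit[of x u "?m (x 0) u"] xs u by blast
  note zp = sphere_posD(2)[OF \<phi>(3)]
  have GK: "(G ^^ k) y \<in> sphere_pos d n p" if "y \<in> sphere_pos d n p" for y k
  proof (induction k)
    case (Suc k)
    then show ?case using G_sphere_pos[OF sphere_posD(2)[OF Suc]] by simp
  qed (use that in simp)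
  have xK: "x (k + l) = (G ^^ l) (x k)" for k l by (induction l) (simp_all add: x)
  have "(\<lambda>k. (G ^^ l) (x (\<phi> k))) \<longlonglongrightarrow> (G ^^ l) z" for l
  proof (induction l)
    case (Suc l)
    then show ?case using tendsto_G[OF sphere_posD(2)[OF GK[OF xs]] Suc sphere_posD(2)[OF GK[OF \<phi>(3)]]] by simp
  qed (use \<phi>(2) in simp)
  then have lim: "(\<lambda>k. x (\<phi> k + K)) \<longlonglongrightarrow> (G ^^ K) z" by (simp add: xK)
  have L1: "?m z u = L"
  proof (rule LIMSEQ_unique)
    show "(\<lambda>k. ?m (x (\<phi> k)) u) \<longlonglongrightarrow> ?m z u" by (rule tendsto_mu[OF \<phi>(2) tendsto_const zp up])
    show "(\<lambda>k. ?m (x (\<phi> k)) u) \<longlonglongrightarrow> L" using LIMSEQ_subseq_LIMSEQ[OF L \<phi>(1)] by (simp add: o_def)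
  qed
  have L2: "?m ((G ^^ K) z) u = L"
  proof (rule LIMSEQ_unique)
    show "(\<lambda>k. ?m (x (\<phi> k + K)) u) \<longlonglongrightarrow> ?m ((G ^^ K) z) u"
      by (rule tendsto_mu[OF lim tendsto_const sphere_posD(2)[OF GK[OF \<phi>(3)]] up])
    have "strict_mono (\<lambda>k. \<phi> k + K)" using \<phi>(1) by (simp add: strict_mono_def)
    from LIMSEQ_subseq_LIMSEQ[OF L this] show "(\<lambda>k. ?m (x (\<phi> k + K)) u) \<longlonglongrightarrow> L" by (simp add: o_def)
  qed
  have "z = u"
  proof (rule ccontr)
    assume ne: "z \<noteq> u"
    have "(G ^^ K) u = u" by (induction K) (simp_all add: Gu)
    then have "?m ((G ^^ K) z) u = ?m (nrm ((F ^^ K) z)) (nrm ((F ^^ K) u))"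
      using funpow_G[OF \<phi>(3), of K] funpow_G[OF u, of K] by simp
    also have "\<dots> = ?m ((F ^^ K) z) ((F ^^ K) u)"
      by (simp add: mu_normalize[OF funpow_F_pos[OF zp]] mu_normalize_right[OF funpow_F_pos[OF up]])
    also have "\<dots> < ?m z u" by (rule mu_funpow_less[OF \<kappa> prim \<phi>(3) u ne])
    finally show False using L1 L2 by simp
  qed
  then have "L = 0" using L1 mu_self[OF up] by simp
  then show ?thesis using tendsto_if_mu_tendsto_0[of x u, OF xs u] L by simp
qed

end

section \<open>Positions and blocks of the tensor\<close>

lemma offset_Suc: "offset \<nu> (Suc i) = offset \<nu> i + \<nu> i"
  unfolding offset_def by simp

lemma offset_mono: "i \<le> k \<Longrightarrow> offset \<nu> i \<le> offset \<nu> k"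
  unfolding offset_def by (intro sum_mono2) auto

text \<open>
  The intervals of positions that belong to different blocks are disjoint.
\<close>

lemma block_of_eqI:
  assumes "offset \<nu> i \<le> q" "q < offset \<nu> (Suc i)"
  shows "block_of \<nu> q = i"
  unfolding block_of_def
proof (rule the_equality)
  show "offset \<nu> i \<le> q \<and> q < offset \<nu> i + \<nu> i" using assms by (simp add: offset_Suc)
  fix k assume k: "offset \<nu> k \<le> q \<and> q < offset \<nu> k + \<nu> k"
  show "k = i"
  proof (rule ccontr)
    assume "k \<noteq> i"
    then have "Suc k \<le> i \<or> Suc i \<le> k" by linarith
    then show False using offset_mono[of "Suc k" i \<nu>] offset_mono[of "Suc i" k \<nu>] assms k
      by (auto simp: offset_Suc)
  qed
qed

lemma block_of_less: "q < offset \<nu> d \<Longrightarrow> block_of \<nu> q < d"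
proof (induction d)
  case (Suc d)
  show ?case
  proof (cases "q < offset \<nu> d")
    case True then show ?thesis using Suc.IH by simp
  next
    case False then show ?thesis using block_of_eqI[of \<nu> d q] Suc.prems by simp
  qed
qed (simp add: offset_def)

lemma prod_block_of:
  fixes c :: "nat \<Rightarrow> real"
  shows "(\<Prod>q<offset \<nu> d. c (block_of \<nu> q)) = (\<Prod>k<d. c k ^ \<nu> k)"
proof (induction d)
  case (Suc d)
  have "{..<offset \<nu> (Suc d)} = {..<offset \<nu> d} \<union> {offset \<nu> d..<offset \<nu> (Suc d)}"
    using offset_mono[of d "Suc d" \<nu>] by auto
  then have "(\<Prod>q<offset \<nu> (Suc d). c (block_of \<nu> q)) =
      (\<Prod>q<offset \<nu> d. c (block_of \<nu> q)) * (\<Prod>q\<in>{offset \<nu> d..<offset \<nu> (Suc d)}. c (block_of \<nu> q))"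
    by (simp add: prod.union_disjoint ivl_disj_int)
  also have "(\<Prod>q\<in>{offset \<nu> d..<offset \<nu> (Suc d)}. c (block_of \<nu> q)) = (\<Prod>q\<in>{offset \<nu> d..<offset \<nu> (Suc d)}. c d)"
    by (intro prod.cong refl arg_cong[of _ _ c] block_of_eqI) auto
  also have "\<dots> = c d ^ \<nu> d" by (simp add: offset_Suc)
  finally show ?case using Suc by simp
qed (simp add: offset_def)

lemma multi_indices_less:
  "J \<in> multi_indices d \<nu> n \<Longrightarrow> q < offset \<nu> d \<Longrightarrow> J q < n (block_of \<nu> q)"
  unfolding multi_indices_def by auto

lemma conj_exp_minus_1: "1 < q \<Longrightarrow> conj_exp q - 1 = 1 / (q - 1)"
  unfolding conj_exp_def by (simp add: field_simps)

lemma conj_exp_gt_1: "1 < q \<Longrightarrow> 1 < conj_exp q"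
  unfolding conj_exp_def by (simp add: field_simps)

lemma psi_nonneg_eq: "0 \<le> z \<Longrightarrow> psi q z = z powr (q - 1)"
  unfolding psi_def by (cases "z = 0") auto

section \<open>The map of a nonnegative tensor\<close>

locale nonneg_tensor =
  fixes d :: nat and \<nu> n :: "nat \<Rightarrow> nat" and p :: "nat \<Rightarrow> real" and t :: "(nat \<Rightarrow> nat) \<Rightarrow> real"
  assumes d_ge_1: "1 \<le> d" and \<nu>_ge_1: "i < d \<Longrightarrow> 1 \<le> \<nu> i" and order_ge_2: "2 \<le> (\<Sum>i<d. \<nu> i)"
    and n_ge_1: "i < d \<Longrightarrow> 1 \<le> n i" and p_greater_1: "i < d \<Longrightarrow> 1 < p i"
    and t_nonneg: "j \<in> multi_indices d \<nu> n \<Longrightarrow> 0 \<le> t j"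
    and R_ones_pos: "pos_entries d n (tensor_map d \<nu> n p t (ones d n))"
begin

abbreviation "R \<equiv> tensor_map d \<nu> n p t"
abbreviation "m \<equiv> offset \<nu> d"

text \<open>
  The gradient of the form with respect to the first argument of block \<open>i\<close>, with the same vector
  plugged in at all positions of a block.
\<close>

definition grad :: "blockvec \<Rightarrow> nat \<Rightarrow> nat \<Rightarrow> real" where
  "grad x i l = form_gradient d \<nu> n t (offset \<nu> i) l (\<lambda>q. x (block_of \<nu> q))"

definition expo :: "nat \<Rightarrow> nat \<Rightarrow> real" where
  "expo i k = (conj_exp (p i) - 1) * (real (\<nu> k) - (if i = k then 1 else 0))"

text \<open>
  An edge leads from \<open>(i, j)\<close> to every coordinate \<open>(k, l)\<close> that occurs in some monomial of \<open>R_(i,j)\<close> with a positive coefficient.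
\<close>

definition edges :: "((nat \<times> nat) \<times> (nat \<times> nat)) set" where
  "edges = {((i, j), (k, l)). i < d \<and> j < n i \<and> (\<exists>J\<in>multi_indices d \<nu> n. 0 < t J \<and> J (offset \<nu> i) = j \<and>
     (\<exists>q<m. q \<noteq> offset \<nu> i \<and> block_of \<nu> q = k \<and> J q = l))}"

lemma offset_less_order: "i < d \<Longrightarrow> offset \<nu> i < m"
  using offset_mono[of "Suc i" d \<nu>] \<nu>_ge_1[of i] by (simp add: offset_Suc)

lemma block_of_offset: "i < d \<Longrightarrow> block_of \<nu> (offset \<nu> i) = i"
  using \<nu>_ge_1[of i] by (intro block_of_eqI) (auto simp: offset_Suc)

lemma conj_pos: "i < d \<Longrightarrow> 0 < conj_exp (p i) - 1"
  using conj_exp_gt_1[OF p_greater_1] by simp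

lemma grad_eq:
  "grad x i l = (\<Sum>J\<in>{J \<in> multi_indices d \<nu> n. J (offset \<nu> i) = l}.
     t J * (\<Prod>r\<in>{..<m} - {offset \<nu> i}. x (block_of \<nu> r) (J r)))"
  unfolding grad_def form_gradient_def ..

lemma finite_slice: "finite {J \<in> multi_indices d \<nu> n. J q = l}"
  using finite_multi_indices by auto

lemma nonneg_factor:
  "nonneg_entries d n x \<Longrightarrow> J \<in> multi_indices d \<nu> n \<Longrightarrow> r < m \<Longrightarrow> 0 \<le> x (block_of \<nu> r) (J r)"
  using multi_indices_less block_of_less nonneg_entriesD by metis

lemma grad_nonneg: "nonneg_entries d n x \<Longrightarrow> 0 \<le> grad x i l"
  unfolding grad_eq using t_nonneg nonneg_factor
  by (intro sum_nonneg mult_nonneg_nonneg prod_nonneg) auto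

lemma R_eq_psi: "i < d \<Longrightarrow> l < n i \<Longrightarrow> R x i l = psi (conj_exp (p i)) (grad x i l)"
  unfolding tensor_map_def grad_def by simp

lemma R_eq_powr:
  "nonneg_entries d n x \<Longrightarrow> i < d \<Longrightarrow> l < n i \<Longrightarrow> R x i l = grad x i l powr (conj_exp (p i) - 1)"
  using R_eq_psi psi_nonneg_eq grad_nonneg by simp

lemma grad_term_mono:
  assumes "nonneg_entries d n x" "\<And>i j. i < d \<Longrightarrow> j < n i \<Longrightarrow> x i j \<le> y i j" "J \<in> multi_indices d \<nu> n"
  shows "t J * (\<Prod>r\<in>{..<m} - {q}. x (block_of \<nu> r) (J r)) \<le> t J * (\<Prod>r\<in>{..<m} - {q}. y (block_of \<nu> r) (J r))"
proof (intro mult_left_mono prod_mono t_nonneg assms(3))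
  fix r assume "r \<in> {..<m} - {q}"
  then have r: "r < m" by auto
  show "0 \<le> x (block_of \<nu> r) (J r) \<and> x (block_of \<nu> r) (J r) \<le> y (block_of \<nu> r) (J r)"
    using nonneg_factor[OF assms(1,3) r] assms(2)[OF block_of_less[OF r] multi_indices_less[OF assms(3) r]] by simp
qed

lemma grad_mono:
  assumes "nonneg_entries d n x" "\<And>i j. i < d \<Longrightarrow> j < n i \<Longrightarrow> x i j \<le> y i j"
  shows "grad x i l \<le> grad y i l"
  unfolding grad_eq using grad_term_mono[OF assms] by (intro sum_mono) auto

text \<open>
  Deleting one position of block \<open>i\<close> lowers the exponent of \<open>c i\<close> by one, which is the Kronecker delta in the
  homogeneity matrix.
\<close>

lemma prod_block_of_minus:
  assumes c: "\<And>k. k < d \<Longrightarrow> 0 < (c k :: real)" and i: "i < d"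
  shows "(\<Prod>r\<in>{..<m} - {offset \<nu> i}. c (block_of \<nu> r)) = (\<Prod>k<d. c k powr (real (\<nu> k) - (if i = k then 1 else 0)))"
proof -
  let ?P = "\<Prod>r\<in>{..<m} - {offset \<nu> i}. c (block_of \<nu> r)"
  let ?Q = "\<Prod>k<d. c k powr (real (\<nu> k) - (if i = k then 1 else 0))"
  have "(\<Prod>r<m. c (block_of \<nu> r)) = c i * ?P"
    using offset_less_order[OF i] block_of_offset[OF i] by (subst prod.remove[of _ "offset \<nu> i"]) auto
  then have "c i * ?P = (\<Prod>k<d. c k ^ \<nu> k)" by (simp add: prod_block_of)
  also have "\<dots> = (\<Prod>k<d. (if i = k then c k else 1) * c k powr (real (\<nu> k) - (if i = k then 1 else 0)))"
  proof (intro prod.cong refl)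
    fix k assume "k \<in> {..<d}"
    then have ck: "0 < c k" using c by simp
    show "c k ^ \<nu> k = (if i = k then c k else 1) * c k powr (real (\<nu> k) - (if i = k then 1 else 0))"
      using ck powr_mult_base[of "c k" "real (\<nu> k) - 1"] by (simp add: powr_realpow)
  qed
  also have "\<dots> = c i * ?Q" using i by (simp add: prod.distrib)
  finally show ?thesis using c[OF i] by simp
qed

lemma grad_hom:
  assumes c: "\<And>k. k < d \<Longrightarrow> 0 < c k" and i: "i < d"
  shows "grad (\<lambda>i j. c i * x i j) i l =
    (\<Prod>k<d. c k powr (real (\<nu> k) - (if i = k then 1 else 0))) * grad x i l"
proof -
  have "(\<Prod>r\<in>{..<m} - {offset \<nu> i}. c (block_of \<nu> r) * x (block_of \<nu> r) (J r)) =
      (\<Prod>k<d. c k powr (real (\<nu> k) - (if i = k then 1 else 0))) *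
      (\<Prod>r\<in>{..<m} - {offset \<nu> i}. x (block_of \<nu> r) (J r))" for J
    using prod_block_of_minus[of c i] c i by (simp add: prod.distrib)
  then show ?thesis unfolding grad_eq by (simp only: sum_distrib_left mult.left_commute)
qed

lemma tendsto_grad:
  assumes "(f \<longlongrightarrow> x) G" shows "((\<lambda>s. grad (f s) i l) \<longlongrightarrow> grad x i l) G"
  unfolding grad_eq using assms by (intro tendsto_intros) (auto simp: blockvec_tendsto_iff)

text \<open>
  The form is linear in its argument at the first position of block \<open>i\<close>. The right-hand side does not depend
  on \<open>i\<close>, which is what couples the eigenvalues of the blocks.
\<close>

lemma euler_identity:
  assumes i: "i < d"
  shows "(\<Sum>l<n i. grad x i l * x i l) = multilinear_form d \<nu> n t (\<lambda>q. x (block_of \<nu> q))"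
proof -
  let ?q = "offset \<nu> i"
  let ?h = "\<lambda>J. t J * (\<Prod>r<m. x (block_of \<nu> r) (J r))"
  have "(\<Sum>l<n i. grad x i l * x i l) = (\<Sum>l<n i. \<Sum>J\<in>{J \<in> multi_indices d \<nu> n. J ?q = l}. ?h J)"
  proof (intro sum.cong refl)
    fix l assume "l \<in> {..<n i}"
    show "grad x i l * x i l = (\<Sum>J\<in>{J \<in> multi_indices d \<nu> n. J ?q = l}. ?h J)"
      unfolding grad_eq sum_distrib_right
    proof (intro sum.cong refl)
      fix J assume J: "J \<in> {J \<in> multi_indices d \<nu> n. J ?q = l}"
      have "(\<Prod>r<m. x (block_of \<nu> r) (J r)) = x i l * (\<Prod>r\<in>{..<m} - {?q}. x (block_of \<nu> r) (J r))"
        using offset_less_order[OF i] block_of_offset[OF i] J by (subst prod.remove[of _ ?q]) auto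
      then show "t J * (\<Prod>r\<in>{..<m} - {?q}. x (block_of \<nu> r) (J r)) * x i l = ?h J" by (simp add: mult_ac)
    qed
  qed
  also have "\<dots> = sum ?h (multi_indices d \<nu> n)"
    using multi_indices_less[of _ d \<nu> n ?q] offset_less_order[OF i] block_of_offset[OF i]
    by (intro sum.group finite_multi_indices) auto
  finally show ?thesis unfolding multilinear_form_def .
qed

lemma R_hom:
  assumes c: "\<And>k. k < d \<Longrightarrow> 0 < c k" and x: "nonneg_entries d n x" and ij: "i < d" "j < n i"
  shows "R (\<lambda>i j. c i * x i j) i j = hom_factor d expo c i * R x i j"
proof -
  have cx: "nonneg_entries d n (\<lambda>i j. c i * x i j)"
    using x c unfolding nonneg_entries_def by (simp add: less_imp_le)
  have "hom_factor d expo c i = (\<Prod>k<d. c k powr (real (\<nu> k) - (if i = k then 1 else 0))) powr (conj_exp (p i) - 1)"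
    unfolding hom_factor_def expo_def by (simp add: prod_powr_distrib powr_powr mult.commute)
  then show ?thesis using R_eq_powr[OF cx ij] R_eq_powr[OF x ij] grad_hom[OF c ij(1)] by (simp add: powr_mult)
qed

lemma R_mono:
  assumes "nonneg_entries d n x" "\<And>i j. i < d \<Longrightarrow> j < n i \<Longrightarrow> x i j \<le> y i j" "i < d" "j < n i"
  shows "R x i j \<le> R y i j"
proof -
  have y: "nonneg_entries d n y" using assms(1,2) unfolding nonneg_entries_def by (meson order_trans)
  show ?thesis
    unfolding R_eq_powr[OF assms(1,3,4)] R_eq_powr[OF y assms(3,4)]
    using grad_nonneg[OF assms(1)] grad_mono[OF assms(1,2)] conj_pos[OF assms(3)]
    by (intro powr_mono2) auto
qed

lemma R_nonneg: "nonneg_entries d n x \<Longrightarrow> nonneg_entries d n (R x)"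
  unfolding nonneg_entries_def[of d n "R x"] using R_eq_powr by simp

lemma R_cont:
  assumes "\<And>s. nonneg_entries d n (f s)" "f \<longlonglongrightarrow> x"
  shows "(\<lambda>s. R (f s)) \<longlonglongrightarrow> R x"
  unfolding blockvec_tendsto_iff
proof (intro allI)
  fix i j
  show "(\<lambda>s. R (f s) i j) \<longlonglongrightarrow> R x i j"
  proof (cases "i < d \<and> j < n i")
    case True
    have f: "(\<lambda>s. f s i j) \<longlonglongrightarrow> x i j" for i j using assms(2) by (simp add: blockvec_tendsto_iff)
    have x: "nonneg_entries d n x" unfolding nonneg_entries_def
      using nonneg_entriesD[OF assms(1)] by (auto intro!: LIMSEQ_le_const[OF f])
    have "(\<lambda>s. grad (f s) i j powr (conj_exp (p i) - 1)) \<longlonglongrightarrow> grad x i j powr (conj_exp (p i) - 1)"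
      using conj_pos True grad_nonneg[OF assms(1)] by (intro tendsto_powr' tendsto_grad assms(2) tendsto_const) auto
    then show ?thesis using R_eq_powr[OF assms(1)] R_eq_powr[OF x] True by simp
  qed (auto simp: tensor_map_def)
qed

lemma edges_coords: "edges \<subseteq> coord_set d n \<times> coord_set d n"
  unfolding edges_def using multi_indices_less block_of_less by (fastforce simp: in_coord_set)

text \<open>
  The gradient is a sum of monomials that are all monotone. Strict inequality in one factor of a monomial with
  positive coefficient makes this monomial, and hence the sum, strictly smaller, since \<open>v > 0\<close>.
\<close>

lemma R_touch:
  assumes E: "((i, j), (k, l)) \<in> edges" and w: "nonneg_entries d n w" and v: "pos_entries d n v"
    and le: "\<And>i j. i < d \<Longrightarrow> j < n i \<Longrightarrow> w i j \<le> v i j" and eq: "R w i j = R v i j"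
  shows "w k l = v k l"
proof (rule ccontr)
  assume ne: "w k l \<noteq> v k l"
  obtain J q where J: "i < d" "j < n i" "J \<in> multi_indices d \<nu> n" "0 < t J" "J (offset \<nu> i) = j"
    and q: "q < m" "q \<noteq> offset \<nu> i" "block_of \<nu> q = k" "J q = l" using E unfolding edges_def by auto
  have kl: "k < d" "l < n k" using block_of_less[OF q(1)] multi_indices_less[OF J(3) q(1)] q by auto
  let ?t = "\<lambda>x J. t J * (\<Prod>r\<in>{..<m} - {offset \<nu> i}. x (block_of \<nu> r) (J r))"
  have "?t w J < ?t v J"
  proof (rule mult_strict_left_mono[OF prod_mono_strict[of q] J(4)])
    show "w (block_of \<nu> q) (J q) < v (block_of \<nu> q) (J q)" using ne le[OF kl] q by simp
    show "0 \<le> w (block_of \<nu> r) (J r) \<and> w (block_of \<nu> r) (J r) \<le> v (block_of \<nu> r) (J r)"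
      if "r \<in> {..<m} - {offset \<nu> i}" for r
      using that nonneg_factor[OF w J(3), of r] le block_of_less multi_indices_less[OF J(3)] by auto
    show "0 < v (block_of \<nu> r) (J r)" if "r \<in> {..<m} - {offset \<nu> i}" for r
      using that pos_entriesD[OF v] block_of_less multi_indices_less[OF J(3)] by auto
  qed (use q in auto)
  then have "grad w i j < grad v i j"
    unfolding grad_eq using grad_term_mono[OF w le] J by (intro sum_strict_mono_ex1 finite_slice) auto
  then have "R w i j < R v i j"
    unfolding R_eq_powr[OF w J(1,2)] R_eq_powr[OF pos_imp_nonneg_entries[OF v] J(1,2)]
    using grad_nonneg[OF w] conj_pos[OF J(1)] by (intro powr_less_mono2) auto
  with eq show False by simp
qed

text \<open>
  Keep one monomial with a positive coefficient and bound all factors except the one at \<open>(k, l)\<close> below by \<open>1\<close>.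
\<close>

lemma R_growth:
  assumes E: "((i, j), (k, l)) \<in> edges"
  shows "\<exists>\<delta>>0. \<exists>\<alpha>>0. \<forall>w. (\<forall>i<d. \<forall>j<n i. 1 \<le> w i j) \<longrightarrow> \<delta> * w k l powr \<alpha> \<le> R w i j"
proof -
  obtain J q where J: "i < d" "j < n i" "J \<in> multi_indices d \<nu> n" "0 < t J" "J (offset \<nu> i) = j"
    and q: "q < m" "q \<noteq> offset \<nu> i" "block_of \<nu> q = k" "J q = l" using E unfolding edges_def by auto
  let ?\<alpha> = "conj_exp (p i) - 1"
  have "t J powr ?\<alpha> * w k l powr ?\<alpha> \<le> R w i j" if w1: "\<forall>i<d. \<forall>j<n i. 1 \<le> w i j" for w
  proof -
    have wn: "nonneg_entries d n w" unfolding nonneg_entries_def using w1 by (meson order_trans zero_le_one)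
    have fac: "1 \<le> w (block_of \<nu> r) (J r)" if "r < m" for r
      using w1 block_of_less[OF that] multi_indices_less[OF J(3) that] by blast
    have "t J * w k l \<le> t J * (\<Prod>r\<in>{..<m} - {offset \<nu> i}. w (block_of \<nu> r) (J r))"
    proof (rule mult_left_mono)
      have "1 \<le> (\<Prod>r\<in>{..<m} - {offset \<nu> i} - {q}. w (block_of \<nu> r) (J r))"
        using fac by (intro prod_ge_1) auto
      then have "w k l * 1 \<le> w k l * (\<Prod>r\<in>{..<m} - {offset \<nu> i} - {q}. w (block_of \<nu> r) (J r))"
        using fac[OF q(1)] q by (intro mult_left_mono) auto
      then show "w k l \<le> (\<Prod>r\<in>{..<m} - {offset \<nu> i}. w (block_of \<nu> r) (J r))"
        using q by (subst prod.remove[of _ q]) auto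
    qed (use J in simp)
    also have "\<dots> \<le> grad w i j"
      unfolding grad_eq using J t_nonneg nonneg_factor[OF wn]
      by (intro member_le_sum[of J _ "\<lambda>J. t J * (\<Prod>r\<in>{..<m} - {offset \<nu> i}. w (block_of \<nu> r) (J r))"])
         (auto intro!: mult_nonneg_nonneg prod_nonneg simp: finite_slice)
    finally have "(t J * w k l) powr ?\<alpha> \<le> grad w i j powr ?\<alpha>"
      using J fac[OF q(1)] q conj_pos[OF J(1)] by (intro powr_mono2) auto
    then show ?thesis using R_eq_powr[OF wn J(1,2)] by (simp add: powr_mult)
  qed
  then show ?thesis using J(4) conj_pos[OF J(1)] by (intro exI[of _ "t J powr ?\<alpha>"] conjI exI[of _ ?\<alpha>]) auto
qed

section \<open>One eigenvalue for all blocks\<close>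

text \<open>
  Undoing the power in \<open>R_i(u) = N_i u_i\<close> gives \<open>T_i(u) = N_i powr (p_i - 1) * u_i powr (p_i - 1)\<close>. The pairing with
  \<open>u_i\<close>, a vector of norm one, equals \<open>N_i powr (p_i - 1)\<close>, and by Euler it is the value of the form.
\<close>

lemma block_eigenvalues_from_one:
  assumes u: "u \<in> sphere_nonneg d n p" and N: "\<And>i. i < d \<Longrightarrow> 0 \<le> N i"
    and Ru: "\<And>i j. i < d \<Longrightarrow> j < n i \<Longrightarrow> R u i j = N i * u i j"
  shows "\<exists>\<theta>\<ge>0. \<forall>i<d. N i = \<theta> powr (conj_exp (p i) - 1)"
proof -
  have un: "nonneg_entries d n u" and us: "\<And>i. i < d \<Longrightarrow> pnorm (n i) (p i) (u i) = 1"
    using u unfolding sphere_nonneg_def sphere_set_def by auto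
  let ?\<tau> = "multilinear_form d \<nu> n t (\<lambda>q. u (block_of \<nu> q))"
  have "N i powr (p i - 1) = ?\<tau>" if i: "i < d" for i
  proof -
    have p1: "1 < p i" using p_greater_1[OF i] .
    have "grad u i l * u i l = N i powr (p i - 1) * \<bar>u i l\<bar> powr p i" if l: "l < n i" for l
    proof -
      have u0: "0 \<le> u i l" using nonneg_entriesD[OF un i l] .
      have "grad u i l = (grad u i l powr (conj_exp (p i) - 1)) powr (p i - 1)"
        using p1 grad_nonneg[OF un] by (simp add: powr_powr conj_exp_minus_1)
      also have "\<dots> = N i powr (p i - 1) * u i l powr (p i - 1)"
        unfolding R_eq_powr[OF un i l, symmetric] Ru[OF i l] by (rule powr_mult)
      finally show ?thesis using u0 p1 powr_mult_base[OF u0, of "p i - 1"] by (simp add: mult_ac)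
    qed
    then have "(\<Sum>l<n i. grad u i l * u i l) = N i powr (p i - 1) * (\<Sum>l<n i. \<bar>u i l\<bar> powr p i)"
      by (simp add: sum_distrib_left)
    also have "(\<Sum>l<n i. \<bar>u i l\<bar> powr p i) = 1"
      using pnorm_powr[of "p i" "n i" "u i"] us[OF i] p1 by simp
    finally show ?thesis using euler_identity[OF i, of u] by simp
  qed
  note * = this
  have "N i = ?\<tau> powr (conj_exp (p i) - 1)" if i: "i < d" for i
    unfolding *[OF i, symmetric] using N[OF i] p_greater_1[OF i] by (simp add: powr_powr conj_exp_minus_1)
  moreover have "0 \<le> ?\<tau>" using *[of 0] d_ge_1 powr_ge_zero[of "N 0" "p 0 - 1"] by simp
  ultimately show ?thesis by blast
qed

lemma abs_R_le:
  assumes "i < d" "j < n i" shows "\<bar>R x i j\<bar> \<le> R (\<lambda>i j. \<bar>x i j\<bar>) i j"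
proof -
  have an: "nonneg_entries d n (\<lambda>i j. \<bar>x i j\<bar>)" unfolding nonneg_entries_def by simp
  have "\<bar>grad x i j\<bar> \<le> grad (\<lambda>i j. \<bar>x i j\<bar>) i j"
    unfolding grad_eq
  proof (rule order_trans[OF sum_abs], rule sum_mono)
    fix J assume "J \<in> {J \<in> multi_indices d \<nu> n. J (offset \<nu> i) = j}"
    then show "\<bar>t J * (\<Prod>r\<in>{..<m} - {offset \<nu> i}. x (block_of \<nu> r) (J r))\<bar>
        \<le> t J * (\<Prod>r\<in>{..<m} - {offset \<nu> i}. \<bar>x (block_of \<nu> r) (J r)\<bar>)"
      using t_nonneg by (auto simp: abs_mult abs_prod)
  qed
  then have "\<bar>grad x i j\<bar> powr (conj_exp (p i) - 1) \<le> grad (\<lambda>i j. \<bar>x i j\<bar>) i j powr (conj_exp (p i) - 1)"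
    using conj_pos[OF assms(1)] by (intro powr_mono2) auto
  moreover have "\<bar>R x i j\<bar> = \<bar>grad x i j\<bar> powr (conj_exp (p i) - 1)"
    unfolding R_eq_psi[OF assms] psi_def by (simp add: abs_mult abs_sgn_eq)
  ultimately show ?thesis using R_eq_powr[OF an assms] by simp
qed

section \<open>The Jacobian and the dependency graph\<close>

text \<open>
  Without an edge the variable \<open>x_(k,l)\<close> does not occur in \<open>R_(i,j)\<close>, so its partial derivative vanishes.
\<close>

lemma partial_deriv_nonzero_imp_edge:
  assumes ij: "i < d" "j < n i" and nz: "partial_deriv R (i, j) (k, l) x \<noteq> 0"
  shows "((i, j), (k, l)) \<in> edges"
proof (rule ccontr)
  assume "((i, j), (k, l)) \<notin> edges"
  then have no: "\<not> (block_of \<nu> q = k \<and> J q = l)"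
    if "J \<in> multi_indices d \<nu> n" "J (offset \<nu> i) = j" "t J \<noteq> 0" "q < m" "q \<noteq> offset \<nu> i" for J q
    using that ij t_nonneg[OF that(1)] unfolding edges_def by force
  have "grad (x(k := (x k)(l := h))) i j = grad x i j" for h
    unfolding grad_eq
  proof (intro sum.cong refl)
    fix J assume J: "J \<in> {J \<in> multi_indices d \<nu> n. J (offset \<nu> i) = j}"
    show "t J * (\<Prod>r\<in>{..<m} - {offset \<nu> i}. (x(k := (x k)(l := h))) (block_of \<nu> r) (J r))
        = t J * (\<Prod>r\<in>{..<m} - {offset \<nu> i}. x (block_of \<nu> r) (J r))"
    proof (cases "t J = 0")
      case False
      have "(\<Prod>r\<in>{..<m} - {offset \<nu> i}. (x(k := (x k)(l := h))) (block_of \<nu> r) (J r))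
        = (\<Prod>r\<in>{..<m} - {offset \<nu> i}. x (block_of \<nu> r) (J r))"
      proof (intro prod.cong refl)
        fix r assume "r \<in> {..<m} - {offset \<nu> i}"
        then have "\<not> (block_of \<nu> r = k \<and> J r = l)" using no[of J r] J False by auto
        then show "(x(k := (x k)(l := h))) (block_of \<nu> r) (J r) = x (block_of \<nu> r) (J r)" by auto
      qed
      then show ?thesis by simp
    qed simp
  qed
  then have "(\<lambda>h. R (x(k := (x k)(l := h))) i j) = (\<lambda>h. R x i j)" using R_eq_psi[OF ij] by simp
  then have "partial_deriv R (i, j) (k, l) x = 0" unfolding partial_deriv_def by simp
  with nz show False by simp
qed

end

lemma set_coords: "set (coords d n) = coord_set d n"
  unfolding coords_def coord_set_def by auto

lemma nonzero_pow_mat_imp_relpow: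
  fixes M :: "real mat"
  assumes M: "M \<in> carrier_mat N N"
  shows "a < N \<Longrightarrow> c < N \<Longrightarrow> (M ^\<^sub>m k) $$ (a, c) \<noteq> 0 \<Longrightarrow> (a, c) \<in> {(a, c). a < N \<and> c < N \<and> M $$ (a, c) \<noteq> 0} ^^ k"
proof (induction k arbitrary: c)
  case 0
  then show ?case using M by (auto split: if_splits)
next
  case (Suc k)
  have Mk: "M ^\<^sub>m k \<in> carrier_mat N N" using M by simp
  have "(M ^\<^sub>m Suc k) $$ (a, c) = (\<Sum>e<N. (M ^\<^sub>m k) $$ (a, e) * M $$ (e, c))"
    using M Mk Suc.prems by (simp add: scalar_prod_def lessThan_atLeast0)
  then obtain e where e: "e < N" "(M ^\<^sub>m k) $$ (a, e) * M $$ (e, c) \<noteq> 0"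
    using Suc.prems(3) by (metis (no_types, lifting) lessThan_iff sum.neutral)
  then have "(a, e) \<in> {(a, c). a < N \<and> c < N \<and> M $$ (a, c) \<noteq> 0} ^^ k" using Suc by auto
  moreover have "(e, c) \<in> {(a, c). a < N \<and> c < N \<and> M $$ (a, c) \<noteq> 0}" using e Suc.prems by auto
  ultimately show ?case by auto
qed

lemma relpow_map:
  assumes "(a, c) \<in> S ^^ k" and "\<And>a c. (a, c) \<in> S \<Longrightarrow> (f a, f c) \<in> E"
  shows "(f a, f c) \<in> E ^^ k"
  using assms(1)
proof (induction k arbitrary: c)
  case (Suc k)
  then show ?case using assms(2) by (auto simp: relcomp_unfold)
qed auto

context nonneg_tensor
begin

abbreviation "DR \<equiv> jacobian_matrix d n R (ones d n)"

lemma jacobian_entry_nonzero_imp_edge: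
  assumes "a < length (coords d n)" "c < length (coords d n)" "DR $$ (a, c) \<noteq> 0"
  shows "(coords d n ! a, coords d n ! c) \<in> edges"
proof -
  obtain i j where ij: "coords d n ! a = (i, j)" by (cases "coords d n ! a") auto
  obtain k l where kl: "coords d n ! c = (k, l)" by (cases "coords d n ! c") auto
  have "(i, j) \<in> coord_set d n" using nth_mem[OF assms(1)] ij set_coords by metis
  then have "i < d" "j < n i" by (auto simp: in_coord_set)
  moreover have "partial_deriv R (i, j) (k, l) (ones d n) \<noteq> 0"
    using assms ij kl unfolding jacobian_matrix_def by simp
  ultimately show ?thesis unfolding ij kl by (rule partial_deriv_nonzero_imp_edge)
qed

lemma jacobian_power_path:
  fixes M :: "real mat"
  assumes "\<And>a b. a < length (coords d n) \<Longrightarrow> b < length (coords d n) \<Longrightarrow> (M ^\<^sub>m k) $$ (a, b) \<noteq> 0"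
    and M: "M \<in> carrier_mat (length (coords d n)) (length (coords d n))"
    and sub: "\<And>a b. a < length (coords d n) \<Longrightarrow> b < length (coords d n) \<Longrightarrow> M $$ (a, b) \<noteq> 0
      \<Longrightarrow> (coords d n ! a, coords d n ! b) \<in> E"
    and c: "c \<in> coord_set d n" "c' \<in> coord_set d n"
  shows "(c, c') \<in> E ^^ k"
proof -
  obtain a e where ae: "a < length (coords d n)" "coords d n ! a = c" "e < length (coords d n)" "coords d n ! e = c'"
    using c unfolding set_coords[symmetric] in_set_conv_nth by auto
  have "(coords d n ! a, coords d n ! e) \<in> E ^^ k"
    by (rule relpow_map[OF nonzero_pow_mat_imp_relpow[OF M ae(1,3) assms(1)[OF ae(1,3)]]]) (use sub in auto)
  then show ?thesis using ae by simp
qed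

lemma DR_carrier: "DR \<in> carrier_mat (length (coords d n)) (length (coords d n))"
  unfolding jacobian_matrix_def by simp

text \<open>
  Entries of \<open>I + DR\<close> that do not vanish are edges or loops, so powers of this matrix describe walks that may pause.
\<close>

lemma irreducible_imp_connected:
  assumes irr: "irreducible_matrix DR" and c: "c \<in> coord_set d n" "c' \<in> coord_set d n"
  shows "(c, c') \<in> edges\<^sup>*"
proof -
  let ?N = "length (coords d n)"
  let ?M = "1\<^sub>m ?N + DR"
  have dim: "dim_row DR = ?N" using DR_carrier by simp
  have M: "?M \<in> carrier_mat ?N ?N" using DR_carrier by simp
  have "(c, c') \<in> (edges\<^sup>=) ^^ (?N - 1)"
  proof (rule jacobian_power_path[OF _ M _ c])
    show "(?M ^\<^sub>m (?N - 1)) $$ (a, e) \<noteq> 0" if "a < ?N" "e < ?N" for a e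
    proof -
      have "?M ^\<^sub>m (?N - 1) \<in> carrier_mat ?N ?N" using M by simp
      then have "0 < (?M ^\<^sub>m (?N - 1)) $$ (a, e)"
        using irr that carrier_matD[OF DR_carrier] carrier_matD[OF M]
        unfolding irreducible_matrix_def pos_mat_def dim by (auto split: if_splits)
      then show ?thesis by simp
    qed
    show "(coords d n ! a, coords d n ! e) \<in> edges\<^sup>=" if ae: "a < ?N" "e < ?N" "?M $$ (a, e) \<noteq> 0" for a e
    proof (cases "a = e")
      case False
      then have "DR $$ (a, e) \<noteq> 0" using ae DR_carrier by auto
      then show ?thesis using jacobian_entry_nonzero_imp_edge ae by blast
    qed simp
  qed
  then have "(c, c') \<in> (edges\<^sup>=)\<^sup>*" by (rule relpow_imp_rtrancl)
  then show ?thesis by simp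
qed

lemma primitive_imp_relpow:
  assumes "primitive_matrix DR"
  shows "\<exists>K. \<forall>c\<in>coord_set d n. \<forall>c'\<in>coord_set d n. (c, c') \<in> edges ^^ K"
proof -
  obtain K where K: "pos_mat (DR ^\<^sub>m K)" using assms unfolding primitive_matrix_def by blast
  have "(c, c') \<in> edges ^^ K" if c: "c \<in> coord_set d n" "c' \<in> coord_set d n" for c c'
  proof (rule jacobian_power_path[OF _ DR_carrier _ c])
    show "(DR ^\<^sub>m K) $$ (a, e) \<noteq> 0" if "a < length (coords d n)" "e < length (coords d n)" for a e
    proof -
      have "DR ^\<^sub>m K \<in> carrier_mat (length (coords d n)) (length (coords d n))"
        using DR_carrier by (rule pow_carrier_mat)
      then have "0 < (DR ^\<^sub>m K) $$ (a, e)" using K that carrier_matD[OF DR_carrier] unfolding pos_mat_def by (auto split: if_splits)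
      then show ?thesis by simp
    qed
  qed (rule jacobian_entry_nonzero_imp_edge)
  then show ?thesis by blast
qed

end

section \<open>Spectral radius and weight vector of the homogeneity matrix\<close>

lemma transpose_mult_vec_index:
  assumes "A \<in> carrier_mat d d" "b \<in> carrier_vec d" "k < d"
  shows "(transpose_mat A *\<^sub>v b) $ k = (\<Sum>i<d. b $ i * (A $$ (i, k) :: real))"
  using assms by (simp add: scalar_prod_def lessThan_atLeast0 mult.commute)

text \<open>
  Summing \<open>\<bar>z\<bar> \<bar>v_i\<bar> \<le> \<Sum>k. A_ik \<bar>v_k\<bar>\<close> with the weights \<open>b_i\<close> bounds every complex eigenvalue \<open>z\<close> by \<open>\<kappa>\<close>; the right
  eigenvector shows that \<open>\<kappa>\<close> itself is an eigenvalue.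
\<close>

lemma spectral_radius_positive_left_eigenvector:
  fixes A :: "real mat"
  assumes A: "A \<in> carrier_mat d d" and d: "0 < d" and A0: "\<And>i k. i < d \<Longrightarrow> k < d \<Longrightarrow> 0 \<le> A $$ (i, k)"
    and b: "\<And>i. i < d \<Longrightarrow> 0 < b i" and left: "\<And>k. k < d \<Longrightarrow> (\<Sum>i<d. b i * A $$ (i, k)) = \<kappa> * b k"
    and w: "w \<in> carrier_vec d" "w \<noteq> 0\<^sub>v d" and right: "A *\<^sub>v w = \<kappa> \<cdot>\<^sub>v w" and \<kappa>: "0 \<le> \<kappa>"
  shows "spectral_radius (map_mat complex_of_real A) = \<kappa>"
proof -
  let ?A = "map_mat complex_of_real A"
  let ?w = "map_vec complex_of_real w"
  have cA: "?A \<in> carrier_mat d d" using A by simp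
  have "eigenvector ?A ?w (complex_of_real \<kappa>)"
    unfolding eigenvector_def
  proof (intro conjI)
    show "?w \<in> carrier_vec (dim_row ?A)" using w A by simp
    show "?w \<noteq> 0\<^sub>v (dim_row ?A)"
    proof
      assume z: "?w = 0\<^sub>v (dim_row ?A)"
      have "w = 0\<^sub>v d"
      proof (rule eq_vecI)
        fix i assume i: "i < dim_vec (0\<^sub>v d :: real vec)"
        then have "complex_of_real (w $ i) = 0" using arg_cong[OF z, of "\<lambda>v. v $ i"] w A by simp
        then show "w $ i = 0\<^sub>v d $ i" using i by simp
      qed (use w in simp)
      with w show False by simp
    qed
    have "?A *\<^sub>v ?w = map_vec complex_of_real (A *\<^sub>v w)" using of_real_hom.mult_mat_vec_hom[OF A w(1)] by metis
    also have "\<dots> = complex_of_real \<kappa> \<cdot>\<^sub>v ?w" unfolding right using w by (intro eq_vecI) auto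
    finally show "?A *\<^sub>v ?w = complex_of_real \<kappa> \<cdot>\<^sub>v ?w" .
  qed
  then have "complex_of_real \<kappa> \<in> spectrum ?A" unfolding spectrum_def eigenvalue_def by auto
  then have "norm (complex_of_real \<kappa>) \<in> norm ` spectrum ?A" by (rule imageI)
  then have "norm (complex_of_real \<kappa>) \<le> spectral_radius ?A"
    by (rule spectral_radius_mem_max(2)[OF cA d])
  then have "\<kappa> \<le> spectral_radius ?A" using \<kappa> by simp
  moreover have "spectral_radius ?A \<le> \<kappa>"
  proof -
    obtain ev where ev: "ev \<in> spectrum ?A" "spectral_radius ?A = norm ev"
      using spectral_radius_mem_max(1)[OF cA d] by auto
    then obtain v where v: "v \<in> carrier_vec d" "v \<noteq> 0\<^sub>v d" "?A *\<^sub>v v = ev \<cdot>\<^sub>v v"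
      unfolding spectrum_def eigenvalue_def eigenvector_def using A by auto
    have row: "norm ev * norm (v $ i) \<le> (\<Sum>k<d. A $$ (i, k) * norm (v $ k))" if i: "i < d" for i
    proof -
      have "ev * v $ i = (\<Sum>k<d. ?A $$ (i, k) * v $ k)"
        using arg_cong[OF v(3), of "\<lambda>v. v $ i"] v(1) A i by (simp add: scalar_prod_def lessThan_atLeast0)
      then have "norm ev * norm (v $ i) = norm (\<Sum>k<d. ?A $$ (i, k) * v $ k)" by (simp flip: norm_mult)
      also have "\<dots> \<le> (\<Sum>k<d. norm (?A $$ (i, k) * v $ k))" by (rule norm_sum)
      also have "\<dots> = (\<Sum>k<d. A $$ (i, k) * norm (v $ k))"
        using A A0 i by (intro sum.cong refl) (simp add: norm_mult)
      finally show ?thesis .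
    qed
    have "norm ev * (\<Sum>i<d. b i * norm (v $ i)) = (\<Sum>i<d. b i * (norm ev * norm (v $ i)))"
      by (simp add: sum_distrib_left mult_ac)
    also have "\<dots> \<le> (\<Sum>i<d. b i * (\<Sum>k<d. A $$ (i, k) * norm (v $ k)))"
      using row b by (intro sum_mono mult_left_mono) (auto simp: less_imp_le)
    also have "\<dots> = (\<Sum>k<d. (\<Sum>i<d. b i * A $$ (i, k)) * norm (v $ k))"
      unfolding sum_distrib_left sum_distrib_right by (subst sum.swap) (simp add: mult_ac)
    also have "\<dots> = \<kappa> * (\<Sum>i<d. b i * norm (v $ i))" using left by (simp add: sum_distrib_left mult_ac)
    finally have le: "norm ev * (\<Sum>i<d. b i * norm (v $ i)) \<le> \<kappa> * (\<Sum>i<d. b i * norm (v $ i))" .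
    have "\<exists>i<d. v $ i \<noteq> 0"
    proof (rule ccontr)
      assume "\<not> (\<exists>i<d. v $ i \<noteq> 0)"
      then have "v = 0\<^sub>v d" using v(1) by (intro eq_vecI) auto
      with v(2) show False by simp
    qed
    then obtain i where i: "i < d" "v $ i \<noteq> 0" by blast
    have "0 < (\<Sum>i<d. b i * norm (v $ i))"
      using i b by (intro sum_pos2[of _ i]) (auto simp: less_imp_le)
    then show ?thesis using le ev(2) by simp
  qed
  ultimately show ?thesis by simp
qed

context nonneg_tensor
begin

abbreviation "A \<equiv> homogeneity_matrix d \<nu> p"

lemma A_carrier: "A \<in> carrier_mat d d" unfolding homogeneity_matrix_def by simp

lemma A_index: "i < d \<Longrightarrow> k < d \<Longrightarrow> A $$ (i, k) = expo i k"
  unfolding homogeneity_matrix_def expo_def by simp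

lemma expo_nonneg: "i < d \<Longrightarrow> k < d \<Longrightarrow> 0 \<le> expo i k"
  unfolding expo_def using conj_pos[of i] \<nu>_ge_1[of k] by (intro mult_nonneg_nonneg) auto

lemma weight_vector_iff:
  "weight_vector d A \<rho> b \<longleftrightarrow> b \<in> carrier_vec d \<and> (\<forall>i<d. 0 < b $ i) \<and>
    (\<forall>k<d. (\<Sum>i<d. b $ i * expo i k) = \<rho> * b $ k) \<and> (\<Sum>i<d. b $ i) = 1"
proof (cases "b \<in> carrier_vec d")
  case True
  have idx: "(transpose_mat A *\<^sub>v b) $ k = (\<Sum>i<d. b $ i * expo i k)" if "k < d" for k
    using transpose_mult_vec_index[OF A_carrier True that] A_index that by simp
  have "transpose_mat A *\<^sub>v b = \<rho> \<cdot>\<^sub>v b \<longleftrightarrow> (\<forall>k<d. (\<Sum>i<d. b $ i * expo i k) = \<rho> * b $ k)"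
  proof
    assume eq: "transpose_mat A *\<^sub>v b = \<rho> \<cdot>\<^sub>v b"
    then have "(transpose_mat A *\<^sub>v b) $ k = (\<rho> \<cdot>\<^sub>v b) $ k" for k by simp
    then show "\<forall>k<d. (\<Sum>i<d. b $ i * expo i k) = \<rho> * b $ k"
      using True by (auto simp: idx[symmetric] simp del: index_mult_mat_vec)
  next
    assume "\<forall>k<d. (\<Sum>i<d. b $ i * expo i k) = \<rho> * b $ k"
    then show "transpose_mat A *\<^sub>v b = \<rho> \<cdot>\<^sub>v b"
      using True A_carrier by (intro eq_vecI) (auto simp: idx simp del: index_mult_mat_vec)
  qed
  then show ?thesis unfolding weight_vector_def by simp
qed (simp add: weight_vector_def)

text \<open>
  \<open>A\<close> is a rank-one matrix minus a diagonal one, so \<open>A\<^sup>T b\<close> depends on \<open>b\<close> only through a single sum and the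
  own entry.
\<close>

lemma left_mult_eq:
  assumes "k < d"
  shows "(\<Sum>i<d. b i * expo i k) = real (\<nu> k) * (\<Sum>i<d. b i * (conj_exp (p i) - 1)) - b k * (conj_exp (p k) - 1)"
proof -
  have "(\<Sum>i<d. b i * expo i k) = (\<Sum>i<d. real (\<nu> k) * (b i * (conj_exp (p i) - 1))
      - (if i = k then b k * (conj_exp (p k) - 1) else 0))"
    unfolding expo_def by (intro sum.cong) (auto simp: algebra_simps)
  then show ?thesis using assms by (simp add: sum_subtractf sum_distrib_left)
qed

text \<open>
  At \<open>\<rho> = 0\<close> the sum is the order of the tensor, which is at least \<open>2\<close>; it falls to at most \<open>1\<close> at
  \<open>\<rho> = \<Sum>k. \<nu>_k D_k\<close>. The intermediate value theorem gives a root, and it is positive.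
\<close>

lemma characteristic_root:
  "\<exists>\<rho>>0. (\<Sum>k<d. real (\<nu> k) * ((conj_exp (p k) - 1) / (\<rho> + (conj_exp (p k) - 1)))) = 1"
proof -
  define D where "D = (\<lambda>k. conj_exp (p k) - 1)"
  define f where "f = (\<lambda>\<rho>. \<Sum>k<d. real (\<nu> k) * (D k / (\<rho> + D k)))"
  define M where "M = (\<Sum>k<d. real (\<nu> k) * D k)"
  have D: "0 < D k" if "k < d" for k unfolding D_def using conj_pos that by simp
  have nu: "real (\<nu> k) > 0" if "k < d" for k using \<nu>_ge_1[OF that] by simp
  have M: "0 < M" unfolding M_def using D nu d_ge_1 by (intro sum_pos) (auto simp: lessThan_empty_iff)
  have "f 0 = (\<Sum>k<d. real (\<nu> k))" unfolding f_def
  proof (intro sum.cong refl)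
    show "real (\<nu> k) * (D k / (0 + D k)) = real (\<nu> k)" if "k \<in> {..<d}" for k using D[of k] that by simp
  qed
  then have f0: "2 \<le> f 0" using order_ge_2 by (simp flip: of_nat_sum)
  have "f M \<le> (\<Sum>k<d. real (\<nu> k) * (D k / M))"
    unfolding f_def using D nu M by (intro sum_mono mult_left_mono divide_left_mono) (auto simp: less_imp_le add_pos_pos)
  also have "\<dots> = 1" using M unfolding M_def by (simp flip: sum_divide_distrib)
  finally have fM: "f M \<le> 1" .
  have "\<rho> + D k \<noteq> 0" if "k < d" "0 \<le> \<rho>" for k \<rho> using D[OF that(1)] that(2) by linarith
  then have "continuous_on {0..M} f" unfolding f_def by (intro continuous_intros) auto
  then obtain \<rho> where \<rho>: "0 \<le> \<rho>" "f \<rho> = 1" using IVT2'[of f M 1 0] f0 fM M by auto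
  then have "\<rho> \<noteq> 0" using f0 by auto
  then show ?thesis using \<rho> unfolding f_def D_def by (intro exI[of _ \<rho>]) auto
qed

lemma spectral_radius_weight_vector:
  assumes \<rho>: "\<rho> = spectral_radius (map_mat complex_of_real A)"
  shows "0 < \<rho> \<and> (\<exists>b. weight_vector d A \<rho> b)"
proof -
  define D where "D = (\<lambda>k. conj_exp (p k) - 1)"
  have D: "0 < D k" if "k < d" for k unfolding D_def using conj_pos that by simp
  obtain \<kappa> where \<kappa>: "0 < \<kappa>" and root: "(\<Sum>k<d. real (\<nu> k) * (D k / (\<kappa> + D k))) = 1"
    using characteristic_root unfolding D_def by blast
  have nu: "real (\<nu> k) > 0" if "k < d" for k using \<nu>_ge_1[OF that] by simp
  define S where "S = (\<Sum>k<d. real (\<nu> k) / (\<kappa> + D k))"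
  have S: "0 < S" unfolding S_def using D nu d_ge_1 \<kappa>
    by (intro sum_pos divide_pos_pos add_pos_pos) (auto simp: lessThan_empty_iff)
  define c where "c = (\<lambda>k. real (\<nu> k) / (\<kappa> + D k) / S)"
  have c: "0 < c k" if "k < d" for k unfolding c_def using D nu S \<kappa> that by (intro divide_pos_pos add_pos_pos) auto
  have "(\<Sum>i<d. c i * D i) = (\<Sum>k<d. real (\<nu> k) * (D k / (\<kappa> + D k))) / S"
    unfolding c_def by (simp add: sum_divide_distrib)
  then have cD: "(\<Sum>i<d. c i * D i) = 1 / S" using root by simp
  have left: "(\<Sum>i<d. c i * expo i k) = \<kappa> * c k" if k: "k < d" for k
  proof -
    have "(\<Sum>i<d. c i * expo i k) = real (\<nu> k) * (1 / S) - c k * D k"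
      using left_mult_eq[OF k, of c] cD unfolding D_def by simp
    also have "real (\<nu> k) * (1 / S) = c k * (\<kappa> + D k)" unfolding c_def using D[OF k] \<kappa> by simp
    finally show ?thesis by (simp add: algebra_simps)
  qed
  have sum1: "(\<Sum>i<d. c i) = 1" unfolding c_def sum_divide_distrib[symmetric] S_def[symmetric] using S by simp
  define X where "X = (\<lambda>k. D k / (\<kappa> + D k))"
  have X: "0 < X k" "D k - D k * X k = \<kappa> * X k" if "k < d" for k
    unfolding X_def using D[OF that] \<kappa> by (auto simp: field_simps)
  have rootX: "(\<Sum>k<d. real (\<nu> k) * X k) = 1" using root unfolding X_def .
  have expoD: "expo i k = D i * (real (\<nu> k) - (if i = k then 1 else 0))" for i k
    unfolding expo_def D_def ..
  define w where "w = vec d X"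
  have "spectral_radius (map_mat complex_of_real A) = \<kappa>"
  proof (rule spectral_radius_positive_left_eigenvector[OF A_carrier])
    show "0 < d" using d_ge_1 by simp
    show "0 \<le> A $$ (i, k)" if "i < d" "k < d" for i k using A_index expo_nonneg that by simp
    show "(\<Sum>i<d. c i * A $$ (i, k)) = \<kappa> * c k" if "k < d" for k using left[OF that] A_index that by simp
    show "w \<in> carrier_vec d" unfolding w_def by simp
    have "w $ 0 \<noteq> 0" unfolding w_def using d_ge_1 X(1)[of 0] by simp
    then show "w \<noteq> 0\<^sub>v d" using d_ge_1 by auto
    show "A *\<^sub>v w = \<kappa> \<cdot>\<^sub>v w"
    proof (rule eq_vecI)
      fix i assume "i < dim_vec (\<kappa> \<cdot>\<^sub>v w)"
      then have i: "i < d" unfolding w_def by simp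
      have "(A *\<^sub>v w) $ i = (\<Sum>k<d. expo i k * X k)"
        using i A_carrier A_index unfolding w_def by (simp add: scalar_prod_def lessThan_atLeast0)
      also have "\<dots> = (\<Sum>k<d. D i * (real (\<nu> k) * X k) - (if k = i then D i * X i else 0))"
        unfolding expoD by (intro sum.cong) (auto simp: algebra_simps)
      also have "\<dots> = D i * (\<Sum>k<d. real (\<nu> k) * X k) - D i * X i"
        using i by (simp add: sum_subtractf sum_distrib_left)
      also have "\<dots> = \<kappa> * X i" using X(2)[OF i] rootX by simp
      finally show "(A *\<^sub>v w) $ i = (\<kappa> \<cdot>\<^sub>v w) $ i" using i unfolding w_def by simp
    qed (use A_carrier in \<open>simp add: w_def\<close>)
  qed (use c \<kappa> in auto)
  then have "\<rho> = \<kappa>" using \<rho> by simp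
  moreover have "weight_vector d A \<kappa> (vec d c)" unfolding weight_vector_iff using c left sum1 by simp
  ultimately show ?thesis using \<kappa> by blast
qed

text \<open>
  The eigenvector equations express each entry by the single number \<open>s = \<Sum>i. b_i D_i\<close>, and the normalisation
  determines \<open>s\<close>.
\<close>

lemma weight_vector_unique:
  assumes \<rho>: "0 < \<rho>" and b: "weight_vector d A \<rho> b" and b': "weight_vector d A \<rho> b'"
  shows "b = b'"
proof -
  define D where "D = (\<lambda>k. conj_exp (p k) - 1)"
  have D: "0 < D k" if "k < d" for k unfolding D_def using conj_pos that by simp
  define S where "S = (\<Sum>k<d. real (\<nu> k) / (\<rho> + D k))"
  have form: "b $ k = real (\<nu> k) / (\<rho> + D k) / S" if b: "weight_vector d A \<rho> b" and k: "k < d" for b k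
  proof -
    define s where "s = (\<Sum>i<d. b $ i * D i)"
    have e: "b $ k = s * (real (\<nu> k) / (\<rho> + D k))" if k: "k < d" for k
    proof -
      have "(\<Sum>i<d. b $ i * expo i k) = real (\<nu> k) * s - b $ k * D k"
        using left_mult_eq[OF k, of "\<lambda>i. b $ i"] unfolding s_def D_def .
      moreover have "(\<Sum>i<d. b $ i * expo i k) = \<rho> * b $ k" using b k unfolding weight_vector_iff by blast
      ultimately have "b $ k * (\<rho> + D k) = s * real (\<nu> k)" by (simp add: algebra_simps)
      then show ?thesis using D[OF k] \<rho> by (simp add: field_simps)
    qed
    have "1 = (\<Sum>k<d. b $ k)" using b unfolding weight_vector_iff by simp
    also have "\<dots> = (\<Sum>k<d. s * (real (\<nu> k) / (\<rho> + D k)))"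
      by (intro sum.cong refl) (rule e, simp)
    also have "\<dots> = s * S" unfolding S_def by (rule sum_distrib_left[symmetric])
    finally have sS: "s * S = 1" by (rule sym)
    then have "S \<noteq> 0" by auto
    then have s: "s = 1 / S" using sS by (simp add: eq_divide_eq)
    show ?thesis unfolding e[OF k] s by simp
  qed
  show ?thesis
  proof (rule eq_vecI)
    show "dim_vec b = dim_vec b'" using b b' unfolding weight_vector_iff by auto
    fix i assume "i < dim_vec b'"
    then have "i < d" using b' unfolding weight_vector_iff by auto
    then show "b $ i = b' $ i" using form[OF b, of i] form[OF b', of i] by simp
  qed
qed

section \<open>Irreducible tensors\<close>

text \<open>
  All iterates of \<open>z + R z\<close> started at an eigenvector \<open>v\<close> stay below blockwise multiples of \<open>v\<close>, so they vanish
  wherever \<open>v\<close> does.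
\<close>

lemma nonneg_eigenvector_positive:
  assumes v: "v \<in> sphere_nonneg d n p" and ev: "map_eigenvector d n p R v"
    and pos: "pos_entries d n (((\<lambda>z i j. z i j + R z i j) ^^ \<kappa>) v)"
  shows "v \<in> sphere_pos d n p"
proof -
  have vn: "nonneg_entries d n v" using v unfolding sphere_nonneg_def by simp
  obtain \<theta> where \<theta>: "eigenpair d n p R \<theta> v" using ev unfolding map_eigenvector_def by blast
  define N where "N = (\<lambda>i. sgn \<theta> * \<bar>\<theta>\<bar> powr (conj_exp (p i) - 1))"
  have N: "R v i j = N i * v i j" if "i < d" "j < n i" for i j
    using \<theta> that unfolding eigenpair_def N_def by blast
  let ?B = "\<lambda>z i j. z i j + R z i j"
  have dominated: "nonneg_entries d n ((?B ^^ k) v) \<and>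
      (\<exists>c. (\<forall>i<d. 0 < c i) \<and> (\<forall>i<d. \<forall>j<n i. (?B ^^ k) v i j \<le> c i * v i j))" for k
  proof (induction k)
    case 0
    show ?case using vn by (intro conjI exI[of _ "\<lambda>_. 1"]) auto
  next
    case (Suc k)
    let ?z = "(?B ^^ k) v"
    note zn = conjunct1[OF Suc]
    obtain c where c: "\<And>i. i < d \<Longrightarrow> 0 < c i" "\<And>i j. i < d \<Longrightarrow> j < n i \<Longrightarrow> ?z i j \<le> c i * v i j"
      using conjunct2[OF Suc] by blast
    let ?c = "\<lambda>i. c i + hom_factor d expo c i * \<bar>N i\<bar>"
    have hf: "0 < hom_factor d expo c i" for i using hom_factor_pos c(1) .
    have "?z i j + R ?z i j \<le> ?c i * v i j" if ij: "i < d" "j < n i" for i j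
    proof -
      have "R ?z i j \<le> R (\<lambda>i j. c i * v i j) i j" using c by (intro R_mono zn ij) auto
      also have "\<dots> = hom_factor d expo c i * (N i * v i j)" using R_hom[OF c(1) vn ij] N[OF ij] by simp
      also have "\<dots> \<le> hom_factor d expo c i * (\<bar>N i\<bar> * v i j)"
        using hf[of i] nonneg_entriesD[OF vn ij] by (intro mult_left_mono mult_right_mono) auto
      finally show ?thesis using c(2)[OF ij] by (simp add: algebra_simps)
    qed
    moreover have "0 < ?c i" if "i < d" for i using c(1)[OF that] hf[of i] by (intro add_pos_nonneg) auto
    moreover have "nonneg_entries d n (\<lambda>i j. ?z i j + R ?z i j)"
      using zn R_nonneg[OF zn] unfolding nonneg_entries_def by simp
    ultimately show ?case unfolding funpow.simps o_apply by (intro conjI exI[of _ ?c]) blast+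
  qed
  obtain c where "\<forall>i<d. \<forall>j<n i. (?B ^^ \<kappa>) v i j \<le> c i * v i j" using dominated[of \<kappa>] by blast
  then have c: "(?B ^^ \<kappa>) v i j \<le> c i * v i j" if "i < d" "j < n i" for i j using that by blast
  have "0 < v i j" if ij: "i < d" "j < n i" for i j
  proof -
    have "0 < c i * v i j" using c[OF ij] pos_entriesD[OF pos ij] by linarith
    then show ?thesis using nonneg_entriesD[OF vn ij] by (auto simp: zero_less_mult_iff)
  qed
  then show ?thesis using v unfolding sphere_pos_def sphere_nonneg_def pos_entries_def by auto
qed

end

section \<open>Roots of geometrically bounded sequences\<close>

text \<open>
  The constant is harmless because \<open>C powr (g / k)\<close> tends to \<open>1\<close>.
\<close>

lemma eventually_powr_root_less:
  fixes f :: "nat \<Rightarrow> real"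
  assumes C: "0 < C" and B: "0 < B" and g: "0 < g" and f: "\<And>k. 0 \<le> f k" "\<And>k. f k \<le> C * B ^ k"
    and L: "B powr g < L"
  shows "\<forall>\<^sub>F k in sequentially. f k powr (g / real k) < L"
proof -
  have "(\<lambda>k. g / real k) \<longlonglongrightarrow> 0" by (rule tendsto_divide_0[OF tendsto_const]) (simp add: filterlim_real_sequentially filterlim_at_top_imp_at_infinity)
  then have "(\<lambda>k. C powr (g / real k) * B powr g) \<longlonglongrightarrow> C powr 0 * B powr g"
    using C by (intro tendsto_mult tendsto_powr tendsto_const) auto
  then have "\<forall>\<^sub>F k in sequentially. C powr (g / real k) * B powr g < L"
    using L C by (intro order_tendstoD(2)) auto
  then show ?thesis using eventually_gt_at_top[of 0]
  proof eventually_elim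
    case (elim k)
    have "f k powr (g / real k) \<le> (C * B ^ k) powr (g / real k)"
      using f[of k] g by (intro powr_mono2) auto
    also have "\<dots> = C powr (g / real k) * B powr g"
      using B elim by (simp add: powr_mult powr_powr flip: powr_realpow)
    finally show ?case using elim by linarith
  qed
qed

lemma eventually_powr_root_greater:
  fixes f :: "nat \<Rightarrow> real"
  assumes C: "0 < C" and B: "0 < B" and g: "0 < g" and f: "\<And>k. B ^ k \<le> C * f k"
    and L: "L < B powr g"
  shows "\<forall>\<^sub>F k in sequentially. L < f k powr (g / real k)"
proof -
  have "(\<lambda>k. g / real k) \<longlonglongrightarrow> 0" by (rule tendsto_divide_0[OF tendsto_const]) (simp add: filterlim_real_sequentially filterlim_at_top_imp_at_infinity)
  then have "(\<lambda>k. (1 / C) powr (g / real k) * B powr g) \<longlonglongrightarrow> (1 / C) powr 0 * B powr g"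
    using C by (intro tendsto_mult tendsto_powr tendsto_const) auto
  then have "\<forall>\<^sub>F k in sequentially. L < (1 / C) powr (g / real k) * B powr g"
    using L C by (intro order_tendstoD(1)) auto
  then show ?thesis using eventually_gt_at_top[of 0]
  proof eventually_elim
    case (elim k)
    have "(1 / C) powr (g / real k) * B powr g = (1 / C * B ^ k) powr (g / real k)"
      using B elim by (simp only: powr_mult powr_powr flip: powr_realpow) simp
    also have "\<dots> \<le> f k powr (g / real k)"
      using f[of k] g C B by (intro powr_mono2) (auto simp: field_simps)
    finally show ?case using elim by linarith
  qed
qed

section \<open>The spectral radius of the tensor map\<close>

locale weighted_tensor = nonneg_tensor +
  fixes b :: "real Matrix.vec" and \<rho> :: real
  assumes b_weight: "weight_vector d (homogeneity_matrix d \<nu> p) \<rho> b" and \<rho>_pos: "0 < \<rho>"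
begin

sublocale multihom_graph d n p b R expo \<rho> edges
proof
  show "0 < d" using d_ge_1 by simp
  show "i < d \<Longrightarrow> 0 < n i" for i using n_ge_1[of i] by simp
  show "i < d \<Longrightarrow> 1 < p i" for i by (rule p_greater_1)
  show "i < d \<Longrightarrow> 0 < b $ i" for i using b_weight unfolding weight_vector_iff by simp
  show "R x \<in> block_space d n" for x unfolding block_space_def tensor_map_def by simp
  show "k < d \<Longrightarrow> (\<Sum>i<d. b $ i * expo i k) = \<rho> * b $ k" for k using b_weight unfolding weight_vector_iff by simp
  show "0 \<le> \<rho>" using \<rho>_pos by simp
qed (fact R_nonneg R_mono R_hom R_ones_pos R_cont edges_coords R_touch R_growth)+

text \<open>
  The mean of the block eigenvalues \<open>\<theta> powr (p_i' - 1)\<close> is \<open>\<theta> powr S\<close>, and \<open>\<gamma> - 1 = 1 / S\<close>; the exponent \<open>\<gamma> - 1\<close> thus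
  recovers \<open>\<theta>\<close> from the mean.
\<close>

definition "S = (\<Sum>i<d. b $ i * (conj_exp (p i) - 1))"
definition "r = map_spectral_radius d n p R"

lemma S_pos: "0 < S"
  unfolding S_def using b_pos conj_pos d_pos by (intro sum_pos mult_pos_pos) (auto simp: lessThan_empty_iff)

lemma S_eq: "(\<Sum>i<d. b $ i * conj_exp (p i)) - 1 = S"
proof -
  have "(\<Sum>i<d. b $ i) = 1" using b_weight unfolding weight_vector_iff by simp
  then show ?thesis unfolding S_def by (simp add: right_diff_distrib sum_subtractf)
qed

lemma gm_common_eigenvalue:
  assumes "0 \<le> \<theta>" shows "gm (\<lambda>i. \<theta> powr (conj_exp (p i) - 1)) = \<theta> powr S"
proof (cases "\<theta> = 0")
  case True
  then show ?thesis unfolding weighted_gm_def using d_pos by auto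
next
  case False
  then show ?thesis unfolding weighted_gm_def S_def by (simp add: powr_sum powr_powr mult.commute)
qed

lemma powr_S_inverse: "0 \<le> \<theta> \<Longrightarrow> (\<theta> powr S) powr (1 / S) = \<theta>"
  using S_pos by (simp add: powr_powr)

lemma le_if_powr_S_le:
  assumes "0 \<le> x" "0 \<le> y" "x powr S \<le> y powr S" shows "x \<le> y"
proof -
  have "(x powr S) powr (1 / S) \<le> (y powr S) powr (1 / S)"
    by (rule powr_mono2) (use S_pos assms in auto)
  then show ?thesis unfolding powr_S_inverse[OF assms(1)] powr_S_inverse[OF assms(2)] .
qed

lemma abs_in_sphere: "x \<in> sphere_set d n p \<Longrightarrow> (\<lambda>i j. \<bar>x i j\<bar>) \<in> sphere_nonneg d n p"
  unfolding sphere_nonneg_def sphere_set_def block_space_def nonneg_entries_def by simp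

text \<open>
  A real eigenvector may have entries of both signs; \<open>\<bar>x\<bar>\<close> is then a sub-eigenvector for \<open>\<bar>\<theta>\<bar>\<close>, to which the
  comparison applies.
\<close>

lemma eigenvalue_le_upper:
  assumes \<rho>: "\<rho> \<le> 1" and x: "eigenpair d n p R \<theta> x" and z: "z \<in> sphere_pos d n p"
    and M: "\<And>i j. i < d \<Longrightarrow> j < n i \<Longrightarrow> R z i j \<le> M i * z i j"
  shows "\<bar>\<theta>\<bar> powr S \<le> gm M"
proof -
  have "gm (\<lambda>i. \<bar>\<theta>\<bar> powr (conj_exp (p i) - 1)) \<le> gm M"
  proof (rule collatz_wielandt_compare[OF \<rho> abs_in_sphere z _ _ M])
    show "x \<in> sphere_set d n p" using x unfolding eigenpair_def by simp
    show "\<bar>\<theta>\<bar> powr (conj_exp (p i) - 1) * \<bar>x i j\<bar> \<le> R (\<lambda>i j. \<bar>x i j\<bar>) i j" if ij: "i < d" "j < n i" for i j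
    proof -
      have "R x i j = sgn \<theta> * \<bar>\<theta>\<bar> powr (conj_exp (p i) - 1) * x i j"
        using x ij unfolding eigenpair_def by blast
      then have "\<bar>R x i j\<bar> = \<bar>\<theta>\<bar> powr (conj_exp (p i) - 1) * \<bar>x i j\<bar>"
        by (cases "\<theta> = 0") (simp_all add: abs_mult abs_sgn_eq)
      then show ?thesis using abs_R_le[OF ij, of x] by simp
    qed
  qed auto
  then show ?thesis using gm_common_eigenvalue[of "\<bar>\<theta>\<bar>"] by simp
qed

lemma eigenpair_nonneg_eq:
  assumes "eigenpair d n p R \<theta> u" "0 \<le> \<theta>" "i < d" "j < n i"
  shows "R u i j = \<theta> powr (conj_exp (p i) - 1) * u i j"
  using assms unfolding eigenpair_def by (cases "\<theta> = 0") auto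

lemma eigenpairI:
  assumes "u \<in> sphere_nonneg d n p" "0 \<le> \<theta>"
    and "\<And>i j. i < d \<Longrightarrow> j < n i \<Longrightarrow> R u i j = \<theta> powr (conj_exp (p i) - 1) * u i j"
  shows "eigenpair d n p R \<theta> u"
  using assms unfolding eigenpair_def sphere_nonneg_def by (cases "\<theta> = 0") auto

lemma eigenpair_if_fixed_point:
  assumes u: "u \<in> sphere_pos d n p" and "G u = u"
  shows "\<exists>\<theta>>0. eigenpair d n p R \<theta> u"
proof -
  let ?N = "\<lambda>i. pnorm (n i) (p i) (R u i)"
  have eq: "R u i j = ?N i * u i j" if "i < d" "j < n i" for i j
    using fixed_point_imp_eigen[OF assms that] .
  obtain \<theta> where \<theta>: "0 \<le> \<theta>" "\<And>i. i < d \<Longrightarrow> ?N i = \<theta> powr (conj_exp (p i) - 1)"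
    using block_eigenvalues_from_one[OF sphere_pos_subset_nonneg[OF u] _ eq] by auto
  have "?N 0 > 0" using pnorm_block_pos[OF F_pos[OF sphere_posD(2)[OF u]] d_pos] .
  then have "\<theta> \<noteq> 0" using \<theta>(2)[OF d_pos] by auto
  then show ?thesis using \<theta> eq by (intro exI[of _ \<theta>] conjI eigenpairI sphere_pos_subset_nonneg u) auto
qed

text \<open>
  The eigenvalue \<open>\<theta>0\<close> of the limit eigenvector dominates all eigenvalues, because its mean is an infimum of upper
  bounds; so the supremum in the definition of \<open>r\<close> is the maximum \<open>\<theta>0\<close>. It is positive since the all-ones vector has
  a positive lower Collatz-Wielandt number.
\<close>

lemma spectral_radius_facts:
  assumes \<rho>: "\<rho> \<le> 1"
  shows "\<exists>u\<in>sphere_nonneg d n p. eigenpair d n p R r u"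
    and "eigenpair d n p R \<theta> x \<Longrightarrow> \<bar>\<theta>\<bar> \<le> r"
    and "0 < r"
    and "0 < \<delta> \<Longrightarrow> \<exists>z\<in>sphere_pos d n p. \<exists>M. (\<forall>i<d. \<forall>j<n i. R z i j \<le> M i * z i j) \<and> gm M < r powr S + \<delta>"
proof -
  obtain u N where u: "u \<in> sphere_nonneg d n p" "\<And>i. i < d \<Longrightarrow> 0 \<le> N i"
      "\<And>i j. i < d \<Longrightarrow> j < n i \<Longrightarrow> R u i j = N i * u i j"
    and approx: "\<And>\<delta>. 0 < \<delta> \<Longrightarrow> \<exists>z\<in>sphere_pos d n p. \<exists>M. (\<forall>i<d. \<forall>j<n i. R z i j \<le> M i * z i j) \<and> gm M < gm N + \<delta>"
    using collatz_wielandt_eigenvector[OF \<rho>] by blast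
  obtain \<theta>0 where \<theta>0: "0 \<le> \<theta>0" "\<And>i. i < d \<Longrightarrow> N i = \<theta>0 powr (conj_exp (p i) - 1)"
    using block_eigenvalues_from_one[OF u] by blast
  have gN: "gm N = \<theta>0 powr S"
    using gm_common_eigenvalue[OF \<theta>0(1)] weighted_gm_cong[of d N] \<theta>0(2) by auto
  have ep: "eigenpair d n p R \<theta>0 u" using u \<theta>0 by (intro eigenpairI) auto
  have le: "\<bar>\<theta>\<bar> \<le> \<theta>0" if "eigenpair d n p R \<theta> x" for \<theta> x
  proof -
    have "\<bar>\<theta>\<bar> powr S \<le> \<theta>0 powr S"
    proof (rule field_le_epsilon)
      fix \<delta> :: real assume "0 < \<delta>"
      then obtain z M where z: "z \<in> sphere_pos d n p" "\<forall>i<d. \<forall>j<n i. R z i j \<le> M i * z i j" "gm M < gm N + \<delta>"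
        using approx by blast
      have "\<bar>\<theta>\<bar> powr S \<le> gm M" using z(2) by (intro eigenvalue_le_upper[OF \<rho> that z(1)]) auto
      then show "\<bar>\<theta>\<bar> powr S \<le> \<theta>0 powr S + \<delta>" using z(3) gN by simp
    qed
    with \<theta>0(1) show ?thesis using le_if_powr_S_le[of "\<bar>\<theta>\<bar>" \<theta>0] by simp
  qed
  have r: "r = \<theta>0"
    unfolding r_def map_spectral_radius_def
  proof (rule cSup_eq_maximum)
    show "\<theta>0 \<in> {\<bar>\<theta>\<bar> |\<theta>. \<exists>x. eigenpair d n p R \<theta> x}" using ep \<theta>0(1) by (auto intro!: exI[of _ \<theta>0])
  qed (use le in auto)
  show "\<exists>u\<in>sphere_nonneg d n p. eigenpair d n p R r u" using ep u(1) r by blast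
  show "eigenpair d n p R \<theta> x \<Longrightarrow> \<bar>\<theta>\<bar> \<le> r" using le r by simp
  show "0 < \<delta> \<Longrightarrow> \<exists>z\<in>sphere_pos d n p. \<exists>M. (\<forall>i<d. \<forall>j<n i. R z i j \<le> M i * z i j) \<and> gm M < r powr S + \<delta>"
    using approx gN r by simp
  show "0 < r"
  proof -
    let ?y = "nrm (ones d n)"
    note ys = sphere_pos_nonempty
    have l: "0 < gm (low_ratio ?y)" using low_ratio_pos[OF sphere_posD(2)[OF ys]] by (intro weighted_gm_pos) auto
    obtain z M where z: "z \<in> sphere_pos d n p" "\<forall>i<d. \<forall>j<n i. R z i j \<le> M i * z i j" "gm M < gm N + gm (low_ratio ?y)"
      using approx[OF l] by blast
    have "gm (low_ratio ?y) \<le> gm M"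
    proof (rule collatz_wielandt_compare[OF \<rho> sphere_pos_subset_nonneg[OF ys] z(1)])
      show "0 \<le> low_ratio ?y i" if "i < d" for i using low_ratio_pos[OF sphere_posD(2)[OF ys] that] by simp
      show "low_ratio ?y i * ?y i j \<le> R ?y i j" if "i < d" "j < n i" for i j
        using low_ratio_le[of j i ?y] that pos_entriesD[OF sphere_posD(2)[OF ys] that] by (simp add: le_divide_eq)
    qed (use z in auto)
    then have "gm N \<noteq> 0" using z(3) by auto
    then have "\<theta>0 \<noteq> 0" using gN by auto
    then show ?thesis using \<theta>0(1) r by simp
  qed
qed

lemma spectral_radius_le_upper:
  assumes "\<rho> \<le> 1" "z \<in> sphere_pos d n p" "\<And>i j. i < d \<Longrightarrow> j < n i \<Longrightarrow> R z i j \<le> M i * z i j"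
  shows "r powr S \<le> gm M"
proof -
  obtain u where "eigenpair d n p R r u" using spectral_radius_facts(1)[OF assms(1)] by blast
  from eigenvalue_le_upper[OF assms(1) this assms(2,3)] show ?thesis
    using spectral_radius_facts(3)[OF assms(1)] by simp
qed

lemma lower_le_spectral_radius:
  assumes \<rho>: "\<rho> \<le> 1" and y: "y \<in> sphere_nonneg d n p" and m0: "\<And>i. i < d \<Longrightarrow> 0 \<le> N i"
    and N: "\<And>i j. i < d \<Longrightarrow> j < n i \<Longrightarrow> N i * y i j \<le> R y i j"
  shows "gm N \<le> r powr S"
proof (rule field_le_epsilon)
  fix \<delta> :: real assume "0 < \<delta>"
  then obtain z M where z: "z \<in> sphere_pos d n p" "\<forall>i<d. \<forall>j<n i. R z i j \<le> M i * z i j" "gm M < r powr S + \<delta>"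
    using spectral_radius_facts(4)[OF \<rho>] by blast
  have "gm N \<le> gm M" using z(2) by (intro collatz_wielandt_compare[OF \<rho> y z(1) m0 N]) auto
  then show "gm N \<le> r powr S + \<delta>" using z(3) by simp
qed

lemma approximate_upper:
  assumes \<rho>: "\<rho> \<le> 1" and \<epsilon>: "0 < \<epsilon>"
  shows "\<exists>z\<in>sphere_pos d n p. \<exists>M. (\<forall>i<d. \<forall>j<n i. R z i j \<le> M i * z i j) \<and> 0 < gm M \<and> gm M powr (1 / S) < r + \<epsilon>"
proof -
  note r0 = spectral_radius_facts(3)[OF \<rho>]
  have "r powr S < (r + \<epsilon>) powr S" using r0 \<epsilon> S_pos by (intro powr_less_mono2) auto
  then obtain z M where z: "z \<in> sphere_pos d n p" "\<forall>i<d. \<forall>j<n i. R z i j \<le> M i * z i j"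
      "gm M < r powr S + ((r + \<epsilon>) powr S - r powr S)"
    using spectral_radius_facts(4)[OF \<rho>, of "(r + \<epsilon>) powr S - r powr S"] by auto
  have "0 < gm M" using upper_bound_pos[OF sphere_posD(2)[OF z(1)], of M] z(2) by (intro weighted_gm_pos) auto
  moreover have "gm M powr (1 / S) < ((r + \<epsilon>) powr S) powr (1 / S)"
    using z(3) S_pos by (intro powr_less_mono2) auto
  moreover have "((r + \<epsilon>) powr S) powr (1 / S) = r + \<epsilon>" using r0 \<epsilon> by (intro powr_S_inverse) simp
  ultimately have "0 < gm M \<and> gm M powr (1 / S) < r + \<epsilon>" by simp
  then show ?thesis using z(1,2) by blast
qed

text \<open>
  A positive eigenvector is its own upper bound, so its eigenvalue is at least \<open>r\<close>.
\<close>

lemma positive_eigenvector: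
  assumes \<rho>: "\<rho> \<le> 1" and v: "v \<in> sphere_pos d n p" and ev: "eigenpair d n p R \<theta> v"
  shows "\<theta> = r" "G v = v"
proof -
  have eq: "R v i j = sgn \<theta> * \<bar>\<theta>\<bar> powr (conj_exp (p i) - 1) * v i j" if "i < d" "j < n i" for i j
    using ev that unfolding eigenpair_def by blast
  note vp = sphere_posD(2)[OF v]
  have "0 < R v 0 0" using pos_entriesD[OF F_pos[OF vp] d_pos n_pos[OF d_pos]] .
  then have th: "0 < \<theta>" using eq[OF d_pos n_pos[OF d_pos]] pos_entriesD[OF vp d_pos n_pos[OF d_pos]]
    by (cases "\<theta> > 0") (auto simp: sgn_if zero_less_mult_iff split: if_splits)
  have eq': "R v i j = \<theta> powr (conj_exp (p i) - 1) * v i j" if "i < d" "j < n i" for i j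
    using eq[OF that] th by simp
  have "r powr S \<le> gm (\<lambda>i. \<theta> powr (conj_exp (p i) - 1))"
    using eq' by (intro spectral_radius_le_upper[OF \<rho> v]) simp
  then have "r powr S \<le> \<theta> powr S" using gm_common_eigenvalue th by simp
  then have "r \<le> \<theta>" using th spectral_radius_facts(3)[OF \<rho>] le_if_powr_S_le[of r \<theta>] by simp
  moreover have "\<theta> \<le> r" using spectral_radius_facts(2)[OF \<rho> ev] by simp
  ultimately show "\<theta> = r" by simp
  show "G v = v" by (rule eigen_imp_fixed_point[OF v _ eq']) (use th in auto)
qed

lemma eigenpair_r_if_fixed_point:
  assumes "\<rho> \<le> 1" "u \<in> sphere_pos d n p" "G u = u"
  shows "eigenpair d n p R r u"
  using eigenpair_if_fixed_point[OF assms(2,3)] positive_eigenvector(1)[OF assms(1,2)] by metis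

lemma eigenvector_unique:
  assumes \<rho>: "\<rho> \<le> 1" and conn: "\<rho> = 1 \<Longrightarrow> strongly_connected"
    and u: "u \<in> sphere_pos d n p" "eigenpair d n p R r u"
    and w: "w \<in> sphere_nonneg d n p" "eigenpair d n p R r w"
  shows "w = u"
proof -
  have r0: "0 \<le> r" using spectral_radius_facts(3)[OF \<rho>] by simp
  show ?thesis
  proof (cases "\<rho> = 1")
    case True
    show ?thesis by (rule strongly_connected_unique_eigenvector[OF True conn[OF True] w(1) u(1)])
      (rule eigenpair_nonneg_eq[OF w(2) r0] eigenpair_nonneg_eq[OF u(2) r0]; assumption)+
  next
    case False
    then have "\<rho> < 1" using \<rho> by simp
    then show ?thesis by (rule subhomogeneous_unique_eigenvector[OF _ w(1) u(1)])
      (rule eigenpair_nonneg_eq[OF w(2) r0] eigenpair_nonneg_eq[OF u(2) r0]; assumption)+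
  qed
qed

lemma positive_eigenvector_exists:
  assumes "\<rho> \<le> 1" and conn: "\<rho> = 1 \<Longrightarrow> strongly_connected"
  shows "\<exists>u\<in>sphere_pos d n p. eigenpair d n p R r u"
proof (cases "\<rho> = 1")
  case True
  then show ?thesis using strongly_connected_positive_eigenvector[OF assms(1) conn] eigenpair_r_if_fixed_point[OF assms(1)] by blast
next
  case False
  then have \<rho>: "\<rho> < 1" using assms(1) by simp
  define x where "x = rec_nat (nrm (ones d n)) (\<lambda>_ y. G y)"
  have x: "x 0 \<in> sphere_pos d n p" "\<And>k. x (Suc k) = G (x k)" unfolding x_def using sphere_pos_nonempty by auto
  obtain u where "u \<in> sphere_pos d n p" "G u = u" using contraction_fixed_point[of x, OF \<rho> x] by blast
  then show ?thesis using eigenpair_r_if_fixed_point[OF assms(1)] by blast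
qed

lemma irreducible_strongly_connected: "irreducible_matrix DR \<Longrightarrow> strongly_connected"
  unfolding strongly_connected_def using irreducible_imp_connected by blast

section \<open>Growth rates of the iterates\<close>

text \<open>
  A positive vector \<open>z\<close> with an almost optimal upper bound dominates a multiple of \<open>x\<close>. The \<open>max 1\<close> keeps the
  multiple positive when a block of \<open>x\<close> vanishes.
\<close>

lemma growth_rate_less:
  assumes \<rho>: "\<rho> = 1" and x: "nonneg_entries d n x" and L: "r < L"
  shows "\<forall>\<^sub>F k in sequentially. np ((R ^^ k) x) powr ((1 / S) / real k) < L"
proof -
  obtain z M where z: "z \<in> sphere_pos d n p" "\<And>i j. i < d \<Longrightarrow> j < n i \<Longrightarrow> R z i j \<le> M i * z i j"
    "0 < gm M" "gm M powr (1 / S) < L"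
    using approximate_upper[of "L - r"] \<rho> L by auto
  note zp = sphere_posD(2)[OF z(1)]
  define c where "c = (\<lambda>i. max 1 (tr x z i))"
  have c0: "0 < c i" for i unfolding c_def by (simp add: less_max_iff_disj)
  have le: "x i j \<le> c i * z i j" if ij: "i < d" "j < n i" for i j
  proof -
    have "0 < z i j" using pos_entriesD[OF zp ij] .
    moreover have "tr x z i * z i j \<le> c i * z i j" unfolding c_def using \<open>0 < z i j\<close> by (intro mult_right_mono) auto
    ultimately show ?thesis using top_ratio_bound[of j n i z x, OF ij(2)] by linarith
  qed
  show ?thesis
  proof (rule eventually_powr_root_less[OF weighted_gm_pos z(3) _ _ _ z(4)])
    show "np ((R ^^ k) x) \<le> gm c * gm M ^ k" for k
      by (rule norm_product_funpow_upper[OF \<rho> x z(1) c0 le z(2)])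
    show "0 \<le> np ((R ^^ k) x)" for k unfolding norm_product_eq_gm by simp
  qed (use c0 S_pos in auto)
qed

lemma growth_rate_greater:
  assumes \<rho>: "\<rho> = 1" and y: "nonneg_entries d n y" and L: "L < r"
    and u: "u \<in> sphere_nonneg d n p" "eigenpair d n p R r u"
    and c: "\<And>i. i < d \<Longrightarrow> 0 < c i" and le: "\<And>i j. i < d \<Longrightarrow> j < n i \<Longrightarrow> u i j \<le> c i * y i j"
  shows "\<forall>\<^sub>F k in sequentially. L < np ((R ^^ k) y) powr ((1 / S) / real k)"
proof -
  have r0: "0 < r" using spectral_radius_facts(3) \<rho> by simp
  let ?M = "\<lambda>i. r powr (conj_exp (p i) - 1)"
  have gM: "gm ?M = r powr S" using r0 by (intro gm_common_eigenvalue) simp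
  show ?thesis
  proof (rule eventually_powr_root_greater[OF weighted_gm_pos _ _ _ ])
    show "gm ?M ^ k \<le> gm c * np ((R ^^ k) y)" for k
      by (rule norm_product_funpow_lower[OF \<rho> y u(1) c le])
        (use r0 eigenpair_nonneg_eq[OF u(2)] in auto)
    show "L < gm ?M powr (1 / S)" unfolding gM using powr_S_inverse r0 L by simp
    show "0 < gm ?M" unfolding gM using r0 by simp
  qed (use c S_pos in auto)
qed

lemma growth_rate_limit:
  assumes \<rho>: "\<rho> = 1" and y: "nonneg_entries d n y"
    and u: "u \<in> sphere_nonneg d n p" "eigenpair d n p R r u"
    and c: "\<And>i. i < d \<Longrightarrow> 0 < c i" and le: "\<And>i j. i < d \<Longrightarrow> j < n i \<Longrightarrow> u i j \<le> c i * y i j"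
  shows "(\<lambda>k. np ((R ^^ k) y) powr ((1 / S) / real k)) \<longlonglongrightarrow> r"
  by (rule order_tendstoI) (rule growth_rate_greater[OF \<rho> y _ u c le] growth_rate_less[OF \<rho> y]; assumption)+

lemma growth_rate_positive:
  assumes \<rho>: "\<rho> = 1" and y: "y \<in> sphere_pos d n p"
  shows "(\<lambda>k. np ((R ^^ k) y) powr ((1 / S) / real k)) \<longlonglongrightarrow> r"
proof -
  obtain u where u: "u \<in> sphere_nonneg d n p" "eigenpair d n p R r u"
    using spectral_radius_facts(1) \<rho> by auto
  note yp = sphere_posD(2)[OF y]
  show ?thesis
  proof (rule growth_rate_limit[OF \<rho> pos_imp_nonneg_entries[OF yp] u])
    show "0 < tr u y i" if "i < d" for i by (rule top_ratio_sphere_pos[OF u(1) yp that])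
    show "u i j \<le> tr u y i * y i j" if "i < d" "j < n i" for i j
      using top_ratio_bound[of j n i y u, OF that(2) pos_entriesD[OF yp that]] .
  qed
qed

lemma growth_rate_sup_limsup:
  assumes \<rho>: "\<rho> = 1"
  shows "ereal r = (SUP z\<in>cone_nonzero d n. limsup (\<lambda>k. ereal (np ((R ^^ k) z) powr ((1 / S) / real k))))"
proof (rule antisym)
  obtain u where u: "u \<in> sphere_nonneg d n p" "eigenpair d n p R r u"
    using spectral_radius_facts(1) \<rho> by auto
  have "(\<lambda>k. np ((R ^^ k) u) powr ((1 / S) / real k)) \<longlonglongrightarrow> r"
    by (rule growth_rate_limit[OF \<rho> sphere_nonnegD(2)[OF u(1)] u, of "\<lambda>_. 1"]) auto
  then have "limsup (\<lambda>k. ereal (np ((R ^^ k) u) powr ((1 / S) / real k))) = ereal r"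
    by (intro lim_imp_Limsup) auto
  then show "ereal r \<le> (SUP z\<in>cone_nonzero d n. limsup (\<lambda>k. ereal (np ((R ^^ k) z) powr ((1 / S) / real k))))"
    using sphere_nonneg_in_cone[OF u(1)] by (intro SUP_upper2[of u]) auto
  show "(SUP z\<in>cone_nonzero d n. limsup (\<lambda>k. ereal (np ((R ^^ k) z) powr ((1 / S) / real k)))) \<le> ereal r"
  proof (rule SUP_least, rule ereal_le_epsilon2)
    fix z and \<epsilon> :: real assume z: "z \<in> cone_nonzero d n" and \<epsilon>: "0 < \<epsilon>"
    have "\<forall>\<^sub>F k in sequentially. np ((R ^^ k) z) powr ((1 / S) / real k) < r + \<epsilon>"
      using z \<epsilon> by (intro growth_rate_less[OF \<rho>]) (auto simp: cone_nonzero_def)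
    then show "limsup (\<lambda>k. ereal (np ((R ^^ k) z) powr ((1 / S) / real k))) \<le> ereal r + ereal \<epsilon>"
      by (intro Limsup_bounded) (auto elim: eventually_mono)
  qed
qed

text \<open>
  On the nonnegative sphere all entries are at most \<open>1\<close>, so one multiple of \<open>z\<close> dominates the whole sphere and the
  upper estimate is uniform.
\<close>

lemma growth_rate_limit_sup:
  assumes \<rho>: "\<rho> = 1"
  shows "(\<lambda>k. (SUP z\<in>sphere_nonneg d n p. np ((R ^^ k) z)) powr ((1 / S) / real k)) \<longlonglongrightarrow> r"
proof -
  obtain u where u: "u \<in> sphere_nonneg d n p" "eigenpair d n p R r u"
    using spectral_radius_facts(1) \<rho> by auto
  have r0: "0 < r" using spectral_radius_facts(3) \<rho> by simp
  have bound: "np ((R ^^ k) x) \<le> gm (tr (ones d n) z) * gm M ^ k"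
    if z: "z \<in> sphere_pos d n p" and M: "\<And>i j. i < d \<Longrightarrow> j < n i \<Longrightarrow> R z i j \<le> M i * z i j"
      and x: "x \<in> sphere_nonneg d n p" for z M x k
  proof (rule norm_product_funpow_upper[OF \<rho> sphere_nonnegD(2)[OF x] z _ _ M])
    note zp = sphere_posD(2)[OF z]
    show "0 < tr (ones d n) z i" if "i < d" for i by (rule top_ratio_pos'[OF pos_entries_ones zp that])
    show "x i j \<le> tr (ones d n) z i * z i j" if ij: "i < d" "j < n i" for i j
    proof -
      have "x i j \<le> ones d n i j" using sphere_entry_le_1[OF x ij] ij by (simp add: ones_def)
      also have "\<dots> \<le> tr (ones d n) z i * z i j"
        by (rule top_ratio_bound[of j n i z "ones d n", OF ij(2) pos_entriesD[OF zp ij]])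
      finally show ?thesis .
    qed
  qed
  have bdd: "bdd_above ((\<lambda>x. np ((R ^^ k) x)) ` sphere_nonneg d n p)" for k
  proof -
    obtain z M where z: "z \<in> sphere_pos d n p" "\<forall>i<d. \<forall>j<n i. R z i j \<le> M i * z i j"
      using approximate_upper[of 1] \<rho> by auto
    show ?thesis
      by (rule bdd_aboveI2[of _ _ "gm (tr (ones d n) z) * gm M ^ k"]) (rule bound[OF z(1)], use z(2) in auto)
  qed
  show ?thesis
  proof (rule order_tendstoI)
    fix L assume L: "r < L"
    obtain z M where z: "z \<in> sphere_pos d n p" "\<And>i j. i < d \<Longrightarrow> j < n i \<Longrightarrow> R z i j \<le> M i * z i j"
      "0 < gm M" "gm M powr (1 / S) < L"
      using approximate_upper[of "L - r"] \<rho> L by auto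
    show "\<forall>\<^sub>F k in sequentially. (SUP z\<in>sphere_nonneg d n p. np ((R ^^ k) z)) powr ((1 / S) / real k) < L"
    proof (rule eventually_powr_root_less[OF weighted_gm_pos z(3) _ _ _ z(4)])
      show "(SUP z\<in>sphere_nonneg d n p. np ((R ^^ k) z)) \<le> gm (tr (ones d n) z) * gm M ^ k" for k
        using u(1) by (intro cSUP_least bound[OF z(1,2)]) auto
      show "0 \<le> (SUP z\<in>sphere_nonneg d n p. np ((R ^^ k) z))" for k
        using cSUP_upper2[OF bdd u(1), of 0] unfolding norm_product_eq_gm by simp
    qed (use top_ratio_pos'[OF pos_entries_ones sphere_posD(2)[OF z(1)]] S_pos in auto)
  next
    fix L assume L: "L < r"
    have "\<forall>\<^sub>F k in sequentially. L < np ((R ^^ k) u) powr ((1 / S) / real k)"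
      by (rule growth_rate_greater[OF \<rho> sphere_nonnegD(2)[OF u(1)] L u, of "\<lambda>_. 1"]) auto
    then show "\<forall>\<^sub>F k in sequentially. L < (SUP z\<in>sphere_nonneg d n p. np ((R ^^ k) z)) powr ((1 / S) / real k)"
    proof eventually_elim
      case (elim k)
      have "np ((R ^^ k) u) powr ((1 / S) / real k) \<le> (SUP z\<in>sphere_nonneg d n p. np ((R ^^ k) z)) powr ((1 / S) / real k)"
        using S_pos by (intro powr_mono2 cSUP_upper[OF u(1) bdd]) (auto simp: norm_product_eq_gm)
      then show ?case using elim by linarith
    qed
  qed
qed

section \<open>The Collatz-Wielandt functions\<close>

lemma cw_upper_eq: "cw_upper d n R \<gamma> b z = gm (tr (R z) z) powr (\<gamma> - 1)"
  unfolding cw_upper_def weighted_gm_def top_ratio_def by (simp add: prod_powr_distrib powr_powr mult.commute)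

abbreviation "low_ratio_support y i \<equiv> Min ((\<lambda>j. R y i j / y i j) ` {j. j < n i \<and> 0 < y i j})"

lemma cw_lower_eq: "cw_lower d n R \<gamma> b y = gm (low_ratio_support y) powr (\<gamma> - 1)"
  unfolding cw_lower_def weighted_gm_def by (simp add: prod_powr_distrib powr_powr mult.commute)

lemma low_ratio_support_pos_eq:
  assumes "pos_entries d n y" "i < d" shows "low_ratio_support y i = low_ratio y i"
proof -
  have "{j. j < n i \<and> 0 < y i j} = {..<n i}" using pos_entriesD[OF assms] by auto
  then show ?thesis by simp
qed

lemma cw_lower_pos_eq: "pos_entries d n y \<Longrightarrow> cw_lower d n R \<gamma> b y = gm (low_ratio y) powr (\<gamma> - 1)"
  unfolding cw_lower_eq using low_ratio_support_pos_eq weighted_gm_cong[of d "low_ratio_support y" "low_ratio y"] by simp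

lemma low_ratio_support_facts:
  assumes y: "y \<in> sphere_nonneg d n p" and i: "i < d"
  shows "0 \<le> low_ratio_support y i" and "j < n i \<Longrightarrow> low_ratio_support y i * y i j \<le> R y i j"
    and "(\<And>j. j < n i \<Longrightarrow> R y i j = N * y i j) \<Longrightarrow> low_ratio_support y i = N"
proof -
  let ?J = "{j. j < n i \<and> 0 < y i j}"
  have ne: "?J \<noteq> {}" using sphere_nonzero_entry[OF y i] by auto
  have R0: "0 \<le> R y i j" if "j < n i" for j using nonneg_entriesD[OF R_nonneg[OF sphere_nonnegD(2)[OF y]] i that] .
  show "0 \<le> low_ratio_support y i" using ne R0 by (subst Min_ge_iff) (auto intro!: divide_nonneg_pos)
  show "low_ratio_support y i * y i j \<le> R y i j" if j: "j < n i"
  proof (cases "0 < y i j")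
    case True
    then have "low_ratio_support y i \<le> R y i j / y i j" using j by (intro Min_le) auto
    then show ?thesis using True by (simp add: le_divide_eq)
  next
    case False
    then have "y i j = 0" using nonneg_entriesD[OF sphere_nonnegD(2)[OF y] i j] by simp
    then show ?thesis using R0[OF j] by simp
  qed
  show "low_ratio_support y i = N" if N: "\<And>j. j < n i \<Longrightarrow> R y i j = N * y i j"
  proof -
    have "(\<lambda>j. R y i j / y i j) ` ?J = (\<lambda>_. N) ` ?J" using N by (intro image_cong) auto
    then show ?thesis by (simp only: image_constant_conv ne if_False Min_singleton)
  qed
qed

text \<open>
  Zero entries of \<open>y\<close> do not disturb the comparison, because there \<open>m y \<le> R y\<close> holds trivially.
\<close>

lemma cw_lower_le:
  assumes "\<rho> \<le> 1" "y \<in> sphere_nonneg d n p" shows "gm (low_ratio_support y) powr (1 / S) \<le> r"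
proof -
  have "gm (low_ratio_support y) \<le> r powr S" using low_ratio_support_facts[OF assms(2)] by (intro lower_le_spectral_radius[OF assms]) auto
  then have "gm (low_ratio_support y) powr (1 / S) \<le> (r powr S) powr (1 / S)" using S_pos by (intro powr_mono2) auto
  then show ?thesis using powr_S_inverse spectral_radius_facts(3)[OF assms(1)] by simp
qed

lemma cw_lower_eigenvector:
  assumes \<rho>: "\<rho> \<le> 1" and y: "y \<in> sphere_nonneg d n p" "eigenpair d n p R r y"
  shows "gm (low_ratio_support y) powr (1 / S) = r"
proof -
  note r0 = spectral_radius_facts(3)[OF \<rho>]
  have "gm (low_ratio_support y) = gm (\<lambda>i. r powr (conj_exp (p i) - 1))"
    using r0 low_ratio_support_facts(3)[OF y(1)] eigenpair_nonneg_eq[OF y(2)] by (intro weighted_gm_cong) auto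
  then show ?thesis using gm_common_eigenvalue powr_S_inverse r0 by simp
qed

lemma cw_upper_ge:
  assumes "\<rho> \<le> 1" "z \<in> sphere_pos d n p" shows "r \<le> gm (tr (R z) z) powr (1 / S)"
proof -
  have "r powr S \<le> gm (tr (R z) z)"
    using top_ratio_bound[where x = "R z" and n = n] pos_entriesD[OF sphere_posD(2)[OF assms(2)]]
    by (intro spectral_radius_le_upper[OF assms]) auto
  then have "(r powr S) powr (1 / S) \<le> gm (tr (R z) z) powr (1 / S)" using S_pos by (intro powr_mono2) auto
  then show ?thesis using powr_S_inverse spectral_radius_facts(3)[OF assms(1)] by simp
qed

lemma gm_upper_le:
  assumes z: "z \<in> sphere_pos d n p" and M: "\<And>i j. i < d \<Longrightarrow> j < n i \<Longrightarrow> R z i j \<le> M i * z i j"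
  shows "gm (tr (R z) z) \<le> gm M"
proof (rule weighted_gm_mono[OF b_pos])
  note zp = sphere_posD(2)[OF z]
  show "0 \<le> tr (R z) z i" if "i < d" for i using top_ratio_pos'[OF F_pos[OF zp] zp that] by simp
  show "tr (R z) z i \<le> M i" if i: "i < d" for i
    using M[OF i] pos_entriesD[OF zp i] n_pos[OF i] by (subst top_ratio_le_iff) (auto simp: divide_le_eq)
qed

lemma INF_cw_upper:
  assumes \<rho>: "\<rho> \<le> 1" shows "(INF z\<in>sphere_pos d n p. gm (tr (R z) z) powr (1 / S)) = r"
proof (rule cInf_eq_non_empty)
  show "(\<lambda>z. gm (tr (R z) z) powr (1 / S)) ` sphere_pos d n p \<noteq> {}" using sphere_pos_nonempty by auto
  show "r \<le> x" if "x \<in> (\<lambda>z. gm (tr (R z) z) powr (1 / S)) ` sphere_pos d n p" for x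
    using that cw_upper_ge[OF \<rho>] by auto
  show "y \<le> r" if y: "\<And>x. x \<in> (\<lambda>z. gm (tr (R z) z) powr (1 / S)) ` sphere_pos d n p \<Longrightarrow> y \<le> x" for y
  proof (rule field_le_epsilon)
    fix \<epsilon> :: real assume "0 < \<epsilon>"
    then obtain z M where z: "z \<in> sphere_pos d n p" "\<forall>i<d. \<forall>j<n i. R z i j \<le> M i * z i j"
      "gm M powr (1 / S) < r + \<epsilon>" using approximate_upper[OF \<rho>] by blast
    have "gm (tr (R z) z) powr (1 / S) \<le> gm M powr (1 / S)"
      using S_pos z(2) by (intro powr_mono2 gm_upper_le[OF z(1)]) auto
    then show "y \<le> r + \<epsilon>" using y[of "gm (tr (R z) z) powr (1 / S)"] z by force
  qed
qed

lemma cw_limits: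
  assumes \<rho>: "\<rho> \<le> 1" and x: "\<And>k. x k \<in> sphere_pos d n p" and u: "u \<in> sphere_pos d n p"
    and ev: "eigenpair d n p R \<theta> u" and lim: "x \<longlonglongrightarrow> u"
  shows "(\<lambda>k. gm (tr (R (x k)) (x k)) powr (1 / S)) \<longlonglongrightarrow> r"
    and "(\<lambda>k. gm (low_ratio (x k)) powr (1 / S)) \<longlonglongrightarrow> r"
proof -
  note r0 = spectral_radius_facts(3)[OF \<rho>]
  have \<theta>: "\<theta> = r" by (rule positive_eigenvector(1)[OF \<rho> u ev])
  note up = sphere_posD(2)[OF u]
  note xp = sphere_posD(2)[OF x]
  have Rlim: "(\<lambda>k. R (x k)) \<longlonglongrightarrow> R u" by (rule R_cont[OF pos_imp_nonneg_entries[OF xp] lim])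
  have ratio: "R u i j / u i j = r powr (conj_exp (p i) - 1)" if "i < d" "j < n i" for i j
    using eigenpair_nonneg_eq[OF ev _ that] \<theta> r0 pos_entriesD[OF up that] by simp
  have "(\<lambda>k. gm (tr (R (x k)) (x k))) \<longlonglongrightarrow> gm (tr (R u) u)"
    using top_ratio_pos'[OF F_pos[OF xp] xp] tendsto_top_ratio[OF Rlim lim up] b_pos
    unfolding weighted_gm_def by (intro tendsto_prod tendsto_powr') (auto simp: less_imp_le)
  moreover have "gm (tr (R u) u) = r powr S"
  proof -
    have "tr (R u) u i = r powr (conj_exp (p i) - 1)" if i: "i < d" for i
      using top_ratio_attained[of n i "R u" u] n_pos[OF i] ratio[OF i] by auto
    then have "gm (tr (R u) u) = gm (\<lambda>i. r powr (conj_exp (p i) - 1))" by (intro weighted_gm_cong)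
    then show ?thesis using gm_common_eigenvalue r0 by simp
  qed
  ultimately have "(\<lambda>k. gm (tr (R (x k)) (x k)) powr (1 / S)) \<longlonglongrightarrow> (r powr S) powr (1 / S)"
    using r0 by (intro tendsto_powr) auto
  then show "(\<lambda>k. gm (tr (R (x k)) (x k)) powr (1 / S)) \<longlonglongrightarrow> r" using powr_S_inverse r0 by simp
  have lowlim: "(\<lambda>k. low_ratio (x k) i) \<longlonglongrightarrow> low_ratio u i" if i: "i < d" for i
  proof (rule tendsto_Min_image)
    show "{..<n i} \<noteq> {}" using n_pos[OF i] by auto
    show "(\<lambda>k. R (x k) i j / x k i j) \<longlonglongrightarrow> R u i j / u i j" if "j \<in> {..<n i}" for j
    proof (rule tendsto_divide)
      show "(\<lambda>k. R (x k) i j) \<longlonglongrightarrow> R u i j" "(\<lambda>k. x k i j) \<longlonglongrightarrow> u i j"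
        using Rlim lim by (simp_all add: blockvec_tendsto_iff)
      show "u i j \<noteq> 0" using pos_entriesD[OF up i, of j] that by simp
    qed
  qed simp
  have "(\<lambda>k. gm (low_ratio (x k))) \<longlonglongrightarrow> gm (low_ratio u)"
    using low_ratio_pos[OF xp] lowlim b_pos
    unfolding weighted_gm_def by (intro tendsto_prod tendsto_powr') (auto simp: less_imp_le)
  moreover have "gm (low_ratio u) = r powr S"
  proof -
    have "gm (low_ratio u) = gm (low_ratio_support u)" using low_ratio_support_pos_eq[OF up] by (intro weighted_gm_cong) simp
    moreover have "gm (low_ratio_support u) powr (1 / S) = r"
      using cw_lower_eigenvector[OF \<rho> sphere_pos_subset_nonneg[OF u]] ev \<theta> by simp
    ultimately have "(gm (low_ratio u) powr (1 / S)) powr S = r powr S" by simp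
    then show ?thesis using S_pos by (simp add: powr_powr)
  qed
  ultimately have "(\<lambda>k. gm (low_ratio (x k)) powr (1 / S)) \<longlonglongrightarrow> (r powr S) powr (1 / S)"
    using r0 by (intro tendsto_powr) auto
  then show "(\<lambda>k. gm (low_ratio (x k)) powr (1 / S)) \<longlonglongrightarrow> r" using powr_S_inverse r0 by simp
qed

end

context weighted_tensor
begin

section \<open>The Perron-Frobenius theorem\<close>

theorem contractive_case:
  assumes \<rho>: "\<rho> < 1" and x0: "x 0 \<in> sphere_pos d n p" and x: "\<And>k. x (Suc k) = nrm (R (x k))"
  shows "\<exists>\<theta> u. u \<in> sphere_pos d n p \<and> 0 < \<theta> \<and> eigenpair d n p R \<theta> u \<and>
    (\<forall>\<theta>' u'. u' \<in> sphere_pos d n p \<and> 0 < \<theta>' \<and> eigenpair d n p R \<theta>' u' \<longrightarrow> \<theta>' = \<theta> \<and> u' = u) \<and>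
    \<theta> = r \<and> x \<longlonglongrightarrow> u \<and>
    (\<forall>k\<ge>1. mu d n b (x k) u \<le> mu d n b (x 1) (x 0) / (1 - \<rho>) * \<rho> ^ k)"
proof -
  have \<rho>1: "\<rho> \<le> 1" and \<rho>n: "\<rho> \<noteq> 1" using \<rho> by auto
  obtain u where u: "u \<in> sphere_pos d n p" "G u = u" "x \<longlonglongrightarrow> u"
    "\<forall>k. mu d n b (x k) u \<le> mu d n b (x 1) (x 0) / (1 - \<rho>) * \<rho> ^ k"
    using contraction_fixed_point[of x, OF \<rho> x0 x] by blast
  have ev: "eigenpair d n p R r u" by (rule eigenpair_r_if_fixed_point[OF \<rho>1 u(1,2)])
  have unique: "\<theta>' = r \<and> u' = u" if u': "u' \<in> sphere_pos d n p" "eigenpair d n p R \<theta>' u'" for \<theta>' u'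
  proof -
    have "\<theta>' = r" by (rule positive_eigenvector(1)[OF \<rho>1 u'])
    moreover have "u' = u"
      using eigenvector_unique[OF \<rho>1 _ u(1) ev sphere_pos_subset_nonneg[OF u'(1)]] \<rho>n u'(2) calculation by blast
    ultimately show ?thesis by simp
  qed
  show ?thesis
  proof (intro exI[of _ r] exI[of _ u] conjI)
    show "\<forall>\<theta>' u'. u' \<in> sphere_pos d n p \<and> 0 < \<theta>' \<and> eigenpair d n p R \<theta>' u' \<longrightarrow> \<theta>' = r \<and> u' = u"
      using unique by blast
    show "\<forall>k\<ge>1. mu d n b (x k) u \<le> mu d n b (x 1) (x 0) / (1 - \<rho>) * \<rho> ^ k" using u(4) by blast
  qed (use u ev spectral_radius_facts(3)[OF \<rho>1] in simp_all)
qed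

theorem nonexpansive_eigenvector:
  assumes \<rho>: "\<rho> = 1" and x0: "x 0 \<in> sphere_pos d n p" and x: "\<And>k. x (Suc k) = nrm (R (x k))"
  shows "\<exists>u\<in>sphere_nonneg d n p. eigenpair d n p R r u \<and>
    (irreducible_matrix DR \<longrightarrow> u \<in> sphere_pos d n p \<and>
      (\<forall>v\<in>sphere_pos d n p. map_eigenvector d n p R v \<longrightarrow> v = u) \<and>
      (primitive_matrix DR \<longrightarrow> x \<longlonglongrightarrow> u))"
proof -
  have \<rho>1: "\<rho> \<le> 1" using \<rho> by simp
  show ?thesis
  proof (cases "irreducible_matrix DR")
    case False
    then show ?thesis using spectral_radius_facts(1)[OF \<rho>1] by blast
  next
    case True
    note conn = irreducible_strongly_connected[OF True]
    obtain u where u: "u \<in> sphere_pos d n p" "eigenpair d n p R r u"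
      using positive_eigenvector_exists[OF \<rho>1 conn] by blast
    have unique: "v = u" if v: "v \<in> sphere_pos d n p" "map_eigenvector d n p R v" for v
    proof -
      obtain \<theta> where "eigenpair d n p R \<theta> v" using v(2) unfolding map_eigenvector_def by blast
      moreover then have "\<theta> = r" by (rule positive_eigenvector(1)[OF \<rho>1 v(1)])
      ultimately have "eigenpair d n p R r v" by simp
      then show ?thesis by (rule eigenvector_unique[OF \<rho>1 conn u sphere_pos_subset_nonneg[OF v(1)]])
    qed
    have conv: "x \<longlonglongrightarrow> u" if prim: "primitive_matrix DR"
    proof -
      obtain K where K: "\<forall>c\<in>coord_set d n. \<forall>c'\<in>coord_set d n. (c, c') \<in> edges ^^ K"
        using primitive_imp_relpow[OF prim] by blast
      show ?thesis
      proof (rule primitive_convergence[of K u x])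
        show "(c, c') \<in> edges ^^ K" if "c \<in> coord_set d n" "c' \<in> coord_set d n" for c c' using K that by blast
        show "G u = u" by (rule positive_eigenvector(2)[OF \<rho>1 u])
      qed (fact \<rho> u(1) x0 x)+
    qed
    show ?thesis
      by (intro bexI[of _ u] conjI impI ballI u(2) u(1) sphere_pos_subset_nonneg[OF u(1)] unique conv)
  qed
qed

text \<open>
  An eigenvector for \<open>r\<close> would coincide with the positive one.
\<close>

lemma nonpositive_eigenvalue_less:
  assumes \<rho>: "\<rho> \<le> 1" and irr: "irreducible_matrix DR"
    and w: "w \<in> sphere_nonneg d n p" "eigenpair d n p R \<theta> w" "w \<notin> sphere_pos d n p"
  shows "\<theta> < r"
proof (rule ccontr)
  assume "\<not> \<theta> < r"
  moreover have "\<theta> \<le> r" using spectral_radius_facts(2)[OF \<rho> w(2)] by simp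
  ultimately have "\<theta> = r" by simp
  note conn = irreducible_strongly_connected[OF irr]
  obtain u where u: "u \<in> sphere_pos d n p" "eigenpair d n p R r u"
    using positive_eigenvector_exists[OF \<rho> conn] by blast
  have "w = u" using w(2) \<open>\<theta> = r\<close> eigenvector_unique[OF \<rho> conn u w(1)] by simp
  with u w(3) show False by simp
qed

theorem nonexpansive_case:
  assumes \<rho>: "\<rho> = 1" and x0: "x 0 \<in> sphere_pos d n p" and x: "\<And>k. x (Suc k) = nrm (R (x k))"
    and \<gamma>: "\<gamma> - 1 = 1 / S"
  shows "(\<exists>u\<in>sphere_nonneg d n p. eigenpair d n p R r u \<and>
      (irreducible_matrix DR \<longrightarrow> u \<in> sphere_pos d n p \<and>
        (\<forall>v\<in>sphere_pos d n p. map_eigenvector d n p R v \<longrightarrow> v = u) \<and>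
        (primitive_matrix DR \<longrightarrow> x \<longlonglongrightarrow> u))) \<and>
    (\<forall>y\<in>sphere_pos d n p. (\<lambda>k. np ((R ^^ k) y) powr ((\<gamma> - 1) / real k)) \<longlonglongrightarrow> r) \<and>
    ereal r = (SUP z\<in>cone_nonzero d n. limsup (\<lambda>k. ereal (np ((R ^^ k) z) powr ((\<gamma> - 1) / real k)))) \<and>
    (\<lambda>k. (SUP z\<in>sphere_nonneg d n p. np ((R ^^ k) z)) powr ((\<gamma> - 1) / real k)) \<longlonglongrightarrow> r"
  unfolding \<gamma>
  by (intro conjI ballI nonexpansive_eigenvector[of x, OF \<rho> x0 x] growth_rate_positive[OF \<rho>]
      growth_rate_sup_limsup[OF \<rho>] growth_rate_limit_sup[OF \<rho>])

theorem collatz_wielandt_case: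
  assumes \<rho>: "\<rho> \<le> 1" and x0: "x 0 \<in> sphere_pos d n p" and x: "\<And>k. x (Suc k) = nrm (R (x k))"
    and \<gamma>: "\<gamma> - 1 = 1 / S"
  shows "(INF z\<in>sphere_pos d n p. cw_upper d n R \<gamma> b z) = r \<and>
    (\<exists>y\<in>sphere_nonneg d n p. cw_lower d n R \<gamma> b y = r) \<and>
    (\<forall>y\<in>sphere_nonneg d n p. cw_lower d n R \<gamma> b y \<le> r) \<and>
    (\<forall>k\<ge>1. cw_lower d n R \<gamma> b (x k) \<le> cw_lower d n R \<gamma> b (x (k + 1)) \<and>
           cw_lower d n R \<gamma> b (x (k + 1)) \<le> r \<and>
           r \<le> cw_upper d n R \<gamma> b (x (k + 1)) \<and>
           cw_upper d n R \<gamma> b (x (k + 1)) \<le> cw_upper d n R \<gamma> b (x k)) \<and>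
    (\<forall>\<epsilon>>0. \<forall>k\<ge>1. cw_upper d n R \<gamma> b (x k) - cw_lower d n R \<gamma> b (x k) < \<epsilon> \<longrightarrow>
       \<bar>(cw_upper d n R \<gamma> b (x k) + cw_lower d n R \<gamma> b (x k)) / 2 - r\<bar> \<le> \<epsilon> / 2) \<and>
    (\<forall>u\<in>sphere_pos d n p. map_eigenvector d n p R u \<and> x \<longlonglongrightarrow> u \<longrightarrow>
       (\<lambda>k. cw_upper d n R \<gamma> b (x k)) \<longlonglongrightarrow> r \<and> (\<lambda>k. cw_lower d n R \<gamma> b (x k)) \<longlonglongrightarrow> r) \<and>
    (irreducible_matrix DR \<longrightarrow>
       (\<forall>\<theta> w. 0 \<le> \<theta> \<and> w \<in> sphere_nonneg d n p \<and> eigenpair d n p R \<theta> w \<and>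
          w \<notin> sphere_pos d n p \<longrightarrow> \<theta> < r))"
proof -
  have xs: "x k \<in> sphere_pos d n p" for k by (rule iterates_in_sphere[of x, OF x0 x])
  note xp = sphere_posD(2)[OF xs]
  have lower: "cw_lower d n R \<gamma> b y \<le> r" if "y \<in> sphere_nonneg d n p" for y
    unfolding cw_lower_eq \<gamma> by (rule cw_lower_le[OF \<rho> that])
  have upper: "r \<le> cw_upper d n R \<gamma> b z" if "z \<in> sphere_pos d n p" for z
    unfolding cw_upper_eq \<gamma> by (rule cw_upper_ge[OF \<rho> that])
  have inf: "(INF z\<in>sphere_pos d n p. cw_upper d n R \<gamma> b z) = r"
    unfolding cw_upper_eq \<gamma> by (rule INF_cw_upper[OF \<rho>])
  have attained: "\<exists>y\<in>sphere_nonneg d n p. cw_lower d n R \<gamma> b y = r"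
    unfolding cw_lower_eq \<gamma> using spectral_radius_facts(1)[OF \<rho>] cw_lower_eigenvector[OF \<rho>] by blast
  have lower_mono: "cw_lower d n R \<gamma> b (x k) \<le> cw_lower d n R \<gamma> b (x (Suc k))" for k
    unfolding cw_lower_pos_eq[OF xp] \<gamma>
    by (rule powr_mono2) (use S_pos lower_step[OF \<rho> xs, of k] x[of k] in auto)
  have upper_mono: "cw_upper d n R \<gamma> b (x (Suc k)) \<le> cw_upper d n R \<gamma> b (x k)" for k
    unfolding cw_upper_eq \<gamma>
    by (rule powr_mono2) (use S_pos upper_step[OF \<rho> xs, of k] x[of k] in auto)
  have mid: "\<bar>(cw_upper d n R \<gamma> b (x k) + cw_lower d n R \<gamma> b (x k)) / 2 - r\<bar> \<le> \<epsilon> / 2"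
    if "cw_upper d n R \<gamma> b (x k) - cw_lower d n R \<gamma> b (x k) < \<epsilon>" for \<epsilon> k
    using that lower[OF sphere_pos_subset_nonneg[OF xs[of k]]] upper[OF xs[of k]] by (simp add: abs_le_iff field_simps)
  have limits: "(\<lambda>k. cw_upper d n R \<gamma> b (x k)) \<longlonglongrightarrow> r \<and> (\<lambda>k. cw_lower d n R \<gamma> b (x k)) \<longlonglongrightarrow> r"
    if u: "u \<in> sphere_pos d n p" and ev: "map_eigenvector d n p R u" and lim: "x \<longlonglongrightarrow> u" for u
  proof -
    obtain \<theta> where "eigenpair d n p R \<theta> u" using ev unfolding map_eigenvector_def by blast
    from cw_limits[of x, OF \<rho> xs u this lim] show ?thesis
      unfolding cw_upper_eq cw_lower_pos_eq[OF xp] \<gamma> by (rule conjI)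
  qed
  have step: "cw_lower d n R \<gamma> b (x k) \<le> cw_lower d n R \<gamma> b (x (k + 1)) \<and>
      cw_lower d n R \<gamma> b (x (k + 1)) \<le> r \<and> r \<le> cw_upper d n R \<gamma> b (x (k + 1)) \<and>
      cw_upper d n R \<gamma> b (x (k + 1)) \<le> cw_upper d n R \<gamma> b (x k)" for k
    using lower_mono[of k] upper_mono[of k] lower[OF sphere_pos_subset_nonneg[OF xs[of "Suc k"]]] upper[OF xs[of "Suc k"]]
    by simp
  have limits': "\<forall>u\<in>sphere_pos d n p. map_eigenvector d n p R u \<and> x \<longlonglongrightarrow> u \<longrightarrow>
      (\<lambda>k. cw_upper d n R \<gamma> b (x k)) \<longlonglongrightarrow> r \<and> (\<lambda>k. cw_lower d n R \<gamma> b (x k)) \<longlonglongrightarrow> r"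
    using limits by blast
  have less: "\<theta> < r" if "irreducible_matrix DR"
      and w: "0 \<le> \<theta> \<and> w \<in> sphere_nonneg d n p \<and> eigenpair d n p R \<theta> w \<and> w \<notin> sphere_pos d n p" for \<theta> w
    using w by (intro nonpositive_eigenvalue_less[OF \<rho> that(1), of w]) auto
  show ?thesis
    by (rule conjI[OF inf], rule conjI[OF attained], rule conjI, rule ballI, erule lower, rule conjI,
        rule allI, rule impI, rule step, rule conjI, rule allI, rule impI, rule allI, rule impI, rule impI,
        erule mid, rule conjI[OF limits'], rule impI, rule allI, rule allI, rule impI, erule (1) less)
qed

end

theorem theorem6p2:
  fixes d :: nat and \<nu> n :: "nat \<Rightarrow> nat" and p :: "nat \<Rightarrow> real" and t :: "(nat \<Rightarrow> nat) \<Rightarrow> real"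
    and R :: "blockvec \<Rightarrow> blockvec" and A :: "real mat" and \<rho> r :: real
    and DR1 :: "real mat" and x :: "nat \<Rightarrow> blockvec"
  assumes "1 \<le> d"
    and "\<forall>i<d. 1 \<le> \<nu> i"
    and "2 \<le> (\<Sum>i<d. \<nu> i)"
    and "\<forall>i<d. 1 \<le> n i"
    and "\<forall>i<d. 1 < p i"
    and "\<forall>j\<in>multi_indices d \<nu> n. 0 \<le> t j"
    and "R = tensor_map d \<nu> n p t"
    and "pos_entries d n (R (ones d n))"
    and "A = homogeneity_matrix d \<nu> p"
    and "\<rho> = spectral_radius (map_mat complex_of_real A)"
    and "r = map_spectral_radius d n p R"
    and "DR1 = jacobian_matrix d n R (ones d n)"
    and "x 0 \<in> sphere_pos d n p"
    and "\<forall>k. x (Suc k) = normalize_blocks d n p (R (x k))"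
  shows "(\<forall>k. x k \<in> sphere_pos d n p) \<and>
    (\<exists>!b. weight_vector d A \<rho> b) \<and>
    (\<forall>b \<gamma>. weight_vector d A \<rho> b \<and>
        \<gamma> = inverse ((\<Sum>i<d. b $ i * conj_exp (p i)) - 1) * (\<Sum>i<d. b $ i * conj_exp (p i)) \<longrightarrow>
      1 < \<gamma> \<and>
      \<comment> \<open>(1) contractive case\<close>
      (\<rho> < 1 \<longrightarrow>
        (\<exists>\<theta> u. u \<in> sphere_pos d n p \<and> 0 < \<theta> \<and> eigenpair d n p R \<theta> u \<and>
          (\<forall>\<theta>' u'. u' \<in> sphere_pos d n p \<and> 0 < \<theta>' \<and> eigenpair d n p R \<theta>' u'
             \<longrightarrow> \<theta>' = \<theta> \<and> u' = u) \<and>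
          \<theta> = r \<and>
          x \<longlonglongrightarrow> u \<and>
          (\<forall>k\<ge>1. mu d n b (x k) u \<le> mu d n b (x 1) (x 0) / (1 - \<rho>) * \<rho> ^ k))) \<and>
      \<comment> \<open>(2) non-expansive case\<close>
      (\<rho> = 1 \<longrightarrow>
        (\<exists>u\<in>sphere_nonneg d n p. eigenpair d n p R r u \<and>
          (irreducible_matrix DR1 \<longrightarrow>
            u \<in> sphere_pos d n p \<and>
            (\<forall>v\<in>sphere_pos d n p. map_eigenvector d n p R v \<longrightarrow> v = u) \<and>
            (primitive_matrix DR1 \<longrightarrow> x \<longlonglongrightarrow> u))) \<and>
        (\<forall>y\<in>sphere_pos d n p.
          (\<lambda>k. norm_product d n p b ((R ^^ k) y) powr ((\<gamma> - 1) / real k)) \<longlonglongrightarrow> r) \<and>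
        ereal r = (SUP z\<in>cone_nonzero d n.
          limsup (\<lambda>k. ereal (norm_product d n p b ((R ^^ k) z) powr ((\<gamma> - 1) / real k)))) \<and>
        (\<lambda>k. (SUP z\<in>sphere_nonneg d n p. norm_product d n p b ((R ^^ k) z))
               powr ((\<gamma> - 1) / real k)) \<longlonglongrightarrow> r) \<and>
      \<comment> \<open>(3) Collatz-Wielandt principle\<close>
      (\<rho> \<le> 1 \<longrightarrow>
        (INF z\<in>sphere_pos d n p. cw_upper d n R \<gamma> b z) = r \<and>
        (\<exists>y\<in>sphere_nonneg d n p. cw_lower d n R \<gamma> b y = r) \<and>
        (\<forall>y\<in>sphere_nonneg d n p. cw_lower d n R \<gamma> b y \<le> r) \<and>
        (\<forall>k\<ge>1. cw_lower d n R \<gamma> b (x k) \<le> cw_lower d n R \<gamma> b (x (k + 1)) \<and>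
               cw_lower d n R \<gamma> b (x (k + 1)) \<le> r \<and>
               r \<le> cw_upper d n R \<gamma> b (x (k + 1)) \<and>
               cw_upper d n R \<gamma> b (x (k + 1)) \<le> cw_upper d n R \<gamma> b (x k)) \<and>
        (\<forall>\<epsilon>>0. \<forall>k\<ge>1. cw_upper d n R \<gamma> b (x k) - cw_lower d n R \<gamma> b (x k) < \<epsilon> \<longrightarrow>
           \<bar>(cw_upper d n R \<gamma> b (x k) + cw_lower d n R \<gamma> b (x k)) / 2 - r\<bar> \<le> \<epsilon> / 2) \<and>
        (\<forall>u\<in>sphere_pos d n p. map_eigenvector d n p R u \<and> x \<longlonglongrightarrow> u \<longrightarrow>
           (\<lambda>k. cw_upper d n R \<gamma> b (x k)) \<longlonglongrightarrow> r \<and>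
           (\<lambda>k. cw_lower d n R \<gamma> b (x k)) \<longlonglongrightarrow> r) \<and>
        (irreducible_matrix DR1 \<longrightarrow>
           (\<forall>\<theta> w. 0 \<le> \<theta> \<and> w \<in> sphere_nonneg d n p \<and> eigenpair d n p R \<theta> w \<and>
              w \<notin> sphere_pos d n p \<longrightarrow> \<theta> < r)))) \<and>
    \<comment> \<open>(4) irreducible tensors\<close>
    ((\<forall>y\<in>sphere_nonneg d n p. \<exists>\<kappa>\<ge>1.
        pos_entries d n (((\<lambda>z i j. z i j + R z i j) ^^ \<kappa>) y)) \<longrightarrow>
      (\<forall>v\<in>sphere_nonneg d n p. map_eigenvector d n p R v \<longrightarrow> v \<in> sphere_pos d n p) \<and>
      (\<forall>u\<in>sphere_pos d n p. map_eigenvector d n p R u \<and>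
          (\<forall>v\<in>sphere_pos d n p. map_eigenvector d n p R v \<longrightarrow> v = u) \<longrightarrow>
        (\<forall>v\<in>sphere_nonneg d n p. map_eigenvector d n p R v \<longrightarrow> v = u)))"
proof -
  interpret T: nonneg_tensor d \<nu> n p t
    using assms(1-6,8) unfolding assms(7) by unfold_locales auto
  have \<rho>: "0 < \<rho>" "\<exists>b. weight_vector d A \<rho> b"
    using T.spectral_radius_weight_vector[of \<rho>] assms(9,10) by auto
  have locale_W: "weighted_tensor d \<nu> n p t b \<rho>" if "weight_vector d A \<rho> b" for b
    using that \<rho>(1) unfolding assms(9) by unfold_locales
  have x0: "x 0 \<in> sphere_pos d n p" and x: "x (Suc k) = normalize_blocks d n p (T.R (x k))" for k
    using assms(7,13,14) by auto
  obtain b0 where b0: "weight_vector d A \<rho> b0" using \<rho>(2) by blast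
  interpret W0: weighted_tensor d \<nu> n p t b0 \<rho> by (rule locale_W[OF b0])
  have xs: "x k \<in> sphere_pos d n p" for k by (rule W0.iterates_in_sphere[of x, OF x0 x])
  have unique: "\<exists>!b. weight_vector d A \<rho> b"
  proof (rule ex1I)
    show "weight_vector d A \<rho> b0" by (rule b0)
    show "b = b0" if "weight_vector d A \<rho> b" for b
      using T.weight_vector_unique[OF \<rho>(1)] that b0 assms(9) by simp
  qed
  show ?thesis
    unfolding assms(7,11,12)
  proof (intro conjI, goal_cases)
    case 1
    show ?case using xs by blast
  next
    case 2
    show ?case by (rule unique)
  next
    case 3
    show ?case
    proof (intro allI impI, goal_cases)
      case (1 b \<gamma>)
      then have b: "weight_vector d A \<rho> b"
        and \<gamma>: "\<gamma> = inverse ((\<Sum>i<d. b $ i * conj_exp (p i)) - 1) * (\<Sum>i<d. b $ i * conj_exp (p i))"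
        by blast+
      interpret W: weighted_tensor d \<nu> n p t b \<rho> by (rule locale_W[OF b])
      have P: "(\<Sum>i<d. b $ i * conj_exp (p i)) = W.S + 1" using W.S_eq by simp
      have "\<gamma> = 1 + 1 / W.S" unfolding \<gamma> P using W.S_pos by (simp add: field_simps)
      then have g: "\<gamma> - 1 = 1 / W.S" "1 < \<gamma>" using W.S_pos by simp_all
      note cases = W.contractive_case[of x, OF _ x0 x, unfolded W.r_def]
        W.nonexpansive_case[of x \<gamma>, OF _ x0 x g(1), unfolded W.r_def]
        W.collatz_wielandt_case[of x \<gamma>, OF _ x0 x g(1), unfolded W.r_def]
      show ?case
        by (rule conjI, rule g(2), rule conjI, rule impI, erule cases(1), rule conjI, rule impI,
            erule cases(2), rule impI, erule cases(3))
    qed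
  next
    case 4
    show ?case
    proof (rule impI)
      assume irr: "\<forall>y\<in>sphere_nonneg d n p. \<exists>\<kappa>\<ge>1. pos_entries d n (((\<lambda>z i j. z i j + T.R z i j) ^^ \<kappa>) y)"
      have pos: "v \<in> sphere_pos d n p" if v: "v \<in> sphere_nonneg d n p" "map_eigenvector d n p T.R v" for v
      proof -
        obtain \<kappa> where "pos_entries d n (((\<lambda>z i j. z i j + T.R z i j) ^^ \<kappa>) v)" using irr v(1) by blast
        then show ?thesis by (rule T.nonneg_eigenvector_positive[OF v])
      qed
      then show "(\<forall>v\<in>sphere_nonneg d n p. map_eigenvector d n p T.R v \<longrightarrow> v \<in> sphere_pos d n p) \<and>
        (\<forall>u\<in>sphere_pos d n p. map_eigenvector d n p T.R u \<and>
            (\<forall>v\<in>sphere_pos d n p. map_eigenvector d n p T.R v \<longrightarrow> v = u) \<longrightarrow>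
          (\<forall>v\<in>sphere_nonneg d n p. map_eigenvector d n p T.R v \<longrightarrow> v = u))"
        by blast
    qed
  qed
qed

end
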